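(* Let $k$ be an algebraically closed field of characteristic $p>0$ and let $G=SL_2(k)$. Let $r,s\in\mathbb{N}$ be such that they are not both $p$-restricted, i.e. $r$ and $s$ do not both lie in $\{0,1,\ldots,p-1\}$. Then the $G$-module $\nabla(r)\otimes\nabla(s)$ is a tilting module if and only if at least one of $r$ and $s$ is equal to $ap^n-1$ for some $a\in\{1,\ldots,p-1\}$ and $n\in\mathbb{N}$, and the other is strictly less than $p^{n+1}-1$ (for the same $n$).
   Context: Here $\mathbb{N}=\{1,2,3,\ldots\}$. "Module" means a finite dimensional rational module for the algebraic group $G=SL_2(k)$. Let $B$ be the Borel subgroup of lower triangular matrices and $T\subset B$ the maximal torus of diagonal matrices. The weight lattice $X(T)$ is identified with $\mathbb{Z}$ so that $r\in\mathbb{Z}$ sends $\mathrm{diag}(t,t^{-1})$ to $t^r$; the dominant weights are then the integers $r\geq 0$. For $r\ge 0$, $\nabla(r)=\mathrm{Ind}_B^G(k_r)$ is the induced module of highest weight $r$, where $k_r$ is the one dimensional $B$-module on which $T$ acts via $r$; it is isomorphic to the symmetric power $S^rE$ of the natural two dimensional $G$-module $E$. The Weyl module is $\Delta(r)=\nabla(r)^*$. A good filtration (resp. Weyl filtration) of a module is a finite filtration by submodules whose successive quotients are each either zero or isomorphic to some $\nabla(r)$ (resp. some $\Delta(r)$) with $r\ge 0$. A tilting module is a module that has both a good filtration and a Weyl filtration. *)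

theory Defs
  imports
    "HOL-Analysis.Determinants"
    "HOL-Library.Function_Algebras"
    "HOL-Computational_Algebra.Polynomial"
begin

section \<open>The group $SL_2(k)$ and its coordinate ring\<close>

definition SL2 :: "('k::field ^ 2 ^ 2) set" where
  "SL2 = {g. det g = 1}"

text \<open>Lower triangular matrices; \<open>g $ i $ j\<close> is the entry in row \<open>i\<close> and column \<open>j\<close>.\<close>

definition borel2 :: "('k::field ^ 2 ^ 2) set" where
  "borel2 = {g \<in> SL2. g $ 1 $ 2 = 0}"

text \<open>A function on the group is represented by a function on all matrices that vanishes
  off \<open>SL2\<close>.  The regular functions are the subalgebra generated by the matrix entries.\<close>

definition on_SL2 :: "('k::field ^ 2 ^ 2 \<Rightarrow> 'k) \<Rightarrow> 'k ^ 2 ^ 2 \<Rightarrow> 'k" where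
  "on_SL2 f = (\<lambda>g. if g \<in> SL2 then f g else 0)"

inductive_set regular_functions :: "('k::field ^ 2 ^ 2 \<Rightarrow> 'k) set" where
  const: "on_SL2 (\<lambda>_. c) \<in> regular_functions"
| entry: "on_SL2 (\<lambda>g. g $ i $ j) \<in> regular_functions"
| add: "\<lbrakk>f \<in> regular_functions; h \<in> regular_functions\<rbrakk>
    \<Longrightarrow> (\<lambda>g. f g + h g) \<in> regular_functions"
| mult: "\<lbrakk>f \<in> regular_functions; h \<in> regular_functions\<rbrakk>
    \<Longrightarrow> (\<lambda>g. f g * h g) \<in> regular_functions"


section \<open>Rational modules\<close>

text \<open>The underlying space of a module is a subspace \<open>vecs\<close> of an ambient vector space on the
  type \<open>'v\<close>.  Only the values of \<open>act\<close> on \<open>SL2\<close> and \<open>vecs\<close> are relevant.\<close>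

record ('k, 'v) gmodule =
  vecs :: "'v set"
  scal :: "'k \<Rightarrow> 'v \<Rightarrow> 'v"
  act :: "'k ^ 2 ^ 2 \<Rightarrow> 'v \<Rightarrow> 'v"

definition linear_within ::
  "'v set \<Rightarrow> ('k \<Rightarrow> 'v \<Rightarrow> 'v) \<Rightarrow> ('k \<Rightarrow> 'w \<Rightarrow> 'w) \<Rightarrow> ('v::ab_group_add \<Rightarrow> 'w::ab_group_add) \<Rightarrow> bool"
  where
  "linear_within V s t f \<longleftrightarrow>
     (\<forall>v\<in>V. \<forall>w\<in>V. f (v + w) = f v + f w) \<and> (\<forall>c. \<forall>v\<in>V. f (s c v) = t c (f v))"

text \<open>The last clause says that the matrix coefficients are regular functions.\<close>

definition rational_module :: "('k::field, 'v::ab_group_add) gmodule \<Rightarrow> bool" where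
  "rational_module M \<longleftrightarrow>
     vector_space (scal M) \<and>
     module.subspace (scal M) (vecs M) \<and>
     (\<exists>B. finite B \<and> vecs M = module.span (scal M) B) \<and>
     (\<forall>g\<in>SL2. act M g ` vecs M \<subseteq> vecs M \<and> linear_within (vecs M) (scal M) (scal M) (act M g)) \<and>
     (\<forall>v\<in>vecs M. act M (mat 1) v = v) \<and>
     (\<forall>g\<in>SL2. \<forall>h\<in>SL2. \<forall>v\<in>vecs M. act M (g ** h) v = act M g (act M h v)) \<and>
     (\<forall>\<phi>. linear_within (vecs M) (scal M) (*) \<phi> \<longrightarrow>
        (\<forall>v\<in>vecs M. on_SL2 (\<lambda>g. \<phi> (act M g v)) \<in> regular_functions))"

definition submodule_of :: "'v set \<Rightarrow> ('k::field, 'v::ab_group_add) gmodule \<Rightarrow> bool" where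
  "submodule_of U M \<longleftrightarrow>
     module.subspace (scal M) U \<and> U \<subseteq> vecs M \<and> (\<forall>g\<in>SL2. act M g ` U \<subseteq> U)"

definition coset :: "'v set \<Rightarrow> 'v::ab_group_add \<Rightarrow> 'v set" where
  "coset U v = (\<lambda>u. v + u) ` U"

text \<open>For submodules \<open>U \<subseteq> V\<close> of \<open>M\<close>, the quotient \<open>V / U\<close>, with its operations
  induced on cosets, is isomorphic to \<open>N\<close> as a module.\<close>

definition quotient_iso ::
  "('k::field, 'v::ab_group_add) gmodule \<Rightarrow> 'v set \<Rightarrow> 'v set
     \<Rightarrow> ('k, 'w::ab_group_add) gmodule \<Rightarrow> bool"
  where
  "quotient_iso M V U N \<longleftrightarrow>
     (\<exists>F. bij_betw F (coset U ` V) (vecs N) \<and>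
        (\<forall>v\<in>V. \<forall>w\<in>V. F (coset U (v + w)) = F (coset U v) + F (coset U w)) \<and>
        (\<forall>c. \<forall>v\<in>V. F (coset U (scal M c v)) = scal N c (F (coset U v))) \<and>
        (\<forall>g\<in>SL2. \<forall>v\<in>V. F (coset U (act M g v)) = act N g (F (coset U v))))"


section \<open>Duals and tensor products\<close>

definition fscal :: "'k::field \<Rightarrow> ('x \<Rightarrow> 'k) \<Rightarrow> 'x \<Rightarrow> 'k" where
  "fscal c f = (\<lambda>x. c * f x)"

lemma vector_space_fscal: "vector_space fscal"
  by standard (auto simp: fscal_def fun_eq_iff algebra_simps)

text \<open>Linear forms on \<open>vecs M\<close> are extended by zero to the ambient type.\<close>

definition dual :: "('k::field, 'v::ab_group_add) gmodule \<Rightarrow> ('k, 'v \<Rightarrow> 'k) gmodule" where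
  "dual M = \<lparr>
     vecs = {\<phi>. linear_within (vecs M) (scal M) (*) \<phi> \<and> (\<forall>v. v \<notin> vecs M \<longrightarrow> \<phi> v = 0)},
     scal = fscal,
     act = (\<lambda>g \<phi> v. if v \<in> vecs M then \<phi> (act M (matrix_inv g) v) else 0)\<rparr>"

definition bilinear_form ::
  "('k::field, 'v::ab_group_add) gmodule \<Rightarrow> ('k, 'w::ab_group_add) gmodule
     \<Rightarrow> ('v \<Rightarrow> 'w \<Rightarrow> 'k) \<Rightarrow> bool"
  where
  "bilinear_form M N b \<longleftrightarrow>
     (\<forall>w\<in>vecs N. linear_within (vecs M) (scal M) (*) (\<lambda>v. b v w)) \<and>
     (\<forall>v\<in>vecs M. linear_within (vecs N) (scal N) (*) (b v))"

text \<open>The tensor product of vector spaces $V$ and $W$ over a field is realised inside the dual of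
  the space of bilinear forms on $V \times W$: the pure tensor $v \otimes w$ is the evaluation
  $b \mapsto b(v,w)$, and $V \otimes W$ is the span of the pure tensors.  This is the usual tensor
  product because the bilinear forms are exactly the linear forms on $V \otimes W$, and they
  separate its points.  The action satisfies $g(v \otimes w) = gv \otimes gw$.\<close>

definition pure_tensor ::
  "('k::field, 'v::ab_group_add) gmodule \<Rightarrow> ('k, 'w::ab_group_add) gmodule
     \<Rightarrow> 'v \<Rightarrow> 'w \<Rightarrow> ('v \<Rightarrow> 'w \<Rightarrow> 'k) \<Rightarrow> 'k"
  where
  "pure_tensor M N v w = (\<lambda>b. if bilinear_form M N b then b v w else 0)"

definition tensor ::
  "('k::field, 'v::ab_group_add) gmodule \<Rightarrow> ('k, 'w::ab_group_add) gmodule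
     \<Rightarrow> ('k, ('v \<Rightarrow> 'w \<Rightarrow> 'k) \<Rightarrow> 'k) gmodule"
  where
  "tensor M N = \<lparr>
     vecs = module.span fscal {pure_tensor M N v w | v w. v \<in> vecs M \<and> w \<in> vecs N},
     scal = fscal,
     act = (\<lambda>g t b. t (\<lambda>v w. b (act M g v) (act N g w)))\<rparr>"

lemma matrix_inv_SL2:
  assumes "g \<in> SL2"
  shows "matrix_inv g \<in> SL2" "g ** matrix_inv g = mat 1" "matrix_inv g ** g = mat 1"
proof -
  have "invertible g"
    using assms by (simp add: SL2_def invertible_det_nz)
  then have "g ** matrix_inv g = mat 1 \<and> matrix_inv g ** g = mat 1"
    unfolding invertible_def matrix_inv_def by (rule someI_ex)
  then show *: "g ** matrix_inv g = mat 1" "matrix_inv g ** g = mat 1" by auto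
  have "det g * det (matrix_inv g) = 1"
    using *(1) by (metis det_I det_mul)
  then show "matrix_inv g \<in> SL2"
    using assms by (simp add: SL2_def)
qed

lemma bilinear_form_act:
  assumes M: "rational_module M" and N: "rational_module N" and g: "g \<in> SL2"
    and b: "bilinear_form M N b"
  shows "bilinear_form M N (\<lambda>v w. b (act M g v) (act N g w))"
proof -
  have "act M g v \<in> vecs M" if "v \<in> vecs M" for v
    using M g that unfolding rational_module_def by blast
  moreover have "act N g w \<in> vecs N" if "w \<in> vecs N" for w
    using N g that unfolding rational_module_def by blast
  moreover have "linear_within (vecs M) (scal M) (scal M) (act M g)"
    using M g unfolding rational_module_def by blast
  moreover have "linear_within (vecs N) (scal N) (scal N) (act N g)"
    using N g unfolding rational_module_def by blast
  ultimately show ?thesis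
    using b unfolding bilinear_form_def linear_within_def by simp
qed

lemma bilinear_form_cong:
  assumes M: "rational_module M" and N: "rational_module N"
    and b: "bilinear_form M N b"
    and eq: "\<And>v w. v \<in> vecs M \<Longrightarrow> w \<in> vecs N \<Longrightarrow> b v w = b' v w"
  shows "bilinear_form M N b'"
proof -
  have M': "module (scal M)" "module.subspace (scal M) (vecs M)"
    and N': "module (scal N)" "module.subspace (scal N) (vecs N)"
    using M N by (auto simp: rational_module_def module_iff_vector_space)
  have "u + v \<in> vecs M" "scal M c v \<in> vecs M" if "u \<in> vecs M" "v \<in> vecs M" for u v c
    using M' that by (auto simp: module.subspace_def)
  moreover have "u + v \<in> vecs N" "scal N c v \<in> vecs N" if "u \<in> vecs N" "v \<in> vecs N" for u v c
    using N' that by (auto simp: module.subspace_def)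
  ultimately show ?thesis
    using b unfolding bilinear_form_def linear_within_def by (simp add: eq[symmetric])
qed

lemma act_tensor_pure_tensor:
  fixes M :: "('k::field, 'v::ab_group_add) gmodule" and N :: "('k, 'w::ab_group_add) gmodule"
  assumes M: "rational_module M" and N: "rational_module N" and g: "g \<in> SL2"
  shows "act (tensor M N) g (pure_tensor M N v w) = pure_tensor M N (act M g v) (act N g w)"
proof
  fix b :: "'v \<Rightarrow> 'w \<Rightarrow> 'k"
  let ?b = "\<lambda>v w. b (act M g v) (act N g w)"
  let ?h = "matrix_inv g"
  note h = matrix_inv_SL2[OF g]
  have "bilinear_form M N ?b \<longleftrightarrow> bilinear_form M N b"
  proof
    assume "bilinear_form M N ?b"
    from bilinear_form_act[OF M N h(1) this]
    have "bilinear_form M N (\<lambda>v w. b (act M g (act M ?h v)) (act N g (act N ?h w)))" .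
    moreover have "act M g (act M ?h v) = v" if "v \<in> vecs M" for v
      using M g h that unfolding rational_module_def by metis
    moreover have "act N g (act N ?h w) = w" if "w \<in> vecs N" for w
      using N g h that unfolding rational_module_def by metis
    ultimately show "bilinear_form M N b"
      using bilinear_form_cong[OF M N,
          of "\<lambda>v w. b (act M g (act M ?h v)) (act N g (act N ?h w))" b] by simp
  qed (rule bilinear_form_act[OF M N g])
  then show "act (tensor M N) g (pure_tensor M N v w) b
      = pure_tensor M N (act M g v) (act N g w) b"
    by (simp add: tensor_def pure_tensor_def)
qed


section \<open>Induced modules, Weyl modules and tilting modules\<close>

text \<open>$\mathrm{Ind}_B^G(k_r)$ consists of the regular functions $f$ with $f(bx) = b \cdot f(x)$ for
  $b \in B$, where $b$ acts on $k_r$ by the $r$-th power of its upper left entry; the group acts by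
  right translation.\<close>

definition nabla :: "nat \<Rightarrow> ('k::field, 'k ^ 2 ^ 2 \<Rightarrow> 'k) gmodule" where
  "nabla r = \<lparr>
     vecs = {f \<in> regular_functions. \<forall>b\<in>borel2. \<forall>x\<in>SL2. f (b ** x) = (b $ 1 $ 1) ^ r * f x},
     scal = fscal,
     act = (\<lambda>g f x. f (x ** g))\<rparr>"

definition weyl :: "nat \<Rightarrow> ('k::field, ('k ^ 2 ^ 2 \<Rightarrow> 'k) \<Rightarrow> 'k) gmodule" where
  "weyl r = dual (nabla r)"

definition filtration_with ::
  "(nat \<Rightarrow> ('k::field, 'w::ab_group_add) gmodule) \<Rightarrow> ('k, 'v::ab_group_add) gmodule \<Rightarrow> bool"
  where
  "filtration_with S M \<longleftrightarrow>
     (\<exists>n F. F 0 = {0} \<and> F n = vecs M \<and> (\<forall>i\<le>n. submodule_of (F i) M) \<and>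
        (\<forall>i<n. F i \<subseteq> F (Suc i) \<and>
           (F (Suc i) = F i \<or> (\<exists>r. quotient_iso M (F (Suc i)) (F i) (S r)))))"

definition good_filtration :: "('k::field, 'v::ab_group_add) gmodule \<Rightarrow> bool" where
  "good_filtration M \<longleftrightarrow> filtration_with nabla M"

definition weyl_filtration :: "('k::field, 'v::ab_group_add) gmodule \<Rightarrow> bool" where
  "weyl_filtration M \<longleftrightarrow> filtration_with weyl M"

definition tilting :: "('k::field, 'v::ab_group_add) gmodule \<Rightarrow> bool" where
  "tilting M \<longleftrightarrow> rational_module M \<and> good_filtration M \<and> weyl_filtration M"

end

theory Submission
  imports Defs
begin

text \<open>
  Let \<open>U\<close> be the group of lower unipotent matrices and \<open>p\<close> the characteristic.  A function in
  \<open>nabla r\<close> only depends on the first row \<open>(x, y)\<close> of a matrix and is a homogeneous polynomial of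
  degree \<open>r\<close> in it; setting \<open>y = 1\<close> identifies \<open>nabla r\<close> with the polynomials of degree at most
  \<open>r\<close> in one variable, on which \<open>U\<close> acts by translations \<open>x \<mapsto> x + h\<close>.  So the tensor product
  \<open>X\<close> of \<open>nabla r\<close> and \<open>nabla s\<close> consists of the polynomials in two variables of bidegree at most
  \<open>(r, s)\<close>, and \<open>U\<close> translates both variables at the same time.

  \<^emph>\<open>Good filtrations.\<close>  \<open>X\<close> always has one (\<open>good_filtration_nabla_tensor\<close>).  Filter it
  by the submodules on which all translates of the first few functionals "coefficient of order \<open>j\<close> at
  the point fixed by the Borel subgroup" vanish.  The quotients embed into induced modules by Frobenius
  reciprocity, and adding up dimensions shows that the embeddings are onto.

  \<^emph>\<open>The obstruction.\<close>  Consider the \<open>U\<close>-invariant functionals of a fixed weight \<open>t \<ge> 0\<close>.  On a Weyl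
  module, which is generated over \<open>U\<close> by its highest weight vector, their number is at most the
  difference of the dimensions of the weight spaces for \<open>t\<close> and \<open>t + 2\<close>.  This inequality survives
  extensions, so it holds on every module with a Weyl filtration
  (\<open>weyl_filtration_form_bound\<close>).  On \<open>X\<close> an invariant functional of degree \<open>D\<close> is a solution of an
  explicit linear system of binomial coefficients (\<open>translation_form\<close>), so that a pair \<open>(r, s)\<close> with
  too many solutions (\<open>excess_forms\<close>) is not tilting.  Such solutions come from one fact: the
  coefficient of \<open>x\<close> to the power \<open>p N - 1\<close> is invariant under translations on polynomials of degree at
  most \<open>p N + p - 2\<close>.  If neither \<open>r\<close> nor \<open>s\<close> ends in the \<open>p\<close>-adic digit \<open>p - 1\<close> and not both are below
  \<open>p\<close>, it gives the excess directly.  If \<open>r = p a + (p - 1)\<close>, the polynomials of degree at most \<open>r\<close>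
  are the tensor product of polynomials in the \<open>p\<close>-th power of the variable and polynomials of degree
  below \<open>p\<close>, and excess for a smaller pair \<open>(a, b)\<close> lifts to \<open>(r, s)\<close>.  An induction leaves exactly the
  pairs with \<open>r + 1 = a p^n\<close>, \<open>1 \<le> a < p\<close>, \<open>s < p^(n+1)\<close>, up to exchanging \<open>r\<close> and \<open>s\<close>
  (\<open>excess_forms_exist\<close>).

  \<^emph>\<open>Weyl filtrations.\<close>  Let \<open>r + 1 = a p^n\<close> and \<open>s < p^(n+1)\<close>.  No binomial coefficient of \<open>r\<close> vanishes
  modulo \<open>p\<close>, so \<open>nabla r\<close> is generated by its lowest weight vector \<open>f\<close>.  The vectors
  \<open>f \<otimes> e\<close>, for the first \<open>min r s + 1\<close> weight vectors \<open>e\<close> of \<open>nabla s\<close>, are lowest weight vectors modulo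
  the submodule generated by their predecessors.  They generate \<open>X\<close>: low degrees are reached by the
  upper unipotent group, high degrees by symmetry, and the degrees between \<open>r\<close> and \<open>s\<close> because there
  the linear system above has no solution at all (\<open>translation_form_steinberg_zero\<close>).  Now a
  dimension count in the dual module shows that all quotients are Weyl modules.

  Pairs with both entries below \<open>p\<close> are covered by the same criterion, and the value
  \<open>s = p^(n+1) - 1\<close> is the case in which \<open>r\<close> and \<open>s\<close> exchange their roles; this turns
  \<open>tilting_nabla_tensor_iff\<close> into the final form.
\<close>

type_synonym 'k gfun = "'k ^ 2 ^ 2 \<Rightarrow> 'k"

type_synonym 'k tfun = "('k gfun \<Rightarrow> 'k gfun \<Rightarrow> 'k) \<Rightarrow> 'k"

section \<open>Binomial coefficients modulo a prime\<close>

lemma prime_CHAR: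
  assumes "CHAR('k::field) > 0" shows "prime CHAR('k)"
  using assms prime_CHAR_semidom by blast

lemma choose_below_char_nonzero:
  assumes "prime (CHAR('k::field))" "k \<le> n" "n < CHAR('k)"
  shows "(of_nat (n choose k) :: 'k) \<noteq> 0"
proof -
  have "\<not> CHAR('k) dvd fact n"
    using assms by (simp add: prime_dvd_fact_iff)
  moreover have "(n choose k) dvd fact n"
    using binomial_fact_lemma[OF assms(2)] by (metis dvd_triv_right mult.assoc mult.commute)
  ultimately show ?thesis
    by (auto simp: of_nat_eq_0_iff_char_dvd dest: dvd_trans)
qed

text \<open>
  Lucas' theorem for a power \<open>q\<close> of the characteristic: compare coefficients in
  \<open>(1 + X)^(q A + a) = (1 + X^q)^A (1 + X)^a\<close>.
\<close>

lemma lucas_choose: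
  assumes p: "prime (CHAR('k::field))" and q: "q = CHAR('k) ^ n" and a0: "a < q" and i0: "i < q"
  shows "(of_nat ((q * A + a) choose (q * I + i)) :: 'k) = of_nat (A choose I) * of_nat (a choose i)"
proof -
  have q0: "q > 0" using p q by (simp add: prime_gt_0_nat)
  have fr: "([:1, 1:] :: 'k poly) ^ q = 1 + monom 1 q"
  proof -
    have "([:1, 1:] :: 'k poly) = 1 + monom 1 1" by (simp add: monom_altdef one_pCons)
    moreover have "(1 + monom 1 1 :: 'k poly) ^ (CHAR('k poly) ^ n)
        = 1 ^ (CHAR('k poly) ^ n) + monom 1 1 ^ (CHAR('k poly) ^ n)"
      by (rule freshmans_dream') (use p in simp_all)
    ultimately show ?thesis by (simp add: q monom_power)
  qed
  have cb: "coeff ([:1, 1:] ^ N :: 'k poly) k = of_nat (N choose k)" for N k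
    by (cases "k \<le> N") (auto simp: coeff_linear_poly_power binomial_eq_0 coeff_eq_0 degree_linear_power)
  have "([:1, 1:] :: 'k poly) ^ (q * A + a) = (1 + monom 1 q) ^ A * [:1, 1:] ^ a"
    by (simp add: power_add power_mult fr)
  also have "(1 + monom 1 q) ^ A = (\<Sum>k\<le>A. of_nat (A choose k) * monom 1 (q * k) :: 'k poly)"
    by (subst add.commute, subst binomial_ring) (simp add: monom_power)
  also have "\<dots> = (\<Sum>k\<le>A. monom (of_nat (A choose k)) (q * k))"
    by (simp add: of_nat_poly smult_monom)
  finally have "of_nat ((q * A + a) choose (q * I + i))
      = coeff ((\<Sum>k\<le>A. monom (of_nat (A choose k)) (q * k)) * [:1, 1:] ^ a :: 'k poly) (q * I + i)"
    by (metis cb)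
  also have "\<dots> = (\<Sum>k\<le>A. of_nat (A choose k) *
       (if q * k \<le> q * I + i then of_nat (a choose (q * I + i - q * k)) else 0))"
    unfolding sum_distrib_right coeff_sum coeff_monom_mult cb
    by (intro sum.cong) auto
  also have "\<dots> = (\<Sum>k\<le>A. if k = I then of_nat (A choose I) * of_nat (a choose i) else 0)"
  proof (rule sum.cong[OF refl])
    fix k assume "k \<in> {..A}"
    consider "k = I" | "k < I" | "k > I" by linarith
    then show "of_nat (A choose k) * (if q * k \<le> q * I + i
        then of_nat (a choose (q * I + i - q * k)) else 0)
      = (if k = I then of_nat (A choose I) * of_nat (a choose i) else (0::'k))"
    proof cases
      case 2
      then obtain e where "I = Suc (k + e)" using less_iff_Suc_add by auto
      then have "q * I + i - q * k \<ge> q" by (simp add: algebra_simps)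
      then have "a < q * I + i - q * k" using a0 by linarith
      then show ?thesis using 2 by (auto simp: binomial_eq_0)
    next
      case 3
      then obtain e where "k = Suc (I + e)" using less_iff_Suc_add by auto
      then have "\<not> q * k \<le> q * I + i" using i0 by (simp add: algebra_simps)
      then show ?thesis using 3 by auto
    qed auto
  qed
  also have "\<dots> = of_nat (A choose I) * of_nat (a choose i)"
    by (auto simp: binomial_eq_0)
  finally show ?thesis .
qed

text \<open>
  Neighbouring entries of the row of \<open>q - 1\<close> add up to an entry of the row of \<open>q\<close>, which vanishes
  strictly between its ends; so none of them is zero because the first one is not.
\<close>

lemma choose_pred_power_nonzero:
  assumes p: "prime (CHAR('k::field))" and "i < CHAR('k) ^ n"
  shows "(of_nat ((CHAR('k) ^ n - 1) choose i) :: 'k) \<noteq> 0"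
  using assms(2)
proof (induction i)
  case (Suc i)
  define q where "q = CHAR('k) ^ n"
  have "(of_nat (q choose Suc i) :: 'k) = 0"
    using lucas_choose[OF p q_def, of 0 "Suc i" 1 0] Suc.prems p by (simp add: q_def prime_gt_0_nat)
  moreover have "q choose Suc i = ((q - 1) choose i) + ((q - 1) choose Suc i)"
    using Suc.prems unfolding q_def[symmetric] by (cases q) auto
  ultimately have "(of_nat ((q - 1) choose i) :: 'k) + of_nat ((q - 1) choose Suc i) = 0"
    by simp
  with Suc show ?case unfolding q_def by auto
qed simp

text \<open>
  In terms of representations: the induced module of highest weight \<open>a p^n - 1\<close> is generated by its
  lowest weight vector.
\<close>

lemma choose_steinberg_nonzero:
  assumes p: "prime (CHAR('k::field))" and a: "1 \<le> a" "a < CHAR('k)" and i: "i < a * CHAR('k) ^ n"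
  shows "(of_nat ((a * CHAR('k) ^ n - 1) choose i) :: 'k) \<noteq> 0"
proof -
  define q where "q = CHAR('k) ^ n"
  have q0: "q > 0" using p by (simp add: q_def prime_gt_0_nat)
  obtain a' where a': "a = Suc a'" using a by (cases a) auto
  have "a * q - 1 = q * a' + (q - 1)" using q0 by (simp add: a' algebra_simps)
  moreover have "i = q * (i div q) + i mod q" by simp
  ultimately have "(of_nat ((a * q - 1) choose i) :: 'k)
     = of_nat (a' choose (i div q)) * of_nat ((q - 1) choose (i mod q))"
    using lucas_choose[OF p q_def, of "q - 1" "i mod q" a' "i div q"] q0 by simp
  moreover have "i div q < a" using i q0 by (simp add: q_def div_less_iff_less_mult)
  then have "i div q \<le> a'" by (simp add: a')
  ultimately show ?thesis
    using choose_below_char_nonzero[OF p, of "i div q" a'] choose_pred_power_nonzero[OF p, of "i mod q" n] a q0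
    by (simp add: q_def a')
qed

lemma choose_multiple_nonzero:
  assumes p: "prime (CHAR('k::field))" and "a * CHAR('k) ^ n \<le> m" "m < CHAR('k) ^ (n + 1)"
  shows "(of_nat (m choose (a * CHAR('k) ^ n)) :: 'k) \<noteq> 0"
proof -
  define q where "q = CHAR('k) ^ n"
  have q0: "q > 0" using p by (simp add: q_def prime_gt_0_nat)
  have "(of_nat ((q * (m div q) + m mod q) choose (q * a + 0)) :: 'k) = of_nat ((m div q) choose a) * of_nat ((m mod q) choose 0)"
    using q0 by (intro lucas_choose[OF p q_def]) auto
  moreover have "a \<le> m div q" using assms q0 by (simp add: less_eq_div_iff_mult_less_eq q_def)
  moreover have "m div q < CHAR('k)" using assms q0 by (simp add: div_less_iff_less_mult q_def)
  ultimately show ?thesis using choose_below_char_nonzero[OF p, of a "m div q"]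
    by (simp add: q_def mult.commute)
qed

text \<open>
  This is the reason for all excess forms: translating a polynomial of degree at most \<open>p N + p - 2\<close>
  does not change its coefficient at the exponent \<open>p N - 1\<close>.
\<close>

lemma choose_top_zero:
  assumes p: "prime (CHAR('k::field))" and "N \<ge> 1" and "CHAR('k) * N - 1 < m" "m \<le> CHAR('k) * N + CHAR('k) - 2"
  shows "(of_nat (m choose (CHAR('k) * N - 1)) :: 'k) = 0"
proof -
  let ?p = "CHAR('k)"
  have p2: "?p \<ge> 2" using p prime_ge_2_nat by blast
  obtain N' where N: "N = Suc N'" using assms by (cases N) auto
  obtain j where j: "m = ?p * N + j" "j < ?p - 1"
    using assms p2 by (intro that[of "m - ?p * N"]) auto
  have "?p * N - 1 = ?p * N' + (?p - 1)" using p2 by (simp add: N algebra_simps)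
  then have "(of_nat (m choose (?p * N - 1)) :: 'k) = of_nat (N choose N') * of_nat (j choose (?p - 1))"
    using lucas_choose[OF p, of ?p 1 j "?p - 1" N N'] j p2 by simp
  then show ?thesis using j by (simp add: binomial_eq_0)
qed

section \<open>Translation-invariant forms\<close>

text \<open>
  A sequence \<open>c\<close> stands for the bilinear form on polynomials of degrees at most \<open>r\<close> and \<open>s\<close> that
  takes the value \<open>c i\<close> at \<open>(x^i, x^(D - i))\<close> and vanishes on all other pairs of monomials.  The
  equations say that the form does not change when both arguments are translated by the same \<open>h\<close>:
  the left-hand side is the coefficient of \<open>h^(a + b - D)\<close> in its value at the translates of
  \<open>x^a\<close> and \<open>x^b\<close>.
\<close>

definition translation_form :: "nat \<Rightarrow> nat \<Rightarrow> nat \<Rightarrow> (nat \<Rightarrow> 'k::field) \<Rightarrow> bool" where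
  "translation_form r s D c \<longleftrightarrow> (\<forall>a\<le>r. \<forall>b\<le>s. D < a + b \<longrightarrow>
     (\<Sum>i\<le>D. of_nat (a choose i) * of_nat (b choose (D - i)) * c i) = 0)"

definition form_range :: "nat \<Rightarrow> nat \<Rightarrow> nat \<Rightarrow> nat set" where
  "form_range r s D = {i. i \<le> r \<and> i \<le> D \<and> D - i \<le> s}"

text \<open>
  There are two linearly independent forms of degree \<open>D\<close>, or at least one if \<open>D < max r s\<close>.  A Weyl
  filtration allows at most one form and no form, respectively, provided that the weight
  \<open>2 D - r - s\<close> is not negative.
\<close>

definition excess_forms :: "nat \<Rightarrow> nat \<Rightarrow> nat \<Rightarrow> (nat \<Rightarrow> 'k::field) \<Rightarrow> (nat \<Rightarrow> 'k) \<Rightarrow> bool" where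
  "excess_forms r s D c c' \<longleftrightarrow> r + s \<le> 2 * D \<and> translation_form r s D c \<and> translation_form r s D c' \<and>
     (\<exists>i\<in>form_range r s D. c' i \<noteq> 0) \<and>
     (max r s \<le> D \<longrightarrow> (\<forall>x. \<exists>i\<in>form_range r s D. c i \<noteq> x * c' i))"

lemma antidiagonal_sum:
  assumes ab: "a \<le> r" "b \<le> s"
  shows "(\<Sum>i\<le>r. \<Sum>j\<le>s. if i + j = D then of_nat (a choose i) * of_nat (b choose j) * x i j else 0)
    = (\<Sum>i\<le>D. of_nat (a choose i) * of_nat (b choose (D - i)) * (x i (D - i) :: 'k::field))"
proof -
  let ?t = "\<lambda>i. of_nat (a choose i) * of_nat (b choose (D - i)) * x i (D - i)"
  have "(\<Sum>i\<le>r. \<Sum>j\<le>s. if i + j = D then of_nat (a choose i) * of_nat (b choose j) * x i j else 0)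
     = (\<Sum>i\<le>r. if i \<le> D then ?t i else 0)"
  proof (intro sum.cong refl)
    fix i
    have "(\<Sum>j\<le>s. if i + j = D then of_nat (a choose i) * of_nat (b choose j) * x i j else 0)
       = (\<Sum>j\<le>s. if j = D - i then (if i \<le> D then ?t i else 0) else 0)"
      by (intro sum.cong refl) auto
    also have "\<dots> = (if i \<le> D then ?t i else 0)"
      using ab by (auto simp: binomial_eq_0)
    finally show "(\<Sum>j\<le>s. if i + j = D then of_nat (a choose i) * of_nat (b choose j) * x i j else 0) = (if i \<le> D then ?t i else 0)" .
  qed
  also have "\<dots> = (\<Sum>i\<le>r + D. if i \<le> D then ?t i else 0)"
    by (rule sum.mono_neutral_left) (use ab in \<open>auto simp: binomial_eq_0\<close>)
  also have "\<dots> = (\<Sum>i\<le>D. ?t i)"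
    by (rule sum.mono_neutral_cong_right) auto
  finally show ?thesis .
qed

lemma translation_form_zero: "translation_form r s D (\<lambda>_. 0)"
  by (simp add: translation_form_def)

lemma translation_form_swap:
  assumes "translation_form r s D c" shows "translation_form s r D (\<lambda>i. c (D - i))"
  unfolding translation_form_def
proof (intro allI impI)
  fix a b assume ab: "a \<le> s" "b \<le> r" "D < a + b"
  have "(\<Sum>i\<le>D. of_nat (a choose i) * of_nat (b choose (D - i)) * c (D - i))
      = (\<Sum>i\<le>D. of_nat (a choose (D - i)) * of_nat (b choose i) * c i)"
    by (rule sum.reindex_bij_witness[of _ "\<lambda>i. D - i" "\<lambda>i. D - i"]) auto
  also have "\<dots> = (\<Sum>i\<le>D. of_nat (b choose i) * of_nat (a choose (D - i)) * c i)"
    by (simp add: mult.commute)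
  also have "\<dots> = 0"
    using assms ab by (auto simp: translation_form_def add.commute)
  finally show "(\<Sum>i\<le>D. of_nat (a choose i) * of_nat (b choose (D - i)) * c (D - i)) = 0" .
qed

lemma excess_forms_swap:
  assumes "excess_forms r s D c c'"
  shows "excess_forms s r D (\<lambda>i. c (D - i)) (\<lambda>i. c' (D - i))"
proof -
  have *: "(\<exists>i\<in>form_range s r D. P (D - i)) \<longleftrightarrow> (\<exists>i\<in>form_range r s D. P i)" for P
  proof
    assume "\<exists>i\<in>form_range s r D. P (D - i)"
    then obtain i where "i \<in> form_range s r D" "P (D - i)" by auto
    then show "\<exists>i\<in>form_range r s D. P i" by (intro bexI[of _ "D - i"]) (auto simp: form_range_def)
  next
    assume "\<exists>i\<in>form_range r s D. P i"
    then obtain i where "i \<in> form_range r s D" "P i" by auto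
    then show "\<exists>i\<in>form_range s r D. P (D - i)" by (intro bexI[of _ "D - i"]) (auto simp: form_range_def)
  qed
  show ?thesis
    using assms translation_form_swap
    unfolding excess_forms_def *[of "\<lambda>i. c' i \<noteq> 0"] *[of "\<lambda>i. c i \<noteq> _ * c' i"]
    by (auto simp: max.commute add.commute)
qed

text \<open>
  Neither \<open>r\<close> nor \<open>s\<close> ends in the digit \<open>p - 1\<close>.  In the language of polynomials \<open>f, g\<close> the two forms
  of degree \<open>D = p (a + b) + c - 1\<close> are \<open>x\<close>: the leading coefficient of \<open>f\<close> times the coefficient of
  \<open>g\<close> at \<open>p b - 1\<close>; and \<open>y\<close>: the coefficient at \<open>p (a + b) - 1\<close> of the product of \<open>f\<close> with the
  \<open>c\<close>-th divided derivative of \<open>g\<close>.  The first one needs \<open>b > 0\<close>, the second one \<open>a > 0\<close>; if only one of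
  them exists, then \<open>D\<close> lies below \<open>max r s\<close>.
\<close>

lemma excess_forms_base:
  fixes a b c d r s :: nat
  defines "p \<equiv> CHAR('k::field)"
  assumes p: "prime p" and r: "r = p * a + c" and s: "s = p * b + d"
    and cd: "c \<le> d" "d \<le> p - 2" and ab: "a > 0 \<or> b > 0"
  shows "\<exists>D x y. excess_forms r s D (x :: nat \<Rightarrow> 'k) y"
proof -
  have p2: "p \<ge> 2" using p prime_ge_2_nat by blast
  have pab: "p * (a + b) \<ge> p" using ab by (cases "a + b") auto
  define D where "D = p * (a + b) + c - 1"
  define x where "x = (\<lambda>i. if i = r then 1 else (0::'k))"
  define y where "y = (\<lambda>i. of_nat ((D - i) choose c) :: 'k)"
  have D': "D = p * (a + b) - 1 + c" using pab p2 by (simp add: D_def)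
  have pp: "p * (a + b) = p * a + p * b" by (simp add: distrib_left)
  have twoD: "r + s \<le> 2 * D"
    using pab cd p2 unfolding D' r s by (simp add: algebra_simps)
  have fx: "translation_form r s D x" if b: "b > 0"
    unfolding translation_form_def
  proof (intro allI impI)
    fix A B assume AB: "A \<le> r" "B \<le> s" "D < A + B"
    have pb: "p * b \<ge> p" using b by (cases b) auto
    have Dr: "D - r = p * b - 1" "r \<le> D" using pb p2 pp D' r by linarith+
    have "(\<Sum>i\<le>D. of_nat (A choose i) * of_nat (B choose (D - i)) * x i)
       = (\<Sum>i\<le>D. if i = r then of_nat (A choose r) * of_nat (B choose (p * b - 1)) else 0)"
      by (rule sum.cong) (auto simp: x_def Dr)
    also have "\<dots> = of_nat (A choose r) * of_nat (B choose (p * b - 1))"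
      using Dr by simp
    also have "\<dots> = 0"
    proof (cases "A < r")
      case False
      with AB have "A = r" by simp
      then have "p * b - 1 < B" using AB Dr by linarith
      moreover have "B \<le> p * b + p - 2" using AB s cd p2 by linarith
      ultimately show ?thesis
        using choose_top_zero[where 'k='k, of b B] p b by (simp add: p_def)
    qed (simp add: binomial_eq_0)
    finally show "(\<Sum>i\<le>D. of_nat (A choose i) * of_nat (B choose (D - i)) * x i) = 0" .
  qed
  have fy: "translation_form r s D y"
    unfolding translation_form_def
  proof (intro allI impI)
    fix A B assume AB: "A \<le> r" "B \<le> s" "D < A + B"
    show "(\<Sum>i\<le>D. of_nat (A choose i) * of_nat (B choose (D - i)) * y i) = 0"
    proof (cases "c \<le> B")
      case False
      then have "(B choose (D - i)) * ((D - i) choose c) = 0" for i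
        by (cases "D - i \<le> B") (auto simp: binomial_eq_0)
      then have h: "of_nat (B choose (D - i)) * y i = 0" for i
        unfolding y_def by (metis of_nat_0 of_nat_mult)
      show ?thesis by (simp only: mult.assoc h mult_zero_right sum.neutral_const)
    next
      case True
      let ?M = "p * (a + b) - 1"
      \<comment> \<open>a Vandermonde convolution evaluates the sum, and its value is a binomial coefficient that vanishes\<close>
      have "(\<Sum>i\<le>D. (A choose i) * (B choose (D - i)) * ((D - i) choose c))
          = (\<Sum>i\<le>?M. (B choose c) * ((A choose i) * ((B - c) choose (?M - i))))"
      proof (rule sum.mono_neutral_cong_right)
        show "{..?M} \<subseteq> {..D}" by (auto simp: D')
        show "\<forall>i\<in>{..D} - {..?M}. (A choose i) * (B choose (D - i)) * (D - i choose c) = 0"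
          by (auto simp: D' binomial_eq_0)
        fix i assume i: "i \<in> {..?M}"
        have "(B choose (D - i)) * ((D - i) choose c) = (B choose c) * ((B - c) choose (?M - i))"
        proof (cases "D - i \<le> B")
          case le: True
          have "c \<le> D - i" using i by (auto simp: D')
          with le have "(B choose (D - i)) * ((D - i) choose c) = (B choose c) * ((B - c) choose (D - i - c))"
            by (rule choose_mult[rotated])
          then show ?thesis using i by (simp add: D' algebra_simps)
        next
          case False
          then show ?thesis using i True by (auto simp: D' binomial_eq_0)
        qed
        then show "(A choose i) * (B choose (D - i)) * (D - i choose c)
           = (B choose c) * ((A choose i) * ((B - c) choose (?M - i)))"
          by (metis mult.assoc mult.left_commute)
      qed simp
      also have "\<dots> = (B choose c) * ((A + (B - c)) choose ?M)"
        by (simp only: vandermonde sum_distrib_left[symmetric])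
      finally have "(\<Sum>i\<le>D. of_nat (A choose i) * of_nat (B choose (D - i)) * y i)
          = (of_nat (B choose c) * of_nat ((A + (B - c)) choose ?M) :: 'k)"
        by (simp add: y_def flip: of_nat_mult of_nat_sum)
      also have "(of_nat ((A + (B - c)) choose ?M) :: 'k) = 0"
        unfolding p_def
      proof (rule choose_top_zero)
        show "prime CHAR('k)" "1 \<le> a + b" using p ab by (auto simp: p_def)
        show "CHAR('k) * (a + b) - 1 < A + (B - c)" using AB True D' by (simp add: p_def)
        have "A + (B - c) \<le> p * a + c + (p * b + d - c)" using AB r s by linarith
        also have "\<dots> \<le> p * (a + b) + p - 2" using cd p2 by (simp add: algebra_simps)
        finally show "A + (B - c) \<le> CHAR('k) * (a + b) + CHAR('k) - 2" by (simp add: p_def)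
      qed
      finally show ?thesis by simp
    qed
  qed
  have x1: "r \<in> form_range r s D" "x r = 1" if "b > 0"
  proof -
    have "p * b \<ge> p" using that by (cases b) auto
    then have "r \<le> D" "D - r \<le> s" using p2 pp D' r s by linarith+
    then show "r \<in> form_range r s D" "x r = 1" by (auto simp: form_range_def x_def)
  qed
  have y1: "p * a - 1 \<in> form_range r s D" "y (p * a - 1) \<noteq> 0" "p * a - 1 \<noteq> r" if "a > 0"
  proof -
    have pa: "p * a \<ge> p" using that by (cases a) auto
    then have Di: "D - (p * a - 1) = p * b + c" using p2 pp D' by linarith
    show "p * a - 1 \<in> form_range r s D" "p * a - 1 \<noteq> r"
      using Di pa p2 cd pp D' r s unfolding form_range_def mem_Collect_eq by linarith+
    have "(of_nat ((p * b + c) choose (p * 0 + c)) :: 'k) = of_nat (b choose 0) * of_nat (c choose c)"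
      using p cd p2 by (intro lucas_choose[where n=1]) (auto simp: p_def)
    then show "y (p * a - 1) \<noteq> 0" unfolding y_def Di by simp
  qed
  consider "a > 0" "b > 0" | "a = 0" "b > 0" | "a > 0" "b = 0" using ab by blast
  then show ?thesis
  proof cases
    case 1
    have "\<forall>z. \<exists>i\<in>form_range r s D. x i \<noteq> z * y i"
    proof
      fix z
      show "\<exists>i\<in>form_range r s D. x i \<noteq> z * y i"
      proof (cases "z = 0")
        case True then show ?thesis using x1 1 by (intro bexI[of _ r]) auto
      next
        case False then show ?thesis using y1 1 by (intro bexI[of _ "p * a - 1"]) (auto simp: x_def)
      qed
    qed
    then have "excess_forms r s D x y"
      using 1 twoD fx fy y1 unfolding excess_forms_def by blast
    then show ?thesis by blast
  next
    case 2
    have "p * a = 0" using 2 by simp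
    then have "D < s" using cd pab p2 pp D' s by linarith
    then have "D < max r s" by simp
    moreover have "\<exists>i\<in>form_range r s D. x i \<noteq> 0" using 2 x1 by (intro bexI[of _ r]) auto
    ultimately have "excess_forms r s D (\<lambda>_. 0) x"
      using 2 twoD fx by (auto simp: excess_forms_def translation_form_zero)
    then show ?thesis by blast
  next
    case 3
    have "p * b = 0" using 3 by simp
    then have "D < r" using cd pab p2 pp D' r by linarith
    then have "D < max r s" by simp
    moreover have "\<exists>i\<in>form_range r s D. y i \<noteq> 0" using 3 y1 by blast
    ultimately have "excess_forms r s D (\<lambda>_. 0) y"
      using twoD fy by (auto simp: excess_forms_def translation_form_zero)
    then show ?thesis by blast
  qed
qed

text \<open>
  With \<open>x^(p I + i)\<close> read as \<open>x^i\<close> tensored with the \<open>I\<close>-th power of a new variable, this is the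
  tensor product of the form \<open>c\<close> in the new variables with the form of degree \<open>p - 1 + m\<close> that takes
  \<open>f, g\<close> to the coefficient at \<open>p - 1\<close> of \<open>f\<close> times the \<open>m\<close>-th divided derivative of \<open>g\<close>.
\<close>

definition lift_form :: "nat \<Rightarrow> nat \<Rightarrow> (nat \<Rightarrow> 'k::field) \<Rightarrow> nat \<Rightarrow> 'k" where
  "lift_form m D c i = of_nat (((D - i) mod CHAR('k)) choose m) * c (i div CHAR('k))"

text \<open>
  By Lucas' theorem the equation for \<open>(A, B)\<close> factors into the equation of \<open>c\<close> for the quotients
  \<open>(A1, B1)\<close> and a Vandermonde sum for the remainders \<open>(A0, B0)\<close>.  The latter vanishes unless
  \<open>A0 + B0 = p - 1 + m\<close>, and in that case the equation of \<open>c\<close> applies.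
\<close>

lemma translation_form_lift:
  fixes c :: "nat \<Rightarrow> 'k::field" and a b r s m D' D :: nat
  defines "p \<equiv> CHAR('k)"
  assumes p: "prime p" and m: "m < p" and r: "r < p * (a + 1)" and s: "s < p * (b + 1) + m"
    and D: "D = p * D' + (p - 1) + m"
    and c: "translation_form a b D' c"
  shows "translation_form r s D (lift_form m D c)"
  unfolding translation_form_def
proof (intro allI impI)
  fix A B assume AB: "A \<le> r" "B \<le> s" "D < A + B"
  have p2: "p \<ge> 2" using p prime_ge_2_nat by blast
  let ?f = "\<lambda>i. of_nat (A choose i) * of_nat (B choose (D - i)) * lift_form m D c i"
  define A1 A0 B1 B0 where defs: "A1 = A div p" "A0 = A mod p" "B1 = B div p" "B0 = B mod p"
  have AB': "A = p * A1 + A0" "A0 < p" "B = p * B1 + B0" "B0 < p"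
    using p2 by (auto simp: defs)
  define g where "g = (\<lambda>I. of_nat (A1 choose I) * of_nat (B1 choose (D' - I)) * c I)"
  define h where "h = (\<lambda>i. (A0 choose i) * ((B0 - m) choose (p - 1 - i)))"
  \<comment> \<open>the remaining indices have D - i < m, where the divided derivative vanishes\<close>
  have "(\<Sum>i\<le>D. ?f i) = (\<Sum>i<(D' + 1) * p. ?f i)"
  proof (rule sum.mono_neutral_right)
    show "{..<(D' + 1) * p} \<subseteq> {..D}" using p2 by (auto simp: D algebra_simps)
    show "\<forall>i\<in>{..D} - {..<(D' + 1) * p}. ?f i = 0"
    proof
      fix i assume "i \<in> {..D} - {..<(D' + 1) * p}"
      then have "D - i < m" using p2 m by (auto simp: D algebra_simps)
      then have "(D - i) mod CHAR('k) < m" using m by (simp add: p_def)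
      then show "?f i = 0" by (simp add: lift_form_def binomial_eq_0)
    qed
  qed simp
  also have "\<dots> = (\<Sum>I<D' + 1. \<Sum>i=I * p..<I * p + p. ?f i)"
    by (rule sum.nat_group[symmetric])
  also have "\<dots> = (\<Sum>I<D' + 1. \<Sum>i<p. ?f (I * p + i))"
  proof (rule sum.cong[OF refl])
    fix I show "(\<Sum>i=I * p..<I * p + p. ?f i) = (\<Sum>i<p. ?f (I * p + i))"
      by (rule sum.reindex_bij_witness[of _ "\<lambda>i. I * p + i" "\<lambda>i. i - I * p"]) auto
  qed
  also have "\<dots> = (\<Sum>I<D' + 1. \<Sum>i<p. g I * of_nat (B0 choose m) * of_nat (h i))"
  proof (intro sum.cong refl)
    fix I i assume I: "I \<in> {..<D' + 1}" and i: "i \<in> {..<p}"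
    have A: "(of_nat (A choose (I * p + i)) :: 'k) = of_nat (A1 choose I) * of_nat (A0 choose i)"
      using lucas_choose[of p 1 A0 i A1 I, where 'k='k] p AB' i by (simp add: p_def mult.commute)
    have "(of_nat (B choose (D - (I * p + i))) * of_nat ((D - (I * p + i)) mod p choose m) :: 'k)
        = of_nat (B1 choose (D' - I)) * of_nat (B0 choose m) * of_nat ((B0 - m) choose (p - 1 - i))"
    proof (cases "m \<le> i")
      case True
      let ?j = "p - 1 + m - i"
      have j: "?j < p" using i True m by auto
      have "p * D' = p * (D' - I) + p * I" using I by (simp flip: distrib_left)
      then have Dj: "D - (I * p + i) = p * (D' - I) + ?j"
        using i True by (simp add: D mult.commute)
      have "(of_nat (B choose (D - (I * p + i))) :: 'k) = of_nat (B1 choose (D' - I)) * of_nat (B0 choose ?j)"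
        unfolding Dj using lucas_choose[of p 1 B0 ?j B1 "D' - I", where 'k='k] p AB' j by (simp add: p_def)
      moreover have "(D - (I * p + i)) mod p = ?j" unfolding Dj using j by simp
      moreover have "(B0 choose ?j) * (?j choose m) = (B0 choose m) * ((B0 - m) choose (p - 1 - i))"
      proof (cases "?j \<le> B0")
        case True
        then have "(B0 choose ?j) * (?j choose m) = (B0 choose m) * ((B0 - m) choose (?j - m))"
          using i by (intro choose_mult) auto
        then show ?thesis using i by simp
      next
        case False
        then have "B0 - m < p - 1 - i \<or> B0 < m" using i by auto
        then show ?thesis using False by (auto simp: binomial_eq_0)
      qed
      ultimately show ?thesis by (simp add: mult.assoc flip: of_nat_mult)
    next
      case False
      have "p * D' = p * (D' - I) + p * I" using I by (simp flip: distrib_left)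
      then have Dj: "D - (I * p + i) = p * (D' - I + 1) + (m - 1 - i)"
        using i False p2 by (simp add: D mult.commute)
      have "(D - (I * p + i)) mod p = m - 1 - i" unfolding Dj mod_mult_self4 using m by simp
      moreover have "B0 - m < p - 1 - i" using AB' False i m by auto
      ultimately show ?thesis using False by (simp add: binomial_eq_0)
    qed
    moreover have "(I * p + i) div p = I" using i by simp
    ultimately show "?f (I * p + i) = g I * of_nat (B0 choose m) * of_nat (h i)"
      by (simp add: A lift_form_def g_def h_def mult_ac flip: p_def)
  qed
  also have "\<dots> = (\<Sum>I<D' + 1. g I) * of_nat (B0 choose m) * of_nat (\<Sum>i<p. h i)"
    by (simp only: of_nat_sum sum_distrib_right[symmetric] sum_distrib_left[symmetric])
  also have "(\<Sum>i<p. h i) = (A0 + (B0 - m)) choose (p - 1)"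
  proof -
    have "{..<p} = {..p - 1}" using p2 by auto
    then show ?thesis by (simp only: h_def vandermonde)
  qed
  also have "(\<Sum>I<D' + 1. g I) * of_nat (B0 choose m) * of_nat ((A0 + (B0 - m)) choose (p - 1)) = 0"
  proof -
    consider "B0 < m" | "A0 + (B0 - m) < p - 1" | "p - 1 < A0 + (B0 - m)"
      | "m \<le> B0" "A0 + (B0 - m) = p - 1" by linarith
    then show ?thesis
    proof cases
      case 3
      have "(of_nat ((A0 + (B0 - m)) choose (CHAR('k) * 1 - 1)) :: 'k) = 0"
        using 3 p AB' by (intro choose_top_zero) (auto simp: p_def)
      then show ?thesis by (simp add: p_def)
    next
      case 4
      have "p * D' < p * (A1 + B1)"
        using AB(3) 4 unfolding D AB'(1,3) by (simp add: algebra_simps)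
      then have "D' < A1 + B1" by simp
      moreover have "p * A1 < p * (a + 1)" using AB r AB' by linarith
      then have "A1 \<le> a" by (simp only: mult_less_cancel1, simp)
      moreover have "p * B1 < p * (b + 1)" using AB s AB' 4 by linarith
      then have "B1 \<le> b" by (simp only: mult_less_cancel1, simp)
      ultimately have "(\<Sum>I\<le>D'. g I) = 0" using c unfolding translation_form_def g_def by blast
      moreover have "{..<D' + 1} = {..D'}" by auto
      ultimately show ?thesis by simp
    qed (auto simp: binomial_eq_0)
  qed
  finally show "(\<Sum>i\<le>D. ?f i) = 0" .
qed

text \<open>
  Restricting the lifted form to exponents \<open>p i + (p - 1)\<close> in the first variable gives \<open>c\<close> back, so
  independence and the position of \<open>D\<close> relative to \<open>max r s\<close> are inherited.
\<close>

lemma excess_forms_lift: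
  fixes c c' :: "nat \<Rightarrow> 'k::field" and a s m D' D :: nat
  defines "p \<equiv> CHAR('k)"
  assumes p: "prime p" and m: "m < p" "m \<le> s" and D: "D = p * D' + (p - 1) + m"
    and c: "excess_forms a ((s - m) div p) D' c c'"
  shows "excess_forms (p * a + (p - 1)) s D (lift_form m D c) (lift_form m D c')"
proof -
  define b where "b = (s - m) div p"
  define r where "r = p * a + (p - 1)"
  have p2: "p \<ge> 2" using p prime_ge_2_nat by blast
  have b1: "p * b + m \<le> s" using m p2 by (simp add: b_def) (metis div_times_less_eq_dividend le_diff_conv2 mult.commute)
  have "s - m < p * (b + 1)" using p2 by (simp add: b_def dividend_less_times_div)
  then have b2: "s < p * (b + 1) + m" using m by linarith
  have r2: "r < p * (a + 1)" using p2 by (simp add: r_def)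
  have form: "translation_form r s D (lift_form m D f)" if "translation_form a b D' f" for f :: "nat \<Rightarrow> 'k"
    using translation_form_lift[where 'k='k, of m r a s b D D' f] p m r2 b2 D that by (simp add: p_def)
  have ran: "p * i + (p - 1) \<in> form_range r s D"
    and val: "lift_form m D f (p * i + (p - 1)) = f i"
    if "i \<in> form_range a b D'" for i and f :: "nat \<Rightarrow> 'k"
  proof -
    have i: "i \<le> a" "i \<le> D'" "D' - i \<le> b" using that by (auto simp: form_range_def)
    have "p * D' = p * (D' - i) + p * i" using i by (simp flip: distrib_left)
    then have Di: "D - (p * i + (p - 1)) = p * (D' - i) + m" "p * i + (p - 1) \<le> D" by (auto simp: D)
    have "p * (D' - i) \<le> p * b" "p * i \<le> p * a" using i by auto
    then have "p * (D' - i) + m \<le> s" "p * i + (p - 1) \<le> r" using b1 unfolding r_def by linarith+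
    then show "p * i + (p - 1) \<in> form_range r s D"
      using Di by (simp add: form_range_def)
    have "(p * i + (p - 1)) div p = i" using p2 by (subst div_mult_self4) auto
    moreover have "(D - (p * i + (p - 1))) mod p = m" unfolding Di using m by simp
    ultimately show "lift_form m D f (p * i + (p - 1)) = f i"
      by (simp add: lift_form_def flip: p_def)
  qed
  have "2 * (p * D') = p * (2 * D')" by simp
  moreover have "p * (a + b) \<le> p * (2 * D')" using c by (simp add: excess_forms_def b_def)
  ultimately have "r + s \<le> 2 * D" using b2 unfolding D r_def by (simp add: algebra_simps)
  moreover have "max a b \<le> D'" if "max r s \<le> D"
  proof -
    have "p * a + (p - 1) \<le> D" "p * b + m \<le> D" using that b1 by (auto simp: r_def)
    then have "p * a < p * (D' + 1)" "p * b < p * (D' + 1)" using m p2 by (auto simp: D)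
    then show ?thesis by (simp only: mult_less_cancel1, simp)
  qed
  ultimately show ?thesis
    using c form ran val unfolding excess_forms_def b_def[symmetric] r_def[symmetric]
    by (metis (no_types, lifting))
qed

section \<open>Pairs without excess forms\<close>

text \<open>
  \<open>nabla r\<close> is simple, a tensor product of a Steinberg module and a Frobenius twist of a restricted
  module, and \<open>s\<close> is small compared to it.  For \<open>n = 0\<close> both weights are \<open>p\<close>-restricted.  The value
  \<open>s = p^(n+1) - 1\<close> may be included because the relation is used symmetrically in \<open>r\<close> and \<open>s\<close>.
\<close>

definition steinberg_dominates :: "nat \<Rightarrow> nat \<Rightarrow> nat \<Rightarrow> bool" where
  "steinberg_dominates p r s \<longleftrightarrow> (\<exists>a n. 1 \<le> a \<and> a < p \<and> r + 1 = a * p ^ n \<and> s < p ^ (n + 1))"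

lemma steinberg_dominates_restricted:
  assumes "p \<ge> 2" "r < p" "s < p" shows "steinberg_dominates p r s"
proof (cases "r + 1 < p")
  case True
  then show ?thesis unfolding steinberg_dominates_def
    using assms by (intro exI[of _ "r + 1"] exI[of _ 0]) auto
next
  case False
  have "s < p ^ 2" using assms by (simp add: power2_eq_square less_le_trans)
  then show ?thesis unfolding steinberg_dominates_def
    using assms False by (intro exI[of _ 1] exI[of _ 1]) (auto simp: numeral_2_eq_2)
qed

lemma steinberg_dominates_step:
  assumes "steinberg_dominates p a b" "p \<ge> 2" "d < p"
  shows "steinberg_dominates p (p * a + (p - 1)) (p * b + d)"
proof -
  obtain x n where x: "1 \<le> x" "x < p" "a + 1 = x * p ^ n" "b < p ^ (n + 1)"
    using assms unfolding steinberg_dominates_def by auto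
  have "p * a + (p - 1) + 1 = p * (a + 1)" using assms by simp
  then have "p * a + (p - 1) + 1 = x * p ^ (n + 1)" unfolding x(3) by (simp add: mult_ac)
  moreover have "p * (b + 1) \<le> p * p ^ (n + 1)" using x by (intro mult_left_mono) auto
  then have "p * b + d < p ^ (n + 1 + 1)" using assms by simp
  ultimately show ?thesis unfolding steinberg_dominates_def using x by blast
qed

text \<open>
  The inductive step, contraposed: \<open>r\<close> ends in the digit \<open>p - 1\<close>, and excess forms for \<open>(r, s)\<close> could be
  lifted from the pairs \<open>(a, b)\<close> and \<open>(a, b - 1)\<close>.  The critical case is that \<open>(a, b)\<close> is only dominated
  by its second entry, so \<open>b + 1 = x p^n\<close>.  If \<open>n > 0\<close>, then \<open>p\<close> does not divide \<open>b\<close>, so the second entry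
  dominates \<open>(a, b - 1)\<close> only for restricted weights.
\<close>

lemma steinberg_dominates_reduce:
  assumes p: "p \<ge> 2" and d: "d < p"
    and ab: "steinberg_dominates p a b \<or> steinberg_dominates p b a"
    and ab': "b > 0 \<Longrightarrow> d < p - 1 \<Longrightarrow> steinberg_dominates p a (b - 1) \<or> steinberg_dominates p (b - 1) a"
  defines "r \<equiv> p * a + (p - 1)" and "s \<equiv> p * b + d"
  shows "steinberg_dominates p r s \<or> steinberg_dominates p s r"
proof (cases "steinberg_dominates p a b")
  case True
  then show ?thesis using steinberg_dominates_step[OF _ p d] by (simp add: r_def s_def)
next
  case False
  then have ba: "steinberg_dominates p b a" using ab by blast
  then obtain x n where x: "1 \<le> x" "x < p" "b + 1 = x * p ^ n" "a < p ^ (n + 1)"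
    unfolding steinberg_dominates_def by auto
  have restr: False if "a < p" "b < p"
    using steinberg_dominates_restricted[OF p that] False by blast
  show ?thesis
  proof (cases "d = p - 1")
    case True
    then show ?thesis using steinberg_dominates_step[OF ba p, of "p - 1"] p by (simp add: r_def s_def)
  next
    case d': False
    have b0: "b > 0"
    proof (rule ccontr)
      assume "\<not> b > 0"
      with x p have "n = 0" by (cases n) auto
      with x restr show False using \<open>\<not> b > 0\<close> by auto
    qed
    from ab'[OF b0] d d' consider "steinberg_dominates p a (b - 1)" | "steinberg_dominates p (b - 1) a"
      by linarith
    then show ?thesis
    proof cases
      case 1
      then obtain y l where y: "1 \<le> y" "y < p" "a + 1 = y * p ^ l" "b - 1 < p ^ (l + 1)"
        unfolding steinberg_dominates_def by auto
      with False have "\<not> b < p ^ (l + 1)" unfolding steinberg_dominates_def by blast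
      with y have b: "b = p ^ (l + 1)" by linarith
      have "n = 0"
      proof (rule ccontr)
        assume "n \<noteq> 0"
        then have "p dvd x * p ^ n" "p dvd b" by (auto simp: b)
        then have "p dvd b + 1" "p dvd b" unfolding x(3)[symmetric] by auto
        then have "p dvd 1" by (metis dvd_add_right_iff)
        then show False using p by simp
      qed
      with x have "b < p" by simp
      moreover have "p ^ 1 \<le> b" unfolding b using p by (intro power_increasing) auto
      ultimately show ?thesis by simp
    next
      case 2
      then obtain y l where y: "1 \<le> y" "y < p" "b - 1 + 1 = y * p ^ l" "a < p ^ (l + 1)"
        unfolding steinberg_dominates_def by auto
      have "n = 0 \<or> l = 0"
      proof (rule ccontr)
        assume "\<not> (n = 0 \<or> l = 0)"
        then have "p dvd b + 1" "p dvd b" using x(3) y(3) b0 by auto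
        then have "p dvd 1" by (metis dvd_add_right_iff)
        then show False using p by simp
      qed
      with x y b0 have "a < p" "b < p" by auto
      with restr show ?thesis by blast
    qed
  qed
qed

text \<open>
  Induction on \<open>r + s\<close>: strip the last \<open>p\<close>-adic digit as long as one of the numbers ends in
  \<open>p - 1\<close>.  The lift with parameter \<open>m\<close> starts from \<open>(s - m) div p\<close>, so \<open>m = 0\<close> and \<open>m = p - 1\<close>
  reach the two pairs of the preceding lemma.
\<close>

lemma excess_forms_exist:
  fixes r s :: nat
  defines "p \<equiv> CHAR('k::field)"
  assumes p: "prime p" and "\<not> steinberg_dominates p r s" "\<not> steinberg_dominates p s r"
  shows "\<exists>D x y. excess_forms r s D (x :: nat \<Rightarrow> 'k) y"
  using assms(3,4)
proof (induction "r + s" arbitrary: r s rule: less_induct)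
  case less
  have p2: "p \<ge> 2" using p prime_ge_2_nat by blast
  have swap: "(\<exists>D x y. excess_forms s r D (x :: nat \<Rightarrow> 'k) y) \<Longrightarrow> (\<exists>D x y. excess_forms r s D (x :: nat \<Rightarrow> 'k) y)" for r s
    using excess_forms_swap by blast
  have step: "\<exists>D x y. excess_forms r s D (x :: nat \<Rightarrow> 'k) y"
    if r: "r mod p = p - 1" and rs: "\<not> steinberg_dominates p r s" "\<not> steinberg_dominates p s r"
      and IH: "\<And>a b. a + b < r + s \<Longrightarrow> \<not> steinberg_dominates p a b \<Longrightarrow> \<not> steinberg_dominates p b a
          \<Longrightarrow> \<exists>D x y. excess_forms a b D (x :: nat \<Rightarrow> 'k) y" for r s
  proof -
    define a where "a = r div p"
    have ra: "r = p * a + (p - 1)" using r mult_div_mod_eq[of p r] by (simp add: a_def)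
    have "\<exists>m<p. m \<le> s \<and> \<not> steinberg_dominates p a ((s - m) div p) \<and> \<not> steinberg_dominates p ((s - m) div p) a"
    proof (rule ccontr)
      assume neg: "\<not> ?thesis"
      define b d where "b = s div p" and "d = s mod p"
      have s: "s = p * b + d" "d < p" using p2 by (auto simp: b_def d_def)
      have 0: "steinberg_dominates p a b \<or> steinberg_dominates p b a"
        using neg p2 unfolding b_def by (metis diff_zero le0 less_le_trans pos2)
      have 1: "steinberg_dominates p a (b - 1) \<or> steinberg_dominates p (b - 1) a" if bd: "b > 0" "d < p - 1"
      proof -
        obtain b' where b': "b = Suc b'" using bd(1) by (auto simp: gr0_conv_Suc)
        have "s - (p - 1) = p * b' + (d + 1)" using p2 by (simp add: s b')
        then have "(s - (p - 1)) div p = b' + (d + 1) div p" using p2 by (metis div_mult_self4 not_numeral_le_zero)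
        then have "(s - (p - 1)) div p = b - 1" using bd b' by simp
        moreover have "p - 1 < p" "p - 1 \<le> s" using p2 by (auto simp: s b')
        ultimately show ?thesis using neg by metis
      qed
      have "steinberg_dominates p r s \<or> steinberg_dominates p s r"
        unfolding ra s(1) by (rule steinberg_dominates_reduce) (use p2 s 0 1 in auto)
      then show False using rs by blast
    qed
    then obtain m where m: "m < p" "m \<le> s"
      "\<not> steinberg_dominates p a ((s - m) div p)" "\<not> steinberg_dominates p ((s - m) div p) a" by blast
    have "1 * a \<le> p * a" using p2 by (intro mult_right_mono) auto
    then have "a < r" unfolding ra using p2 by linarith
    moreover have "(s - m) div p \<le> s" by (meson diff_le_self div_le_dividend le_trans)
    ultimately have "a + (s - m) div p < r + s" by linarith
    from IH[OF this m(3,4)] obtain D x y where "excess_forms a ((s - m) div p) D (x :: nat \<Rightarrow> 'k) y" by blast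
    from excess_forms_lift[OF _ _ m(2) refl this[unfolded p_def]] p m
    show ?thesis unfolding ra p_def by blast
  qed
  consider "r mod p = p - 1" | "s mod p = p - 1" | "r mod p \<noteq> p - 1" "s mod p \<noteq> p - 1" by blast
  then show ?case
  proof cases
    case 1 then show ?thesis using step[OF 1] less by blast
  next
    case 2
    have "\<exists>D x y. excess_forms s r D (x :: nat \<Rightarrow> 'k) y"
      using less by (intro step[OF 2]) (auto simp: add.commute)
    then show ?thesis by (rule swap)
  next
    case 3
    define a c b d where defs: "a = r div p" "c = r mod p" "b = s div p" "d = s mod p"
    have eqs: "r = p * a + c" "s = p * b + d" by (auto simp: defs)
    have "c < p" "d < p" using p2 by (auto simp: defs)
    with 3 have cd: "c \<le> p - 2" "d \<le> p - 2" unfolding defs by linarith+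
    have ab: "a > 0 \<or> b > 0"
    proof (rule ccontr)
      assume "\<not> ?thesis"
      then have "r < p" "s < p" using eqs \<open>c < p\<close> \<open>d < p\<close> by auto
      then show False using less steinberg_dominates_restricted[OF p2] by blast
    qed
    show ?thesis
    proof (cases "c \<le> d")
      case True
      then show ?thesis using excess_forms_base[of r a c s b d, where 'k='k] p eqs cd ab by (simp add: p_def)
    next
      case False
      then have "\<exists>D x y. excess_forms s r D (x :: nat \<Rightarrow> 'k) y"
        using excess_forms_base[of s b d r a c, where 'k='k] p eqs cd ab by (auto simp: p_def)
      then show ?thesis by (rule swap)
    qed
  qed
qed

text \<open>
  Let \<open>u\<close> and \<open>v\<close> be monomials, and write \<open>D_l\<close> for the \<open>l\<close>-th divided derivative.  For an invariant
  form, \<open>(u, D_k v)\<close> and \<open>(-1)^k (D_k u, v)\<close> have the same value; this integration by parts is the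
  alternating sum over \<open>l < k\<close> of the equations for \<open>D_l u\<close> and \<open>v\<close>.  With \<open>u = x^r\<close> and
  \<open>k = r + 1\<close> the second value is zero, hence \<open>c r = 0\<close> since \<open>(D + 1) choose (r + 1)\<close> is invertible;
  smaller \<open>k\<close> then give \<open>c (r - k) = 0\<close> because \<open>r choose k\<close> is invertible.
\<close>

lemma translation_form_steinberg_zero:
  fixes c :: "nat \<Rightarrow> 'k::field" and a n r s D :: nat
  assumes p: "prime CHAR('k)" and a: "1 \<le> a" "a < CHAR('k)" and r: "r + 1 = a * CHAR('k) ^ n"
    and D: "r < D" "D < s" "s < CHAR('k) ^ (n + 1)"
    and c: "translation_form r s D c" and i: "i \<le> r"
  shows "c i = 0"
proof -
  have key: "(if k \<le> r then (- 1) ^ k * of_nat (r choose k) * c (r - k) else 0)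
      = of_nat ((D + k - r) choose (D - r)) * c r" if k: "1 \<le> k" "D + k - r \<le> s" for k
  proof -
    define b where "b = D + k - r"
    let ?f = "\<lambda>l i. (- 1) ^ l * of_nat (r choose l) * (of_nat ((r - l) choose i) * of_nat (b choose (D - i)) * c i)"
    have zero: "(\<Sum>i\<le>D. ?f l i) = 0" if "l < k" for l
    proof (cases "l \<le> r")
      case True
      have "(\<Sum>i\<le>D. of_nat ((r - l) choose i) * of_nat (b choose (D - i)) * c i) = 0"
        using c that k D True unfolding translation_form_def b_def by auto
      then show ?thesis by (simp flip: sum_distrib_left)
    qed (simp add: binomial_eq_0)
    have rl: "(r choose l) * ((r - l) choose i) = (r choose i) * ((r - i) choose l)" for l i
    proof (cases "l + i \<le> r")
      case True
      then show ?thesis using choose_mult[of l "l + i" r] choose_mult[of i "l + i" r]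
        by (metis add_diff_cancel_left' add_diff_cancel_right' binomial_symmetric le_add1 le_add2)
    next
      case False
      then show ?thesis by (cases "l \<le> r"; cases "i \<le> r") (auto simp: binomial_eq_0)
    qed
    have inner: "(\<Sum>l<k. ?f l i) = (if i = r then of_nat (b choose (D - r)) * c r else 0)
         - (if i + k = r then (- 1) ^ k * of_nat (r choose k) * c (r - k) else 0)" for i
    proof -
      have "(\<Sum>l<k. ?f l i) = (\<Sum>l<k. (- 1) ^ l * of_nat ((r - i) choose l)) * (of_nat (r choose i) * of_nat (b choose (D - i)) * c i)"
        unfolding sum_distrib_right
      proof (rule sum.cong[OF refl])
        fix l
        have "(of_nat (r choose l) * of_nat ((r - l) choose i) :: 'k) = of_nat (r choose i) * of_nat ((r - i) choose l)"
          by (metis rl of_nat_mult)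
        then show "?f l i = (- 1) ^ l * of_nat ((r - i) choose l) * (of_nat (r choose i) * of_nat (b choose (D - i)) * c i)"
          by (simp add: mult.assoc mult.left_commute)
      qed
      also have "\<dots> = (if i = r then of_nat (b choose (D - r)) * c r else 0)
         - (if i + k = r then (- 1) ^ k * of_nat (r choose k) * c (r - k) else 0)"
      proof (cases "i \<le> r \<and> D - i \<le> b")
        case False
        then have "of_nat (r choose i) * of_nat (b choose (D - i)) = (0::'k)" by (auto simp: binomial_eq_0)
        moreover have "i \<noteq> r \<and> i + k \<noteq> r" using False k D by (auto simp: b_def)
        ultimately show ?thesis by simp
      next
        case True
        then have ri: "r - i \<le> k" using D by (auto simp: b_def)
        have alt: "(\<Sum>l\<le>r - i. (- 1) ^ l * of_nat ((r - i) choose l) :: 'k) = (if i = r then 1 else 0)"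
          using choose_alternating_sum[of "r - i", where 'a='k] True by (cases "i = r") auto
        show ?thesis
        proof (cases "r - i = k")
          case eq: True
          then have "i + k = r" "i \<noteq> r" using k True by auto
          moreover have "(\<Sum>l<k. (- 1) ^ l * of_nat ((r - i) choose l) :: 'k) = - ((- 1) ^ k)"
            using alt \<open>i \<noteq> r\<close> unfolding eq atMost_Suc lessThan_Suc_atMost[symmetric] by (simp add: eq_neg_iff_add_eq_0)
          moreover have "b = D - i" using eq True D by (auto simp: b_def)
          moreover have "r choose i = r choose k" using \<open>i + k = r\<close> by (metis add_diff_cancel_left' binomial_symmetric le_add1)
          moreover have "i = r - k" using \<open>i + k = r\<close> by simp
          ultimately show ?thesis by simp
        next
          case False
          with ri have lt: "r - i < k" by simp
          then have "(\<Sum>l<k. (- 1) ^ l * of_nat ((r - i) choose l) :: 'k) = (\<Sum>l\<le>r - i. (- 1) ^ l * of_nat ((r - i) choose l))"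
            by (intro sum.mono_neutral_right) (auto simp: binomial_eq_0)
          moreover have "i + k \<noteq> r" using lt by auto
          ultimately show ?thesis using alt by simp
        qed
      qed
      finally show ?thesis .
    qed
    have "0 = (\<Sum>l<k. \<Sum>i\<le>D. ?f l i)" using zero by simp
    also have "\<dots> = (\<Sum>i\<le>D. \<Sum>l<k. ?f l i)" by (rule sum.swap)
    also have "\<dots> = of_nat (b choose (D - r)) * c r
       - (\<Sum>i\<le>D. if i + k = r then (- 1) ^ k * of_nat (r choose k) * c (r - k) else 0)"
      unfolding inner sum_subtractf using D by simp
    also have "(\<Sum>i\<le>D. if i + k = r then (- 1) ^ k * of_nat (r choose k) * c (r - k) else 0)
       = (\<Sum>i\<le>D. if i = r - k \<and> k \<le> r then (- 1) ^ k * of_nat (r choose k) * c (r - k) else 0)"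
      by (intro sum.cong refl) auto
    also have "\<dots> = (if k \<le> r then (- 1) ^ k * of_nat (r choose k) * c (r - k) else 0)"
    proof -
      have "r - k \<le> D" using D by simp
      then show ?thesis by (cases "k \<le> r") simp_all
    qed
    finally show ?thesis by (simp add: b_def)
  qed
  have "of_nat ((D + 1) choose (D - r)) * c r = 0"
    using key[of "r + 1"] D by simp
  moreover have "(D + 1) choose (D - r) = (D + 1) choose (r + 1)"
    using D by (subst binomial_symmetric) auto
  moreover have "(of_nat ((D + 1) choose (r + 1)) :: 'k) \<noteq> 0"
    unfolding r using D r by (intro choose_multiple_nonzero[OF p]) auto
  ultimately have cr: "c r = 0" by simp
  show ?thesis
  proof (cases "i = r")
    case False
    define k where "k = r - i"
    have k: "1 \<le> k" "k \<le> r" "D + k - r \<le> s" "r - k = i" using False i D by (auto simp: k_def)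
    have "(- 1) ^ k * of_nat (r choose k) * c i = 0"
      using key[OF k(1,3)] k cr by simp
    moreover have "(of_nat (r choose k) :: 'k) \<noteq> 0"
      using choose_steinberg_nonzero[OF p a, of k n] k r by (metis Suc_eq_plus1 diff_Suc_1 le_imp_less_Suc)
    ultimately show ?thesis by simp
  qed (simp add: cr)
qed

section \<open>Dimensions of function spaces\<close>

interpretation fs: vector_space "fscal :: 'k::field \<Rightarrow> ('x \<Rightarrow> 'k) \<Rightarrow> 'x \<Rightarrow> 'k"
  by (rule vector_space_fscal)

lemma sum_fun_apply: "(\<Sum>i\<in>A. f i) x = (\<Sum>i\<in>A. f i x)"
  by (induction A rule: infinite_finite_induct) auto

lemma fscal_apply [simp]: "fscal c f x = c * f x"
  by (simp add: fscal_def)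

lemma fscal_zero_left [simp]: "fscal 0 f = 0"
  by (simp add: fun_eq_iff)

lemma fscal_uminus_one [simp]: "fscal (- 1) f = - f"
  by (simp add: fun_eq_iff)

lemma (in vector_space) independent_card_le_dim_finite:
  assumes "finite B" "V \<subseteq> span B" "independent A" "A \<subseteq> V"
  shows "finite A" "card A \<le> dim V"
proof -
  obtain C where C: "C \<subseteq> V" "independent C" "V \<subseteq> span C" "card C = dim V"
    using basis_exists by blast
  have "finite C"
    using independent_span_bound[OF assms(1) C(2)] C(1) assms(2) by blast
  then have "finite A \<and> card A \<le> card C"
    using independent_span_bound[OF _ assms(3)] C assms(4) by blast
  then show "finite A" "card A \<le> dim V" using C by auto
qed

lemma (in vector_space) finite_basis_exists:
  assumes "finite B" "V \<subseteq> span B"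
  obtains A where "finite A" "A \<subseteq> V" "independent A" "V \<subseteq> span A" "card A = dim V"
proof -
  obtain A where A: "A \<subseteq> V" "independent A" "V \<subseteq> span A" "card A = dim V"
    using basis_exists by blast
  show ?thesis by (rule that[OF independent_card_le_dim_finite(1)[OF assms A(2,1)] A])
qed

lemma (in vector_space) dim_mono_finite:
  assumes "finite B" "V \<subseteq> span B" "U \<subseteq> V"
  shows "dim U \<le> dim V"
proof -
  obtain A where A: "finite A" "A \<subseteq> V" "independent A" "V \<subseteq> span A" "card A = dim V"
    by (rule finite_basis_exists[OF assms(1,2)])
  then show ?thesis using dim_le_card[of U A] assms(3) by simp
qed

lemma (in vector_space) dim_strict_mono_finite:
  assumes "finite B" "V \<subseteq> span B" "subspace U" "U \<subset> V"
  shows "dim U < dim V"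
proof -
  obtain A where A: "finite A" "A \<subseteq> U" "independent A" "U \<subseteq> span A" "card A = dim U"
    by (rule finite_basis_exists[OF assms(1), of U]) (use assms(2,4) in auto)
  obtain v where v: "v \<in> V" "v \<notin> U" using assms by blast
  have "span A \<subseteq> U" using A assms(3) by (simp add: span_minimal)
  with v have vA: "v \<notin> span A" by blast
  then have ind: "independent (insert v A)" and "v \<notin> A"
    using independent_insertI[OF vA A(3)] span_base by blast+
  then have "card (insert v A) \<le> dim V"
    using A v assms by (intro independent_card_le_dim_finite[OF assms(1,2)]) auto
  then show ?thesis using A \<open>v \<notin> A\<close> by simp
qed

lemma linear_within_zero:
  assumes "module s" "module t" "module.subspace s V" "linear_within V s t f"
  shows "f 0 = 0"
proof -
  have "0 \<in> V" using assms(1,3) by (rule module.subspace_0)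
  then have "f (s 0 0) = t 0 (f 0)" using assms(4) unfolding linear_within_def by blast
  then show ?thesis using assms(1,2) by (simp add: module.scale_zero_left)
qed

lemma linear_within_sum:
  assumes "module s" "module t" "module.subspace s V" "linear_within V s t f"
    and "finite I" "\<And>i. i \<in> I \<Longrightarrow> x i \<in> V"
  shows "f (\<Sum>i\<in>I. s (c i) (x i)) = (\<Sum>i\<in>I. t (c i) (f (x i)))"
  using assms(5,6)
proof (induction I rule: finite_induct)
  case empty
  then show ?case using linear_within_zero[OF assms(1-4)] by simp
next
  case (insert j I)
  have sV: "s (c i) (x i) \<in> V" if "i \<in> insert j I" for i
    using module.subspace_scale[OF assms(1,3)] insert.prems that by blast
  then have "(\<Sum>i\<in>I. s (c i) (x i)) \<in> V"
    by (intro module.subspace_sum[OF assms(1,3)]) blast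
  with sV have "s (c j) (x j) \<in> V" "(\<Sum>i\<in>I. s (c i) (x i)) \<in> V" by blast+
  then have "f (s (c j) (x j) + (\<Sum>i\<in>I. s (c i) (x i))) = f (s (c j) (x j)) + f (\<Sum>i\<in>I. s (c i) (x i))"
    using assms(4) unfolding linear_within_def by blast
  moreover have "f (s (c j) (x j)) = t (c j) (f (x j))"
    using insert.prems assms(4) unfolding linear_within_def by blast
  moreover have "f (\<Sum>i\<in>I. s (c i) (x i)) = (\<Sum>i\<in>I. t (c i) (f (x i)))"
    using insert.prems by (intro insert.IH) blast
  ultimately show ?case using insert.hyps by simp
qed

lemma module_mult: "module ((*) :: 'k::field \<Rightarrow> 'k \<Rightarrow> 'k)"
  by standard (auto simp: algebra_simps)

lemma module_fscal: "module (fscal :: 'k::field \<Rightarrow> ('x \<Rightarrow> 'k) \<Rightarrow> 'x \<Rightarrow> 'k)"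
  using vector_space_fscal by (simp add: module_iff_vector_space)

lemma dim_le_kernel_image:
  fixes f :: "('x \<Rightarrow> 'k::field) \<Rightarrow> ('y \<Rightarrow> 'k)"
  assumes V: "fs.subspace V" "finite B" "V \<subseteq> fs.span B" and f: "linear_within V fscal fscal f"
  shows "fs.dim V \<le> fs.dim {v \<in> V. f v = 0} + fs.dim (f ` V)"
proof -
  note lsum = linear_within_sum[OF module_fscal module_fscal V(1) f]
  let ?K = "{v \<in> V. f v = 0}"
  obtain E where E: "finite E" "E \<subseteq> V" "fs.independent E" "V \<subseteq> fs.span E" "card E = fs.dim V"
    by (rule fs.finite_basis_exists[OF V(2,3)])
  have KB: "?K \<subseteq> fs.span B" using V by blast
  obtain A where A: "finite A" "A \<subseteq> ?K" "fs.independent A" "?K \<subseteq> fs.span A" "card A = fs.dim ?K"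
    by (rule fs.finite_basis_exists[OF V(2) KB])
  have "f ` V \<subseteq> fs.span (f ` E)"
  proof
    fix w assume "w \<in> f ` V"
    then obtain v where v: "v \<in> V" "w = f v" by blast
    then have "v \<in> fs.span E" using E by blast
    then obtain u where "v = (\<Sum>e\<in>E. fscal (u e) e)"
      using fs.span_finite[OF E(1)] by auto
    then have "w = (\<Sum>e\<in>E. fscal (u e) (f e))"
      using v lsum[OF E(1), of "\<lambda>e. e" u] E by auto
    then show "w \<in> fs.span (f ` E)"
      by (simp only:) (intro fs.span_sum fs.span_scale fs.span_base imageI)
  qed
  then have fE: "f ` V \<subseteq> fs.span (f ` E)" .
  obtain C where C: "finite C" "C \<subseteq> f ` V" "fs.independent C" "f ` V \<subseteq> fs.span C" "card C = fs.dim (f ` V)"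
    by (rule fs.finite_basis_exists[OF finite_imageI[OF E(1)] fE])
  have "\<forall>c\<in>C. \<exists>v. v \<in> V \<and> f v = c" using C(2) by blast
  then obtain g where g: "\<And>c. c \<in> C \<Longrightarrow> g c \<in> V \<and> f (g c) = c"
    unfolding bchoice_iff by blast
  have "V \<subseteq> fs.span (A \<union> g ` C)"
  proof
    fix v assume v: "v \<in> V"
    then have "f v \<in> fs.span C" using C by blast
    then obtain u where u: "f v = (\<Sum>c\<in>C. fscal (u c) c)"
      using fs.span_finite[OF C(1)] by auto
    define w where "w = (\<Sum>c\<in>C. fscal (u c) (g c))"
    have wV: "w \<in> V" unfolding w_def
      using g V(1) by (intro fs.subspace_sum fs.subspace_scale) auto
    have "f w = (\<Sum>c\<in>C. fscal (u c) (f (g c)))" unfolding w_def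
      using g by (intro lsum[OF C(1)]) auto
    also have "\<dots> = f v" unfolding u using g by (intro sum.cong) auto
    finally have fw: "f w = f v" .
    have "f (v + fscal (- 1) w) = f v + f (fscal (- 1) w)"
      using f v wV V(1) unfolding linear_within_def by (blast intro: fs.subspace_scale)
    moreover have "f (fscal (- 1) w) = fscal (- 1) (f w)" using f wV unfolding linear_within_def by blast
    ultimately have "f (v - w) = 0" using fw by simp
    then have "v - w \<in> fs.span A" using A v wV V(1) fs.subspace_diff by blast
    then have 1: "v - w \<in> fs.span (A \<union> g ` C)" using fs.span_mono[of A "A \<union> g ` C"] by blast
    have 2: "w \<in> fs.span (A \<union> g ` C)" unfolding w_def
      by (intro fs.span_sum fs.span_scale fs.span_base) blast
    from fs.span_add[OF 1 2] show "v \<in> fs.span (A \<union> g ` C)" by simp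
  qed
  then have "fs.dim V \<le> card (A \<union> g ` C)" using A C by (intro fs.dim_le_card) auto
  also have "\<dots> \<le> card A + card (g ` C)" by (rule card_Un_le)
  also have "card (g ` C) \<le> card C" using C by (intro card_image_le)
  finally show ?thesis using A C by simp
qed

lemma subspace_linear_image:
  assumes V: "fs.subspace V" and f: "linear_within V fscal fscal f"
  shows "fs.subspace (f ` V)"
proof (rule fs.subspaceI)
  have "f 0 = 0" using linear_within_zero[OF module_fscal module_fscal V f] .
  then show "0 \<in> f ` V" using fs.subspace_0[OF V] by force
next
  fix x y assume "x \<in> f ` V" "y \<in> f ` V"
  then obtain v w where "v \<in> V" "w \<in> V" "x = f v" "y = f w" by blast
  then have "x + y = f (v + w)" "v + w \<in> V"
    using f V by (auto simp: linear_within_def intro: fs.subspace_add)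
  then show "x + y \<in> f ` V" by blast
next
  fix c x assume "x \<in> f ` V"
  then obtain v where "v \<in> V" "x = f v" by blast
  then have "fscal c x = f (fscal c v)" "fscal c v \<in> V"
    using f V by (auto simp: linear_within_def intro: fs.subspace_scale)
  then show "fscal c x \<in> f ` V" by blast
qed

text \<open>
  Successive kernels: the dimensions of the images add up to the dimension of \<open>V 0\<close>, so none of them
  can be smaller than the space that contains it.
\<close>

lemma kernel_chain_surjective:
  fixes f :: "nat \<Rightarrow> ('x \<Rightarrow> 'k::field) \<Rightarrow> ('y \<Rightarrow> 'k)"
  assumes B: "finite B" "V 0 \<subseteq> fs.span B"
    and sub: "\<And>i. i \<le> m \<Longrightarrow> fs.subspace (V i)"
    and lin: "\<And>i. i < m \<Longrightarrow> linear_within (V i) fscal fscal (f i)"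
    and ker: "\<And>i. i < m \<Longrightarrow> V (Suc i) = {v \<in> V i. f i v = 0}"
    and final: "V m = {0}"
    and im: "\<And>i. i < m \<Longrightarrow> f i ` V i \<subseteq> W i"
    and W: "\<And>i. i < m \<Longrightarrow> finite (C i) \<and> card (C i) \<le> d i \<and> W i = fs.span (C i)"
    and sum: "(\<Sum>i<m. d i) \<le> fs.dim (V 0)"
    and j: "j < m"
  shows "f j ` V j = W j"
proof (rule ccontr)
  assume neq: "f j ` V j \<noteq> W j"
  have VB: "V i \<subseteq> fs.span B" if "i \<le> m" for i
    using that by (induction i) (use B ker in auto)
  have Wd: "fs.dim (W i) \<le> d i" if "i < m" for i
    using W[OF that] fs.dim_le_card[of "W i" "C i"] by simp
  have le: "fs.dim (f i ` V i) \<le> d i" if "i < m" for i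
    using fs.dim_mono_finite[of "C i" "W i" "f i ` V i"] W[OF that] im[OF that] Wd[OF that] by simp
  have lt: "fs.dim (f j ` V j) < d j"
  proof -
    have "fs.dim (f j ` V j) < fs.dim (W j)"
      using W[OF j] im[OF j] neq subspace_linear_image[OF sub lin[OF j]] j
      by (intro fs.dim_strict_mono_finite[of "C j"]) auto
    then show ?thesis using Wd[OF j] by simp
  qed
  define g h where "g n = fs.dim (V n)" and "h n = fs.dim (f n ` V n)" for n
  have gh: "g n \<le> g (Suc n) + h n" if "n < m" for n
    using dim_le_kernel_image[OF sub B(1) VB lin, of n] ker[OF that] that by (simp add: g_def h_def)
  have "g 0 \<le> g n + (\<Sum>i<n. h i)" if "n \<le> m" for n
    using that
  proof (induction n)
    case (Suc n)
    then show ?case using gh[of n] by simp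
  qed simp
  then have "fs.dim (V 0) \<le> fs.dim (V m) + (\<Sum>i<m. fs.dim (f i ` V i))"
    by (simp add: g_def h_def)
  then have "fs.dim (V 0) \<le> (\<Sum>i<m. fs.dim (f i ` V i))"
    using final fs.dim_le_card[of "V m" "{}"] by simp
  also have "\<dots> < (\<Sum>i<m. d i)"
    using le lt j by (intro sum_strict_mono_ex1) auto
  finally show False using sum by simp
qed

lemma independent_by_coordinates:
  fixes x :: "'i \<Rightarrow> ('x \<Rightarrow> 'k::field)"
  assumes I: "finite I"
    and add: "\<And>i u v. i \<in> I \<Longrightarrow> e i (u + v) = e i u + (e i v :: 'k)"
    and scal: "\<And>i c v. i \<in> I \<Longrightarrow> e i (fscal c v) = c * e i v"
    and ex: "\<And>i j. i \<in> I \<Longrightarrow> j \<in> I \<Longrightarrow> e i (x j) = (if i = j then 1 else 0)"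
    and B: "finite B" "V \<subseteq> fs.span B" and V: "\<And>i. i \<in> I \<Longrightarrow> x i \<in> V"
  shows "card I \<le> fs.dim V"
proof -
  have inj: "inj_on x I" using ex by (intro inj_onI) (metis zero_neq_one)
  have e0: "e i 0 = 0" if "i \<in> I" for i using scal[OF that, of 0 0] by simp
  have esum: "e i (\<Sum>j\<in>I. fscal (u j) (x j)) = (\<Sum>j\<in>I. u j * e i (x j))" if "i \<in> I" for i u
    using linear_within_sum[OF module_fscal module_mult fs.subspace_UNIV, of "e i"] I add[OF that] scal[OF that]
    by (simp add: linear_within_def)
  have "fs.independent (x ` I)"
  proof (rule fs.independent_if_scalars_zero)
    fix u v assume 0: "(\<Sum>w\<in>x ` I. fscal (u w) w) = 0" and "v \<in> x ` I"
    then obtain i where i: "i \<in> I" "v = x i" by blast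
    have "0 = e i (\<Sum>j\<in>I. fscal (u (x j)) (x j))"
      using 0 inj i e0 by (simp add: sum.reindex)
    also have "\<dots> = (\<Sum>j\<in>I. u (x j) * (if i = j then 1 else 0))"
      unfolding esum[OF i(1)] using ex i by (intro sum.cong) auto
    also have "\<dots> = (\<Sum>j\<in>I. if i = j then u (x i) else 0)" by (intro sum.cong) auto
    also have "\<dots> = u v" unfolding i(2) using I i(1) by simp
    finally show "u v = 0" by simp
  qed (use I in auto)
  then have "card (x ` I) \<le> fs.dim V"
    using V B by (intro fs.independent_card_le_dim_finite(2)) auto
  then show ?thesis using inj by (simp add: card_image)
qed

section \<open>Interpolation\<close>

lemma infinite_alg_closed: "infinite (UNIV :: 'k::alg_closed_field set)"
proof
  assume fin: "finite (UNIV :: 'k set)"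
  define P where "P = (\<Prod>a\<in>(UNIV :: 'k set). [:- a, 1:])"
  have "degree P = card (UNIV :: 'k set)"
    unfolding P_def by (subst degree_prod_sum_eq) auto
  then have "degree P > 0" using fin by (simp add: finite_UNIV_card_ge_0)
  then have "degree (P + 1) > 0" by (subst degree_add_eq_left) auto
  then obtain x where x: "poly (P + 1) x = 0" using alg_closed_imp_poly_has_root by blast
  have "poly P x = 0" unfolding P_def poly_prod using fin by (intro prod_zero) auto
  with x show False by simp
qed

lemma power_eq_all_imp_eq:
  assumes "\<And>z :: 'k::alg_closed_field. z \<noteq> 0 \<Longrightarrow> z ^ m = z ^ n"
  shows "m = n"
proof (rule ccontr)
  assume "m \<noteq> n"
  then have "monom (1 :: 'k) m - monom 1 n \<noteq> 0" by (simp add: monom_eq_iff')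
  from poly_roots_finite[OF this] have "finite {z :: 'k. z ^ m - z ^ n = 0}" by (simp add: poly_monom)
  moreover have "UNIV - {0} \<subseteq> {z :: 'k. z ^ m - z ^ n = 0}" using assms by auto
  ultimately show False using infinite_alg_closed[where 'k='k] finite_subset by fastforce
qed

lemma double_poly_zero:
  fixes M :: "nat \<Rightarrow> nat \<Rightarrow> 'k::alg_closed_field"
  assumes "\<And>h. (\<Sum>k\<le>r. \<Sum>l\<le>s. M k l * h ^ e k l) = 0"
  shows "(\<Sum>k\<le>r. \<Sum>l\<le>s. if e k l = n then M k l else 0) = 0"
proof -
  define P where "P = (\<Sum>k\<le>r. \<Sum>l\<le>s. monom (M k l) (e k l))"
  have "poly P h = 0" for h using assms[of h] by (simp add: P_def poly_sum poly_monom)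
  then have "{h. poly P h = 0} = UNIV" by auto
  then have "P = 0" using poly_roots_finite[of P] infinite_alg_closed[where 'k='k] by auto
  then have "coeff P n = 0" by simp
  then show ?thesis by (simp add: P_def coeff_sum)
qed

lemma poly_coeffs_zero:
  fixes x :: "nat \<Rightarrow> 'k::alg_closed_field"
  assumes "\<And>q. (\<Sum>a\<le>N. x a * q ^ a) = 0" and "a \<le> N"
  shows "x a = 0"
  using double_poly_zero[where r = N and s = 0 and M = "\<lambda>a _. x a" and e = "\<lambda>a _. a" and n = a] assms by simp

text \<open>
  The \<open>j\<close>-th coefficient of a polynomial of degree at most \<open>N\<close> is a fixed linear combination of its
  values at \<open>N + 1\<close> nonzero points; the weights are coefficients of the Lagrange polynomials.  This
  serves to extract coefficients by group elements, both for functions in an induced module and for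
  weight components.
\<close>

lemma interpolation_functional:
  assumes inf: "infinite (UNIV :: 'k::field set)"
  shows "\<exists>(K :: 'k set) \<kappa>. finite K \<and> 0 \<notin> K \<and> (\<forall>n\<le>N. (\<Sum>q\<in>K. \<kappa> q * q ^ n) = (if n = j then 1 else 0))"
proof -
  have "infinite (UNIV - {0 :: 'k})" using inf by simp
  then obtain K where K: "K \<subseteq> UNIV - {0 :: 'k}" "card K = Suc N" "finite K"
    using infinite_arbitrarily_large by blast
  define l where "l = (\<lambda>q. \<Prod>x\<in>K - {q}. smult (1 / (q - x)) [:- x, 1:])"
  have deg: "degree (l q) \<le> N" if "q \<in> K" for q
  proof -
    have "degree (l q) \<le> (\<Sum>x\<in>K - {q}. degree (smult (1 / (q - x)) [:- x, 1:]))" unfolding l_def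
      by (rule order_trans[OF degree_prod_sum_le]) (use K in auto)
    also have "\<dots> \<le> (\<Sum>x\<in>K - {q}. 1)"
      by (intro sum_mono order_trans[OF degree_smult_le]) simp
    finally have "degree (l q) \<le> (\<Sum>x\<in>K - {q}. 1)" .
    then show ?thesis using K that by simp
  qed
  have pl: "poly (l q) x = (if x = q then 1 else 0)" if "q \<in> K" "x \<in> K" for q x
  proof (cases "x = q")
    case True
    then have "poly (smult (1 / (q - y)) [:- y, 1:]) x = 1" if "y \<in> K - {q}" for y
      using that by (auto simp flip: diff_divide_distrib)
    then have "poly (l q) x = 1" unfolding l_def poly_prod by (intro prod.neutral) blast
    then show ?thesis using True by simp
  next
    case False
    then have "poly (l q) x = 0" unfolding l_def poly_prod
      using K that by (intro prod_zero) auto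
    then show ?thesis using False by simp
  qed
  have "(\<Sum>q\<in>K. coeff (l q) j * q ^ n) = (if n = j then 1 else 0)" if n: "n \<le> N" for n
  proof -
    have "monom 1 n = (\<Sum>q\<in>K. smult (q ^ n) (l q))"
    proof (rule poly_eqI_degree[where A = K])
      fix x assume "x \<in> K"
      then have "(\<Sum>q\<in>K. q ^ n * poly (l q) x) = (\<Sum>q\<in>K. if x = q then x ^ n else 0)"
        by (intro sum.cong refl) (simp add: pl)
      then show "poly (monom 1 n) x = poly (\<Sum>q\<in>K. smult (q ^ n) (l q)) x"
        using K \<open>x \<in> K\<close> by (simp add: poly_sum poly_monom)
    next
      show "degree (monom (1::'k) n) < card K" using K n by (simp add: degree_monom_eq)
      have "degree (\<Sum>q\<in>K. smult (q ^ n) (l q)) \<le> N"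
        using deg K by (intro degree_sum_le) (auto intro: order_trans[OF degree_smult_le])
      then show "degree (\<Sum>q\<in>K. smult (q ^ n) (l q)) < card K" using K by simp
    qed
    then have "coeff (monom 1 n) j = (\<Sum>q\<in>K. q ^ n * coeff (l q) j)" by (simp add: coeff_sum)
    then show ?thesis by (simp add: mult.commute)
  qed
  then show ?thesis
    using K by (intro exI[of _ K] exI[of _ "\<lambda>q. coeff (l q) j"]) auto
qed

section \<open>The group and its regular functions\<close>

definition mat2 :: "'k \<Rightarrow> 'k \<Rightarrow> 'k \<Rightarrow> 'k \<Rightarrow> 'k::field ^ 2 ^ 2" where
  "mat2 a b c d = vector [vector [a, b], vector [c, d]]"

lemma mat2_entries [simp]:
  "mat2 a b c d $ 1 $ 1 = a" "mat2 a b c d $ 1 $ 2 = b"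
  "mat2 a b c d $ 2 $ 1 = c" "mat2 a b c d $ 2 $ 2 = d"
  by (simp_all add: mat2_def)

lemma mat2_eq_iff: "(x :: 'k::field ^ 2 ^ 2) = y \<longleftrightarrow>
    x $ 1 $ 1 = y $ 1 $ 1 \<and> x $ 1 $ 2 = y $ 1 $ 2 \<and> x $ 2 $ 1 = y $ 2 $ 1 \<and> x $ 2 $ 2 = y $ 2 $ 2"
  by (auto simp: vec_eq_iff forall_2)

lemma matrix_mult_entry: "((x :: 'k::field ^ 2 ^ 2) ** y) $ i $ j = x $ i $ 1 * y $ 1 $ j + x $ i $ 2 * y $ 2 $ j"
  by (simp add: matrix_matrix_mult_def sum_2)

lemma mat2_in_SL2 [simp]: "mat2 a b c d \<in> SL2 \<longleftrightarrow> a * d - b * c = 1"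
  by (simp add: SL2_def det_2)

lemma SL2_det: "g \<in> SL2 \<Longrightarrow> g $ 1 $ 1 * g $ 2 $ 2 - g $ 1 $ 2 * g $ 2 $ 1 = 1"
  by (simp add: SL2_def det_2)

lemma SL2_one [simp]: "mat 1 \<in> SL2"
  by (simp add: SL2_def)

lemma SL2_mult [simp]: "g \<in> SL2 \<Longrightarrow> h \<in> SL2 \<Longrightarrow> g ** h \<in> SL2"
  by (simp add: SL2_def det_mul)

lemma SL2_mult_iff: "g \<in> SL2 \<Longrightarrow> x ** g \<in> SL2 \<longleftrightarrow> x \<in> SL2" "g \<in> SL2 \<Longrightarrow> g ** x \<in> SL2 \<longleftrightarrow> x \<in> SL2"
  by (simp_all add: SL2_def det_mul)

lemma matrix_inv_SL2_eq:
  assumes "g \<in> SL2"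
  shows "matrix_inv g = mat2 (g $ 2 $ 2) (- (g $ 1 $ 2)) (- (g $ 2 $ 1)) (g $ 1 $ 1)"
proof -
  let ?h = "mat2 (g $ 2 $ 2) (- (g $ 1 $ 2)) (- (g $ 2 $ 1)) (g $ 1 $ 1)"
  have "g ** ?h = mat 1"
    using SL2_det[OF assms] by (simp add: mat2_eq_iff matrix_mult_entry mat_def algebra_simps)
  then have "matrix_inv g ** (g ** ?h) = matrix_inv g" by simp
  then show ?thesis using matrix_inv_SL2(3)[OF assms] by (simp add: matrix_mul_assoc)
qed

lemma matrix_inv_SL2_mult:
  assumes "g \<in> SL2" "h \<in> SL2"
  shows "matrix_inv (g ** h) = matrix_inv h ** matrix_inv g"
  using assms by (simp add: matrix_inv_SL2_eq) (simp add: mat2_eq_iff matrix_mult_entry algebra_simps)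

lemma matrix_inv_SL2_inv:
  assumes "g \<in> SL2" shows "matrix_inv (matrix_inv g) = g"
proof -
  have "matrix_inv g \<in> SL2" using assms by (rule matrix_inv_SL2)
  then have "matrix_inv (matrix_inv g) = mat2 (matrix_inv g $ 2 $ 2) (- (matrix_inv g $ 1 $ 2)) (- (matrix_inv g $ 2 $ 1)) (matrix_inv g $ 1 $ 1)"
    by (rule matrix_inv_SL2_eq)
  then show ?thesis unfolding matrix_inv_SL2_eq[OF assms] by (simp add: mat2_eq_iff)
qed

lemma regular_off_SL2: "f \<in> regular_functions \<Longrightarrow> g \<notin> SL2 \<Longrightarrow> f g = 0"
  by (induction rule: regular_functions.induct) (auto simp: on_SL2_def)

lemma regular_on_SL2_cong: "(\<And>g. g \<in> SL2 \<Longrightarrow> f g = h g) \<Longrightarrow> on_SL2 f = on_SL2 h"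
  by (auto simp: on_SL2_def)

lemma regular_mult: "on_SL2 f \<in> regular_functions \<Longrightarrow> on_SL2 h \<in> regular_functions
    \<Longrightarrow> on_SL2 (\<lambda>g. f g * h g) \<in> regular_functions"
  by (drule (1) regular_functions.mult) (auto simp: on_SL2_def if_distrib cong: if_cong)

lemma regular_add: "on_SL2 f \<in> regular_functions \<Longrightarrow> on_SL2 h \<in> regular_functions
    \<Longrightarrow> on_SL2 (\<lambda>g. f g + h g) \<in> regular_functions"
  by (drule (1) regular_functions.add) (auto simp: on_SL2_def if_distrib cong: if_cong)

lemma regular_power: "on_SL2 f \<in> regular_functions \<Longrightarrow> on_SL2 (\<lambda>g. f g ^ n) \<in> regular_functions"
  by (induction n) (auto intro: regular_functions.const regular_mult)

lemma regular_sum: "(\<And>i. i \<in> I \<Longrightarrow> on_SL2 (f i) \<in> regular_functions) \<Longrightarrow> on_SL2 (\<lambda>g. \<Sum>i\<in>I. f i g) \<in> regular_functions"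
  by (induction I rule: infinite_finite_induct) (auto intro: regular_functions.const regular_add)

lemma regular_compose:
  assumes f: "f \<in> regular_functions" and T: "\<And>g. g \<in> SL2 \<Longrightarrow> T g \<in> SL2"
    and entries: "\<And>i j. on_SL2 (\<lambda>g. T g $ i $ j) \<in> regular_functions"
  shows "on_SL2 (\<lambda>g. f (T g)) \<in> regular_functions"
  using f
proof (induction rule: regular_functions.induct)
  case (const c)
  have "on_SL2 (\<lambda>g. on_SL2 (\<lambda>_. c) (T g)) = on_SL2 (\<lambda>_. c)" using T by (auto simp: on_SL2_def)
  then show ?case by (simp add: regular_functions.const)
next
  case (entry i j)
  have "on_SL2 (\<lambda>g. on_SL2 (\<lambda>g. g $ i $ j) (T g)) = on_SL2 (\<lambda>g. T g $ i $ j)" using T by (auto simp: on_SL2_def)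
  then show ?case by (simp add: entries)
qed (auto intro: regular_add regular_mult)

lemma regular_right_translate:
  assumes "f \<in> regular_functions" "g \<in> SL2"
  shows "(\<lambda>x. f (x ** g)) \<in> regular_functions"
proof -
  have "on_SL2 (\<lambda>x. f (x ** g)) \<in> regular_functions"
    by (rule regular_compose[OF assms(1)])
      (use assms(2) in \<open>auto simp: matrix_mult_entry intro!: regular_add regular_mult regular_functions.entry regular_functions.const\<close>)
  moreover have "on_SL2 (\<lambda>x. f (x ** g)) = (\<lambda>x. f (x ** g))"
    using regular_off_SL2[OF assms(1)] SL2_mult_iff[OF assms(2)] by (auto simp: on_SL2_def)
  ultimately show ?thesis by simp
qed

lemma regular_left_translate:
  assumes "f \<in> regular_functions" "g \<in> SL2"
  shows "on_SL2 (\<lambda>x. f (g ** x)) \<in> regular_functions"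
  by (rule regular_compose[OF assms(1)])
    (use assms(2) in \<open>auto simp: matrix_mult_entry intro!: regular_add regular_mult regular_functions.entry regular_functions.const\<close>)

lemma regular_inverse:
  assumes "f \<in> regular_functions"
  shows "on_SL2 (\<lambda>x. f (matrix_inv x)) \<in> regular_functions"
proof (rule regular_compose[OF assms])
  fix i j :: 2
  have *: "on_SL2 (\<lambda>g. - 1 * g $ k $ l) \<in> regular_functions" for k l
    by (intro regular_mult regular_functions.const regular_functions.entry)
  have "on_SL2 (\<lambda>g. mat2 (g $ 2 $ 2) (- (g $ 1 $ 2)) (- (g $ 2 $ 1)) (g $ 1 $ 1) $ i $ j) \<in> regular_functions"
    using exhaust_2[of i] exhaust_2[of j] *[of 1 2] *[of 2 1] by (auto intro: regular_functions.entry)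
  also have "on_SL2 (\<lambda>g. mat2 (g $ 2 $ 2) (- (g $ 1 $ 2)) (- (g $ 2 $ 1)) (g $ 1 $ 1) $ i $ j) = on_SL2 (\<lambda>g. matrix_inv g $ i $ j)"
    by (rule regular_on_SL2_cong) (simp add: matrix_inv_SL2_eq)
  finally show "on_SL2 (\<lambda>g. matrix_inv g $ i $ j) \<in> regular_functions" .
qed (rule matrix_inv_SL2)

text \<open>
  Restricted to a polynomial curve in the group, a regular function is a polynomial in the parameter.
\<close>

lemma regular_along_curve:
  assumes f: "f \<in> regular_functions" and A: "\<And>z. A z \<in> SL2"
    and entries: "\<And>i j. \<exists>P. \<forall>z. A z $ i $ j = poly P z"
  shows "\<exists>P. \<forall>z. f (A z) = poly P z"
  using f
proof (induction rule: regular_functions.induct)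
  case (const c)
  show ?case by (rule exI[of _ "[:c:]"]) (simp add: on_SL2_def A)
next
  case (entry i j)
  show ?case using entries[of i j] by (simp add: on_SL2_def A)
next
  case (add f h)
  then show ?case by (metis poly_add)
next
  case (mult f h)
  then show ?case by (metis poly_mult)
qed

section \<open>Induced modules as spaces of binary forms\<close>

definition monomial_fn :: "nat \<Rightarrow> nat \<Rightarrow> 'k::field gfun" where
  "monomial_fn r i = on_SL2 (\<lambda>g. g $ 1 $ 1 ^ i * g $ 1 $ 2 ^ (r - i))"

lemma scal_nabla [simp]: "scal (nabla r) = fscal"
  and act_nabla: "act (nabla r) g f = (\<lambda>x. f (x ** g))"
  by (simp_all add: nabla_def)

lemma nabla_memI:
  "f \<in> regular_functions \<Longrightarrow> (\<And>b x. b \<in> borel2 \<Longrightarrow> x \<in> SL2 \<Longrightarrow> f (b ** x) = (b $ 1 $ 1) ^ r * f x) \<Longrightarrow> f \<in> vecs (nabla r)"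
  by (simp add: nabla_def)

lemma nabla_memD:
  assumes "f \<in> vecs (nabla r)"
  shows "f \<in> regular_functions" "b \<in> borel2 \<Longrightarrow> x \<in> SL2 \<Longrightarrow> f (b ** x) = (b $ 1 $ 1) ^ r * f x"
  using assms by (simp_all add: nabla_def)

lemma monomial_fn_nabla:
  assumes "i \<le> r" shows "monomial_fn r i \<in> vecs (nabla r)"
proof (rule nabla_memI)
  show "monomial_fn r i \<in> regular_functions"
    unfolding monomial_fn_def by (intro regular_mult regular_power regular_functions.entry)
  fix b x :: "'a ^ 2 ^ 2" assume b: "b \<in> borel2" and x: "x \<in> SL2"
  then have "b \<in> SL2" "b $ 1 $ 2 = 0" by (auto simp: borel2_def)
  moreover have "(b $ 1 $ 1) ^ r = (b $ 1 $ 1) ^ i * (b $ 1 $ 1) ^ (r - i)"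
    using assms by (simp flip: power_add)
  ultimately show "monomial_fn r i (b ** x) = (b $ 1 $ 1) ^ r * monomial_fn r i x"
    using x by (simp add: monomial_fn_def on_SL2_def matrix_mult_entry power_mult_distrib)
qed

lemma nabla_subspace: "fs.subspace (vecs (nabla r :: ('k::field, 'k gfun) gmodule))"
proof (rule fs.subspaceI)
  let ?V = "vecs (nabla r :: ('k, 'k gfun) gmodule)"
  have "(\<lambda>_. 0 :: 'k) = on_SL2 (\<lambda>_. 0)" by (auto simp: on_SL2_def)
  then have "(\<lambda>_. 0 :: 'k) \<in> regular_functions" by (metis regular_functions.const)
  then have "(0 :: 'k gfun) \<in> regular_functions" by (simp add: zero_fun_def)
  then show "0 \<in> ?V" by (intro nabla_memI) auto
  show "f + h \<in> ?V" if "f \<in> ?V" "h \<in> ?V" for f h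
  proof (rule nabla_memI)
    show "f + h \<in> regular_functions"
      using regular_functions.add[OF nabla_memD(1)[OF that(1)] nabla_memD(1)[OF that(2)]] by (simp add: plus_fun_def)
    show "\<And>b x. b \<in> borel2 \<Longrightarrow> x \<in> SL2 \<Longrightarrow> (f + h) (b ** x) = (b $ 1 $ 1) ^ r * (f + h) x"
      using nabla_memD(2)[OF that(1)] nabla_memD(2)[OF that(2)] by (simp add: distrib_left)
  qed
  show "fscal c f \<in> ?V" if f: "f \<in> ?V" for c f
  proof (rule nabla_memI)
    have "(\<lambda>g. on_SL2 (\<lambda>_. c) g * f g) \<in> regular_functions"
      using f by (intro regular_functions.mult regular_functions.const nabla_memD)
    moreover have "(\<lambda>g. on_SL2 (\<lambda>_. c) g * f g) = fscal c f"
      using regular_off_SL2[OF nabla_memD(1)[OF f]] by (auto simp: on_SL2_def fun_eq_iff)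
    ultimately show "fscal c f \<in> regular_functions" by simp
    show "\<And>b x. b \<in> borel2 \<Longrightarrow> x \<in> SL2 \<Longrightarrow> fscal c f (b ** x) = (b $ 1 $ 1) ^ r * fscal c f x"
      using nabla_memD(2)[OF f] by simp
  qed
qed

lemma act_nabla_closed:
  fixes f :: "'k::field gfun"
  assumes "f \<in> vecs (nabla r)" "g \<in> SL2"
  shows "act (nabla r) g f \<in> vecs (nabla r)"
proof (rule nabla_memI)
  show "act (nabla r) g f \<in> regular_functions"
    unfolding act_nabla using assms nabla_memD(1) by (intro regular_right_translate)
  fix b x :: "'k ^ 2 ^ 2" assume "b \<in> borel2" "x \<in> SL2"
  then show "act (nabla r) g f (b ** x) = (b $ 1 $ 1) ^ r * act (nabla r) g f x"
    unfolding act_nabla using nabla_memD(2)[OF assms(1), of b "x ** g"] assms(2)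
    by (simp add: matrix_mul_assoc)
qed

text \<open>
  A matrix with first row \<open>t\<close> times that of \<open>y\<close> differs from \<open>y\<close> by a left factor in the Borel
  subgroup with upper left entry \<open>t\<close>.
\<close>

lemma nabla_proportional_rows:
  assumes f: "f \<in> vecs (nabla r)" and x: "x \<in> SL2" "y \<in> SL2"
    and t: "x $ 1 $ 1 = t * y $ 1 $ 1" "x $ 1 $ 2 = t * y $ 1 $ 2"
  shows "f x = t ^ r * f y"
proof -
  note iy = matrix_inv_SL2[OF x(2)]
  let ?b = "x ** matrix_inv y"
  have dy: "y $ 1 $ 1 * y $ 2 $ 2 - y $ 1 $ 2 * y $ 2 $ 1 = 1" using SL2_det[OF x(2)] .
  have "?b $ 1 $ 1 = t * (y $ 1 $ 1 * y $ 2 $ 2 - y $ 1 $ 2 * y $ 2 $ 1)"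
    by (simp add: matrix_mult_entry matrix_inv_SL2_eq[OF x(2)] t algebra_simps)
  then have b11: "?b $ 1 $ 1 = t" using dy by simp
  have "?b $ 1 $ 2 = 0"
    by (simp add: matrix_mult_entry matrix_inv_SL2_eq[OF x(2)] t)
  then have "?b \<in> borel2" using x iy by (simp add: borel2_def)
  from nabla_memD(2)[OF f this x(2)] show ?thesis
    using b11 iy by (simp flip: matrix_mul_assoc)
qed

text \<open>
  A matrix with first row \<open>(z, 1)\<close>; the values at these matrices are those of the dehomogenised
  polynomial.  For \<open>z = 0\<close> it represents the nontrivial element of the Weyl group.
\<close>

abbreviation row_point :: "'k \<Rightarrow> 'k::field ^ 2 ^ 2" where
  "row_point z \<equiv> mat2 z 1 (- 1) 0"

text \<open>
  Induced modules consist of homogeneous polynomials in the first row.  On rows \<open>(z, 1)\<close> and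
  \<open>(1, z)\<close> the function is a polynomial \<open>\<phi>\<close> and \<open>\<psi>\<close>, respectively, and \<open>\<phi> z = z^r \<psi> (1/z)\<close> for
  \<open>z \<noteq> 0\<close>.  This bounds the degree of \<open>\<phi>\<close> by \<open>r\<close> and shows that the formula coming from \<open>\<phi>\<close> is also
  right where the second entry vanishes.
\<close>

lemma nabla_polynomial:
  fixes f :: "'k::alg_closed_field gfun"
  assumes f: "f \<in> vecs (nabla r)"
  obtains c where "\<And>x. x \<in> SL2 \<Longrightarrow> f x = (\<Sum>i\<le>r. c i * (x $ 1 $ 1 ^ i * x $ 1 $ 2 ^ (r - i)))"
proof -
  have ent: "\<exists>P. \<forall>z :: 'k. row_point z $ i $ j = poly P z"
    "\<exists>P. \<forall>z :: 'k. mat2 1 z 0 1 $ i $ j = poly P z" for i j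
  proof -
    have "row_point z $ i $ j = poly (if i = 1 \<and> j = 1 then [:0, 1:] else [:row_point 0 $ i $ j:]) z"
      "mat2 1 z 0 1 $ i $ j = poly (if i = 1 \<and> j = 2 then [:0, 1:] else [:mat2 1 0 0 1 $ i $ j:]) z" for z :: 'k
      using exhaust_2[of i] exhaust_2[of j] by auto
    then show "\<exists>P. \<forall>z :: 'k. row_point z $ i $ j = poly P z"
      "\<exists>P. \<forall>z :: 'k. mat2 1 z 0 1 $ i $ j = poly P z" by blast+
  qed
  obtain \<phi> where \<phi>: "\<And>z. f (row_point z) = poly \<phi> z"
    using regular_along_curve[OF nabla_memD(1)[OF f], of row_point] ent by auto
  obtain \<psi> where \<psi>: "\<And>z. f (mat2 1 z 0 1) = poly \<psi> z"
    using regular_along_curve[OF nabla_memD(1)[OF f], of "\<lambda>z. mat2 1 z 0 1"] ent by auto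
  define n where "n = degree \<psi>"
  have eq: "monom 1 n * \<phi> = monom 1 r * reflect_poly \<psi>"
  proof -
    have "poly (monom 1 n * \<phi> - monom 1 r * reflect_poly \<psi>) z = 0" if "z \<noteq> 0" for z
    proof -
      have "f (row_point z) = z ^ r * f (mat2 1 (inverse z) 0 1)"
        using that by (intro nabla_proportional_rows[OF f]) auto
      then have "poly \<phi> z = z ^ r * poly \<psi> (inverse z)" by (simp add: \<phi> \<psi>)
      then show ?thesis
        using that by (simp add: poly_monom poly_reflect_poly_nz n_def algebra_simps)
    qed
    then have "UNIV - {0} \<subseteq> {z. poly (monom 1 n * \<phi> - monom 1 r * reflect_poly \<psi>) z = 0}" by auto
    moreover have "infinite (UNIV - {0 :: 'k})" using infinite_alg_closed by simp
    ultimately have "infinite {z. poly (monom 1 n * \<phi> - monom 1 r * reflect_poly \<psi>) z = 0}"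
      using finite_subset by blast
    then show ?thesis using poly_roots_finite by (metis eq_iff_diff_eq_0)
  qed
  have coeffs: "coeff \<phi> m = (if r \<le> m + n then coeff (reflect_poly \<psi>) (m + n - r) else 0)" for m
    using arg_cong[OF eq, of "\<lambda>P. coeff P (m + n)"] by (simp add: coeff_monom_mult)
  have deg: "degree \<phi> \<le> r"
  proof (rule degree_le, intro allI impI)
    fix m assume "r < m"
    then show "coeff \<phi> m = 0" using coeffs[of m] by (simp add: coeff_reflect_poly n_def)
  qed
  show ?thesis
  proof
    fix x :: "'k ^ 2 ^ 2" assume x: "x \<in> SL2"
    show "f x = (\<Sum>i\<le>r. coeff \<phi> i * (x $ 1 $ 1 ^ i * x $ 1 $ 2 ^ (r - i)))"
    proof (cases "x $ 1 $ 2 = 0")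
      case False
      let ?a = "x $ 1 $ 1" and ?b = "x $ 1 $ 2"
      have "f x = ?b ^ r * f (row_point (?a / ?b))"
        using False x by (intro nabla_proportional_rows[OF f]) auto
      also have "f (row_point (?a / ?b)) = (\<Sum>i\<le>r. coeff \<phi> i * (?a / ?b) ^ i)"
        unfolding \<phi> poly_altdef using deg by (intro sum.mono_neutral_left) (auto simp: coeff_eq_0)
      also have "?b ^ r * \<dots> = (\<Sum>i\<le>r. coeff \<phi> i * (?a ^ i * ?b ^ (r - i)))"
        unfolding sum_distrib_left
        by (intro sum.cong refl) (use False in \<open>auto simp: power_diff field_simps\<close>)
      finally show ?thesis .
    next
      case True
      have "f x = (x $ 1 $ 1) ^ r * f (mat2 1 0 0 1)"
        using True x by (intro nabla_proportional_rows[OF f]) auto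
      also have "f (mat2 1 0 0 1) = coeff \<psi> 0" by (simp add: \<psi> poly_0_coeff_0)
      also have "coeff \<psi> 0 = coeff \<phi> r" using coeffs[of r] by (simp add: coeff_reflect_poly n_def)
      also have "(x $ 1 $ 1) ^ r * coeff \<phi> r = (\<Sum>i\<le>r. if i = r then (x $ 1 $ 1) ^ r * coeff \<phi> r else 0)"
        by simp
      also have "\<dots> = (\<Sum>i\<le>r. coeff \<phi> i * (x $ 1 $ 1 ^ i * x $ 1 $ 2 ^ (r - i)))"
        by (intro sum.cong refl) (auto simp: True power_0_left)
      finally show ?thesis .
    qed
  qed
qed

text \<open>
  Points and weights of the interpolation formula for the \<open>j\<close>-th coefficient.
\<close>

definition interp :: "nat \<Rightarrow> nat \<Rightarrow> 'k::field set \<times> ('k \<Rightarrow> 'k)" where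
  "interp N j = (SOME K\<kappa>. finite (fst K\<kappa>) \<and> 0 \<notin> fst K\<kappa> \<and>
     (\<forall>n\<le>N. (\<Sum>q\<in>fst K\<kappa>. snd K\<kappa> q * q ^ n) = (if n = j then 1 else 0)))"

lemma interp:
  fixes N j defines "I \<equiv> interp N j :: 'k::alg_closed_field set \<times> ('k \<Rightarrow> 'k)"
  shows "finite (fst I)" "0 \<notin> fst I" "n \<le> N \<Longrightarrow> (\<Sum>q\<in>fst I. snd I q * q ^ n) = (if n = j then 1 else 0)"
proof -
  have "\<exists>K\<kappa> :: 'k set \<times> ('k \<Rightarrow> 'k). finite (fst K\<kappa>) \<and> 0 \<notin> fst K\<kappa> \<and>
     (\<forall>n\<le>N. (\<Sum>q\<in>fst K\<kappa>. snd K\<kappa> q * q ^ n) = (if n = j then 1 else 0))"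
    using interpolation_functional[OF infinite_alg_closed, of N j] by auto
  from someI_ex[OF this] show "finite (fst I)" "0 \<notin> fst I"
    "n \<le> N \<Longrightarrow> (\<Sum>q\<in>fst I. snd I q * q ^ n) = (if n = j then 1 else 0)"
    unfolding I_def interp_def by blast+
qed

text \<open>
  The coefficient of \<open>monomial_fn r j\<close> in an element of \<open>nabla r\<close>.  Writing it through values at
  matrices makes it linear on all functions and regular along the group action.
\<close>

definition coord :: "nat \<Rightarrow> nat \<Rightarrow> 'k::field gfun \<Rightarrow> 'k" where
  "coord r j f = (\<Sum>q\<in>fst (interp r j). snd (interp r j) q * f (row_point q))"

lemma coord_add: "coord r j (f + h) = coord r j f + coord r j h"
  by (simp add: coord_def distrib_left sum.distrib)

lemma coord_fscal: "coord r j (fscal c f) = c * coord r j f"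
  by (simp add: coord_def sum_distrib_left mult.left_commute)

lemma coord_linear: "linear_within V fscal (*) (coord r j)"
  by (simp add: linear_within_def coord_add coord_fscal)

lemma coord_sum: "finite I \<Longrightarrow> coord r j (\<Sum>i\<in>I. fscal (c i) (f i)) = (\<Sum>i\<in>I. c i * coord r j (f i))"
  by (rule linear_within_sum[OF module_fscal module_mult fs.subspace_UNIV coord_linear]) auto

lemma coord_monomial:
  assumes "i \<le> r"
  shows "coord r j (monomial_fn r i :: 'k::alg_closed_field gfun) = (if i = j then 1 else 0)"
  using interp(3)[OF assms, of j, where 'k='k]
  by (simp add: coord_def monomial_fn_def on_SL2_def)

lemma nabla_expansion:
  fixes f :: "'k::alg_closed_field gfun"
  assumes f: "f \<in> vecs (nabla r)"
  shows "f = (\<Sum>i\<le>r. fscal (coord r i f) (monomial_fn r i))"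
proof -
  obtain c where c: "\<And>x. x \<in> SL2 \<Longrightarrow> f x = (\<Sum>i\<le>r. c i * (x $ 1 $ 1 ^ i * x $ 1 $ 2 ^ (r - i)))"
    using nabla_polynomial[OF f] by blast
  have eq: "f = (\<Sum>i\<le>r. fscal (c i) (monomial_fn r i))"
  proof
    fix x show "f x = (\<Sum>i\<le>r. fscal (c i) (monomial_fn r i)) x"
    proof (cases "x \<in> SL2")
      case True then show ?thesis by (simp add: c sum_fun_apply monomial_fn_def on_SL2_def)
    next
      case False then show ?thesis using regular_off_SL2[OF nabla_memD(1)[OF f]]
        by (simp add: sum_fun_apply monomial_fn_def on_SL2_def)
    qed
  qed
  have "coord r j f = c j" if "j \<le> r" for j
  proof -
    have "coord r j f = (\<Sum>i\<le>r. c i * coord r j (monomial_fn r i :: 'k gfun))"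
      by (subst eq) (rule coord_sum, simp)
    also have "\<dots> = (\<Sum>i\<le>r. if i = j then c j else 0)"
      by (intro sum.cong refl) (auto simp: coord_monomial)
    finally show ?thesis using that by simp
  qed
  then show ?thesis by (subst eq) (intro sum.cong refl, simp)
qed

lemma nabla_eq_span: "vecs (nabla r :: ('k::alg_closed_field, 'k gfun) gmodule) = fs.span (monomial_fn r ` {..r})"
proof
  show "vecs (nabla r :: ('k, 'k gfun) gmodule) \<subseteq> fs.span (monomial_fn r ` {..r})"
  proof
    fix f assume f: "f \<in> vecs (nabla r :: ('k, 'k gfun) gmodule)"
    have "(\<Sum>i\<le>r. fscal (coord r i f) (monomial_fn r i)) \<in> fs.span (monomial_fn r ` {..r})"
      by (rule fs.span_sum, rule fs.span_scale, rule fs.span_base, rule imageI)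
    then show "f \<in> fs.span (monomial_fn r ` {..r})"
      by (simp only: nabla_expansion[OF f, symmetric])
  qed
  show "fs.span (monomial_fn r ` {..r}) \<subseteq> vecs (nabla r :: ('k, 'k gfun) gmodule)"
    by (rule fs.span_minimal) (auto intro: monomial_fn_nabla nabla_subspace)
qed

lemma act_nabla_linear: "linear_within V fscal fscal (act (nabla r) g)"
  by (auto simp: linear_within_def act_nabla fun_eq_iff)

lemma act_nabla_coeff_regular:
  assumes f: "f \<in> vecs (nabla r)"
  shows "on_SL2 (\<lambda>g. coord r j (act (nabla r) g f)) \<in> regular_functions"
  unfolding coord_def act_nabla
  by (intro regular_sum regular_mult regular_functions.const regular_left_translate nabla_memD(1)[OF f]) simp

lemma rational_nabla: "rational_module (nabla r :: ('k::alg_closed_field, 'k gfun) gmodule)"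
proof -
  let ?M = "nabla r :: ('k, 'k gfun) gmodule"
  have "on_SL2 (\<lambda>g. \<phi> (act ?M g v)) \<in> regular_functions"
    if \<phi>: "linear_within (vecs ?M) (scal ?M) (*) \<phi>" and v: "v \<in> vecs ?M" for \<phi> v
  proof -
    have "on_SL2 (\<lambda>g. \<Sum>i\<le>r. coord r i (act ?M g v) * \<phi> (monomial_fn r i)) \<in> regular_functions"
      by (intro regular_sum regular_mult regular_functions.const act_nabla_coeff_regular v)
    also have "on_SL2 (\<lambda>g. \<Sum>i\<le>r. coord r i (act ?M g v) * \<phi> (monomial_fn r i)) = on_SL2 (\<lambda>g. \<phi> (act ?M g v))"
    proof (rule regular_on_SL2_cong)
      fix g :: "'k ^ 2 ^ 2" assume "g \<in> SL2"
      then have mem: "act ?M g v \<in> vecs ?M" using v by (rule act_nabla_closed[rotated])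
      have "\<phi> (act ?M g v) = \<phi> (\<Sum>i\<le>r. fscal (coord r i (act ?M g v)) (monomial_fn r i))"
        by (rule arg_cong[OF nabla_expansion[OF mem]])
      also have "\<dots> = (\<Sum>i\<le>r. coord r i (act ?M g v) * \<phi> (monomial_fn r i))"
        using \<phi> by (intro linear_within_sum[OF module_fscal module_mult nabla_subspace]) (auto intro: monomial_fn_nabla)
      finally show "(\<Sum>i\<le>r. coord r i (act ?M g v) * \<phi> (monomial_fn r i)) = \<phi> (act ?M g v)" ..
    qed
    finally show ?thesis .
  qed
  moreover have "\<exists>B. finite B \<and> vecs ?M = fs.span B"
    using nabla_eq_span by blast
  moreover have "act ?M (mat 1) v = v" "act ?M (g ** h) v = act ?M g (act ?M h v)" for g h v
    by (simp_all add: act_nabla matrix_mul_assoc)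
  moreover have "act ?M g ` vecs ?M \<subseteq> vecs ?M" if "g \<in> SL2" for g
    using act_nabla_closed that by blast
  ultimately show ?thesis
    unfolding rational_module_def
    using vector_space_fscal nabla_subspace act_nabla_linear by (simp only: scal_nabla) blast
qed

section \<open>The tensor product of two induced modules\<close>

definition basis_tensor :: "nat \<Rightarrow> nat \<Rightarrow> nat \<Rightarrow> nat \<Rightarrow> 'k::field tfun" where
  "basis_tensor r s a b = pure_tensor (nabla r) (nabla s) (monomial_fn r a) (monomial_fn s b)"

definition coord_form :: "nat \<Rightarrow> nat \<Rightarrow> nat \<Rightarrow> nat \<Rightarrow> 'k::field gfun \<Rightarrow> 'k gfun \<Rightarrow> 'k" where
  "coord_form r s a b = (\<lambda>f h. coord r a f * coord s b h)"

abbreviation nabla_tensor :: "nat \<Rightarrow> nat \<Rightarrow> ('k::field, 'k tfun) gmodule" where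
  "nabla_tensor r s \<equiv> tensor (nabla r) (nabla s)"

lemma scal_tensor [simp]: "scal (tensor M N) = fscal"
  and act_tensor: "act (tensor M N) g t = (\<lambda>b. t (\<lambda>v w. b (act M g v) (act N g w)))"
  and vecs_tensor: "vecs (tensor M N) = fs.span {pure_tensor M N v w | v w. v \<in> vecs M \<and> w \<in> vecs N}"
  by (simp_all add: tensor_def)

lemma tensor_subspace: "fs.subspace (vecs (tensor M N))"
  unfolding vecs_tensor by (rule fs.subspace_span)

lemma act_tensor_linear: "linear_within V fscal fscal (act (tensor M N) g)"
  by (auto simp: linear_within_def act_tensor fun_eq_iff)

lemma rational_act_closed:
  assumes "rational_module M" "g \<in> SL2" "v \<in> vecs M"
  shows "act M g v \<in> vecs M"
  using assms unfolding rational_module_def by blast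

lemma act_tensor_closed:
  assumes M: "rational_module M" and N: "rational_module N" and g: "g \<in> SL2" and t: "t \<in> vecs (tensor M N)"
  shows "act (tensor M N) g t \<in> vecs (tensor M N)"
proof -
  let ?S = "{pure_tensor M N v w | v w. v \<in> vecs M \<and> w \<in> vecs N}"
  have "t \<in> fs.span ?S" using t by (simp add: vecs_tensor)
  then show ?thesis
  proof (induction rule: fs.span_induct_alt)
    case base
    have "act (tensor M N) g 0 = 0" by (simp add: act_tensor zero_fun_def)
    then show ?case using fs.subspace_0[OF tensor_subspace] by metis
  next
    case (step c x y)
    then obtain v w where x: "x = pure_tensor M N v w" "v \<in> vecs M" "w \<in> vecs N" by blast
    have "act M g v \<in> vecs M" "act N g w \<in> vecs N"
      using rational_act_closed[OF M g] rational_act_closed[OF N g] x by auto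
    then have "act (tensor M N) g x \<in> vecs (tensor M N)"
      unfolding x(1) act_tensor_pure_tensor[OF M N g] vecs_tensor by (intro fs.span_base) blast
    then have "fscal c (act (tensor M N) g x) + act (tensor M N) g y \<in> vecs (tensor M N)"
      using fs.subspace_add[OF tensor_subspace fs.subspace_scale[OF tensor_subspace] step.IH] by blast
    moreover have "act (tensor M N) g (fscal c x + y) = fscal c (act (tensor M N) g x) + act (tensor M N) g y"
      by (simp add: act_tensor fun_eq_iff)
    ultimately show ?case by (rule ssubst[rotated])
  qed
qed

lemma pure_tensor_sum:
  fixes f :: "'i \<Rightarrow> 'v::ab_group_add" and h :: "'j \<Rightarrow> 'w::ab_group_add"
    and M :: "('k::field, 'v) gmodule" and N :: "('k, 'w) gmodule"
  assumes M: "module (scal M)" "module.subspace (scal M) (vecs M)"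
    and N: "module (scal N)" "module.subspace (scal N) (vecs N)"
    and I: "finite I" "\<And>i. i \<in> I \<Longrightarrow> f i \<in> vecs M"
    and J: "finite J" "\<And>j. j \<in> J \<Longrightarrow> h j \<in> vecs N"
  shows "pure_tensor M N (\<Sum>i\<in>I. scal M (c i) (f i)) (\<Sum>j\<in>J. scal N (d j) (h j))
    = (\<Sum>i\<in>I. \<Sum>j\<in>J. fscal (c i * d j) (pure_tensor M N (f i) (h j)))"
proof
  fix b
  let ?f = "\<Sum>i\<in>I. scal M (c i) (f i)" and ?h = "\<Sum>j\<in>J. scal N (d j) (h j)"
  show "pure_tensor M N ?f ?h b = (\<Sum>i\<in>I. \<Sum>j\<in>J. fscal (c i * d j) (pure_tensor M N (f i) (h j))) b"
  proof (cases "bilinear_form M N b")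
    case False
    then show ?thesis by (simp add: pure_tensor_def sum_fun_apply)
  next
    case True
    have h: "?h \<in> vecs N"
      using J by (intro module.subspace_sum[OF N] module.subspace_scale[OF N])
    have "b ?f ?h = (\<Sum>i\<in>I. c i * b (f i) ?h)"
      using True h I linear_within_sum[OF M(1) module_mult M(2), of "\<lambda>v. b v ?h" I f c]
      by (simp add: bilinear_form_def)
    also have "\<dots> = (\<Sum>i\<in>I. c i * (\<Sum>j\<in>J. d j * b (f i) (h j)))"
    proof (intro sum.cong refl arg_cong2[of _ _ _ _ "(*)"])
      fix i assume "i \<in> I"
      then show "b (f i) ?h = (\<Sum>j\<in>J. d j * b (f i) (h j))"
        using True I J linear_within_sum[OF N(1) module_mult N(2), of "b (f i)" J h d]
        by (simp add: bilinear_form_def)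
    qed
    finally show ?thesis using True
      by (simp add: pure_tensor_def sum_fun_apply sum_distrib_left mult.assoc)
  qed
qed

lemma bilinear_coord_form: "bilinear_form (nabla r) (nabla s) (coord_form r s a b)"
  by (simp add: bilinear_form_def linear_within_def coord_form_def coord_add coord_fscal algebra_simps)

lemma pure_tensor_coord_form: "pure_tensor (nabla r) (nabla s) f h (coord_form r s a b) = coord r a f * coord s b h"
  by (simp add: pure_tensor_def bilinear_coord_form) (simp add: coord_form_def)

lemma basis_tensor_coord_form:
  assumes "i \<le> r" "j \<le> s"
  shows "basis_tensor r s i j (coord_form r s a b :: 'k::alg_closed_field gfun \<Rightarrow> _) = (if i = a \<and> j = b then 1 else 0)"
  using assms by (simp add: basis_tensor_def pure_tensor_coord_form coord_monomial)

lemma pure_tensor_nabla_sum: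
  fixes c d :: "nat \<Rightarrow> 'k::alg_closed_field"
  shows "pure_tensor (nabla r) (nabla s) (\<Sum>i\<le>r. fscal (c i) (monomial_fn r i)) (\<Sum>j\<le>s. fscal (d j) (monomial_fn s j))
    = (\<Sum>i\<le>r. \<Sum>j\<le>s. fscal (c i * d j) (basis_tensor r s i j))"
  using pure_tensor_sum[where M = "nabla r :: ('k, _) gmodule" and N = "nabla s :: ('k, _) gmodule"
      and I = "{..r}" and J = "{..s}" and f = "monomial_fn r" and h = "monomial_fn s" and c = c and d = d]
  by (simp add: module_fscal nabla_subspace monomial_fn_nabla basis_tensor_def)

lemma basis_tensor_mem: "a \<le> r \<Longrightarrow> b \<le> s \<Longrightarrow> basis_tensor r s a b \<in> vecs (nabla_tensor r s)"
  unfolding vecs_tensor basis_tensor_def by (rule fs.span_base) (auto intro: monomial_fn_nabla)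

text \<open>
  The evaluations at the bilinear forms \<open>coord_form r s a b\<close> are the coordinates with respect to the
  basis \<open>basis_tensor r s a b\<close>.
\<close>

lemma nabla_tensor_expansion:
  fixes t :: "'k::alg_closed_field tfun"
  assumes "t \<in> vecs (nabla_tensor r s)"
  shows "t = (\<Sum>a\<le>r. \<Sum>b\<le>s. fscal (t (coord_form r s a b)) (basis_tensor r s a b))"
proof -
  define L :: "'k tfun \<Rightarrow> 'k tfun"
    where "L = (\<lambda>t. \<Sum>a\<le>r. \<Sum>b\<le>s. fscal (t (coord_form r s a b)) (basis_tensor r s a b))"
  have add: "L (x + y) = L x + L y" for x y
    by (simp add: L_def fun_eq_iff sum_fun_apply distrib_right sum.distrib)
  have scale: "L (fscal c x) = fscal c (L x)" for c x
    by (simp add: L_def fun_eq_iff sum_fun_apply sum_distrib_left mult.assoc)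
  have "t \<in> fs.span {pure_tensor (nabla r) (nabla s) v w | v w. v \<in> vecs (nabla r) \<and> w \<in> vecs (nabla s)}"
    using assms by (simp add: vecs_tensor)
  then have "t = L t"
  proof (rule fs.span_induct[where P = "\<lambda>t. t = L t"])
    show "fs.subspace {t. t = L t}"
    proof (rule fs.subspaceI)
      show "0 \<in> {t. t = L t}" using scale[of 0 0] by simp
    next
      fix x y assume "x \<in> {t. t = L t}" "y \<in> {t. t = L t}"
      then show "x + y \<in> {t. t = L t}" unfolding mem_Collect_eq add by (rule arg_cong2)
    next
      fix c x assume "x \<in> {t. t = L t}"
      then show "fscal c x \<in> {t. t = L t}" unfolding mem_Collect_eq scale by (rule arg_cong)
    qed
  next
    fix x :: "'k tfun"
    assume "x \<in> {pure_tensor (nabla r) (nabla s) v w | v w. v \<in> vecs (nabla r) \<and> w \<in> vecs (nabla s)}"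
    then obtain v w where vw: "v \<in> vecs (nabla r)" "w \<in> vecs (nabla s)"
      and x: "x = pure_tensor (nabla r) (nabla s) v w" by blast
    have "x = pure_tensor (nabla r) (nabla s) (\<Sum>i\<le>r. fscal (coord r i v) (monomial_fn r i)) (\<Sum>j\<le>s. fscal (coord s j w) (monomial_fn s j))"
      unfolding x using nabla_expansion[OF vw(1)] nabla_expansion[OF vw(2)] by (rule arg_cong2)
    also have "\<dots> = L x"
      unfolding pure_tensor_nabla_sum L_def x pure_tensor_coord_form ..
    finally show "x = L x" .
  qed
  then show ?thesis by (simp add: L_def)
qed

lemma nabla_tensor_linear_value:
  fixes \<xi> :: "'k::alg_closed_field tfun \<Rightarrow> 'k"
  assumes \<xi>: "linear_within (vecs (nabla_tensor r s)) fscal (*) \<xi>"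
  shows "\<xi> (\<Sum>a\<le>r. \<Sum>b\<le>s. fscal (m a b) (basis_tensor r s a b)) = (\<Sum>a\<le>r. \<Sum>b\<le>s. m a b * \<xi> (basis_tensor r s a b))"
proof -
  have "\<xi> (\<Sum>ab\<in>{..r} \<times> {..s}. fscal (m (fst ab) (snd ab)) (basis_tensor r s (fst ab) (snd ab)))
      = (\<Sum>ab\<in>{..r} \<times> {..s}. m (fst ab) (snd ab) * \<xi> (basis_tensor r s (fst ab) (snd ab)))"
    by (rule linear_within_sum[OF module_fscal module_mult tensor_subspace \<xi>]) (auto intro: basis_tensor_mem)
  then show ?thesis by (simp add: sum.cartesian_product case_prod_beta)
qed

lemma nabla_tensor_linear_expansion:
  fixes \<xi> :: "'k::alg_closed_field tfun \<Rightarrow> 'k"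
  assumes \<xi>: "linear_within (vecs (nabla_tensor r s)) fscal (*) \<xi>" and t: "t \<in> vecs (nabla_tensor r s)"
  shows "\<xi> t = (\<Sum>a\<le>r. \<Sum>b\<le>s. t (coord_form r s a b) * \<xi> (basis_tensor r s a b))"
  using nabla_tensor_linear_value[OF \<xi>, of "\<lambda>a b. t (coord_form r s a b)"]
  unfolding nabla_tensor_expansion[OF t, symmetric] .

lemma nabla_tensor_finite_span:
  "vecs (nabla_tensor r s :: ('k::alg_closed_field, _) gmodule) = fs.span ((\<lambda>(a, b). basis_tensor r s a b) ` ({..r} \<times> {..s}))"
proof
  show "fs.span ((\<lambda>(a, b). basis_tensor r s a b) ` ({..r} \<times> {..s})) \<subseteq> vecs (nabla_tensor r s :: ('k, _) gmodule)"
    by (rule fs.span_minimal) (auto intro: basis_tensor_mem tensor_subspace)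
  show "vecs (nabla_tensor r s :: ('k, _) gmodule) \<subseteq> fs.span ((\<lambda>(a, b). basis_tensor r s a b) ` ({..r} \<times> {..s}))"
  proof
    fix t assume t: "t \<in> vecs (nabla_tensor r s :: ('k, _) gmodule)"
    have "(\<Sum>a\<le>r. \<Sum>b\<le>s. fscal (t (coord_form r s a b)) (basis_tensor r s a b))
       \<in> fs.span ((\<lambda>(a, b). basis_tensor r s a b) ` ({..r} \<times> {..s}))"
      by (rule fs.span_sum, rule fs.span_sum, rule fs.span_scale, rule fs.span_base) auto
    then show "t \<in> fs.span ((\<lambda>(a, b). basis_tensor r s a b) ` ({..r} \<times> {..s}))"
      by (simp only: nabla_tensor_expansion[OF t, symmetric])
  qed
qed

lemma act_nabla_tensor_mult: "act (nabla_tensor r s) (g ** h) t = act (nabla_tensor r s) g (act (nabla_tensor r s) h t)"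
  and act_nabla_tensor_one: "act (nabla_tensor r s) (mat 1) t = t"
  by (simp_all add: act_tensor act_nabla matrix_mul_assoc)

lemma rational_nabla_tensor: "rational_module (nabla_tensor r s :: ('k::alg_closed_field, _) gmodule)"
proof -
  let ?X = "nabla_tensor r s :: ('k, _) gmodule"
  have reg: "on_SL2 (\<lambda>g. act ?X g t (coord_form r s a b)) \<in> regular_functions" if t: "t \<in> vecs ?X" for t a b
  proof -
    have "t \<in> fs.span {pure_tensor (nabla r) (nabla s) v w | v w. v \<in> vecs (nabla r) \<and> w \<in> vecs (nabla s)}"
      using t by (simp add: vecs_tensor)
    then show ?thesis
    proof (induction rule: fs.span_induct_alt)
      case base
      then show ?case by (simp add: act_tensor regular_functions.const)
    next
      case (step c x y)
      then obtain v w where vw: "v \<in> vecs (nabla r)" "w \<in> vecs (nabla s)"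
        and x: "x = pure_tensor (nabla r) (nabla s) v w" by blast
      have "on_SL2 (\<lambda>g. coord r a (act (nabla r) g v) * coord s b (act (nabla s) g w)) \<in> regular_functions"
        by (intro regular_mult act_nabla_coeff_regular vw)
      also have "on_SL2 (\<lambda>g. coord r a (act (nabla r) g v) * coord s b (act (nabla s) g w))
          = on_SL2 (\<lambda>g. act ?X g x (coord_form r s a b))"
        by (rule regular_on_SL2_cong)
          (simp only: x act_tensor_pure_tensor[OF rational_nabla rational_nabla] pure_tensor_coord_form)
      finally have "on_SL2 (\<lambda>g. c * act ?X g x (coord_form r s a b) + act ?X g y (coord_form r s a b)) \<in> regular_functions"
        by (intro regular_add regular_mult regular_functions.const step.IH)
      then show ?case by (simp add: act_tensor)
    qed
  qed
  have "on_SL2 (\<lambda>g. \<phi> (act ?X g t)) \<in> regular_functions"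
    if \<phi>: "linear_within (vecs ?X) (scal ?X) (*) \<phi>" and t: "t \<in> vecs ?X" for \<phi> t
  proof -
    have "on_SL2 (\<lambda>g. \<Sum>a\<le>r. \<Sum>b\<le>s. act ?X g t (coord_form r s a b) * \<phi> (basis_tensor r s a b)) \<in> regular_functions"
      by (intro regular_sum regular_mult regular_functions.const reg t)
    also have "on_SL2 (\<lambda>g. \<Sum>a\<le>r. \<Sum>b\<le>s. act ?X g t (coord_form r s a b) * \<phi> (basis_tensor r s a b)) = on_SL2 (\<lambda>g. \<phi> (act ?X g t))"
    proof (rule regular_on_SL2_cong)
      fix g :: "'k ^ 2 ^ 2" assume "g \<in> SL2"
      then have "act ?X g t \<in> vecs ?X" using act_tensor_closed[OF rational_nabla rational_nabla] t by blast
      from nabla_tensor_linear_expansion[OF _ this] \<phi>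
      show "(\<Sum>a\<le>r. \<Sum>b\<le>s. act ?X g t (coord_form r s a b) * \<phi> (basis_tensor r s a b)) = \<phi> (act ?X g t)" by simp
    qed
    finally show ?thesis .
  qed
  moreover have "\<exists>B. finite B \<and> vecs ?X = fs.span B"
    using nabla_tensor_finite_span[of r s, where 'k='k] by (intro exI[of _ "(\<lambda>(a, b). basis_tensor r s a b) ` ({..r} \<times> {..s})"]) auto
  moreover have "act ?X g ` vecs ?X \<subseteq> vecs ?X" if "g \<in> SL2" for g
    using act_tensor_closed[OF rational_nabla rational_nabla that] by blast
  ultimately show ?thesis
    unfolding rational_module_def scal_tensor
    by (intro conjI ballI allI impI)
      (auto simp only: vector_space_fscal tensor_subspace act_tensor_linear act_nabla_tensor_mult act_nabla_tensor_one)
qed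

section \<open>Unipotent elements, tori and the Weyl element\<close>

text \<open>
  For \<open>g\<close> in the Borel subgroup; the case of a lower unipotent matrix is translation of the variable.
\<close>

lemma act_monomial_lower:
  fixes g :: "'k::field ^ 2 ^ 2"
  assumes g: "g \<in> SL2" "g $ 1 $ 2 = 0" and a: "a \<le> r"
  shows "act (nabla r) g (monomial_fn r a)
    = (\<Sum>i\<le>r. fscal (of_nat (a choose i) * (g $ 1 $ 1 ^ i * g $ 2 $ 1 ^ (a - i) * g $ 2 $ 2 ^ (r - a))) (monomial_fn r i))"
proof
  fix x :: "'k ^ 2 ^ 2"
  show "act (nabla r) g (monomial_fn r a) x
    = (\<Sum>i\<le>r. fscal (of_nat (a choose i) * (g $ 1 $ 1 ^ i * g $ 2 $ 1 ^ (a - i) * g $ 2 $ 2 ^ (r - a))) (monomial_fn r i)) x"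
  proof (cases "x \<in> SL2")
    case False
    then show ?thesis using SL2_mult_iff[OF g(1)] by (simp add: act_nabla monomial_fn_def on_SL2_def sum_fun_apply)
  next
    case True
    let ?u = "x $ 1 $ 1" and ?v = "x $ 1 $ 2"
    have "act (nabla r) g (monomial_fn r a) x = (?u * g $ 1 $ 1 + ?v * g $ 2 $ 1) ^ a * (?v * g $ 2 $ 2) ^ (r - a)"
      using True g by (simp add: act_nabla monomial_fn_def on_SL2_def matrix_mult_entry)
    also have "\<dots> = (\<Sum>i\<le>a. of_nat (a choose i) * (?u * g $ 1 $ 1) ^ i * (?v * g $ 2 $ 1) ^ (a - i) * (?v * g $ 2 $ 2) ^ (r - a))"
      by (simp add: binomial_ring sum_distrib_right)
    also have "\<dots> = (\<Sum>i\<le>r. of_nat (a choose i) * (g $ 1 $ 1 ^ i * g $ 2 $ 1 ^ (a - i) * g $ 2 $ 2 ^ (r - a)) * (?u ^ i * ?v ^ (r - i)))"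
    proof (rule sum.mono_neutral_cong_left)
      show "\<forall>i\<in>{..r} - {..a}. of_nat (a choose i) * (g $ 1 $ 1 ^ i * g $ 2 $ 1 ^ (a - i) * g $ 2 $ 2 ^ (r - a)) * (?u ^ i * ?v ^ (r - i)) = 0"
        by (auto simp: binomial_eq_0)
      fix i assume "i \<in> {..a}"
      then have "?v ^ (r - i) = ?v ^ (a - i) * ?v ^ (r - a)" using a by (simp flip: power_add)
      then show "of_nat (a choose i) * (?u * g $ 1 $ 1) ^ i * (?v * g $ 2 $ 1) ^ (a - i) * (?v * g $ 2 $ 2) ^ (r - a)
        = of_nat (a choose i) * (g $ 1 $ 1 ^ i * g $ 2 $ 1 ^ (a - i) * g $ 2 $ 2 ^ (r - a)) * (?u ^ i * ?v ^ (r - i))"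
        by (simp add: power_mult_distrib mult_ac)
    qed (use a in auto)
    finally show ?thesis using True by (simp add: sum_fun_apply monomial_fn_def on_SL2_def)
  qed
qed

lemma act_monomial_upper:
  fixes g :: "'k::field ^ 2 ^ 2"
  assumes g: "g \<in> SL2" "g $ 1 $ 1 = 1" "g $ 2 $ 1 = 0" "g $ 2 $ 2 = 1" and a: "a \<le> r"
  shows "act (nabla r) g (monomial_fn r a)
    = (\<Sum>i\<le>r. fscal (if a \<le> i then of_nat ((r - a) choose (i - a)) * g $ 1 $ 2 ^ (i - a) else 0) (monomial_fn r i))"
proof
  fix x :: "'k ^ 2 ^ 2"
  show "act (nabla r) g (monomial_fn r a) x
    = (\<Sum>i\<le>r. fscal (if a \<le> i then of_nat ((r - a) choose (i - a)) * g $ 1 $ 2 ^ (i - a) else 0) (monomial_fn r i)) x"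
  proof (cases "x \<in> SL2")
    case False
    then show ?thesis using SL2_mult_iff[OF g(1)] by (simp add: act_nabla monomial_fn_def on_SL2_def sum_fun_apply)
  next
    case True
    let ?u = "x $ 1 $ 1" and ?v = "x $ 1 $ 2" and ?h = "g $ 1 $ 2"
    have "act (nabla r) g (monomial_fn r a) x = ?u ^ a * (?u * ?h + ?v) ^ (r - a)"
      using True g by (simp add: act_nabla monomial_fn_def on_SL2_def matrix_mult_entry)
    also have "\<dots> = (\<Sum>k\<le>r - a. ?u ^ a * (of_nat ((r - a) choose k) * (?u * ?h) ^ k * ?v ^ (r - a - k)))"
      by (simp add: binomial_ring sum_distrib_left)
    also have "\<dots> = (\<Sum>i\<in>{a..r}. of_nat ((r - a) choose (i - a)) * ?h ^ (i - a) * (?u ^ i * ?v ^ (r - i)))"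
      by (rule sum.reindex_bij_witness[of _ "\<lambda>i. i - a" "\<lambda>k. k + a"])
        (use a in \<open>auto simp: power_mult_distrib power_add mult_ac add_ac\<close>)
    also have "\<dots> = (\<Sum>i\<le>r. (if a \<le> i then of_nat ((r - a) choose (i - a)) * ?h ^ (i - a) else 0) * (?u ^ i * ?v ^ (r - i)))"
      by (rule sum.mono_neutral_cong_left) auto
    finally show ?thesis using True by (simp add: sum_fun_apply monomial_fn_def on_SL2_def)
  qed
qed

lemma act_monomial_weyl_element:
  assumes a: "a \<le> r"
  shows "act (nabla r) (row_point 0) (monomial_fn r a) = fscal ((- 1) ^ a) (monomial_fn r (r - a) :: 'k::field gfun)"
proof
  fix x :: "'k ^ 2 ^ 2"
  have "x ** row_point 0 \<in> SL2 \<longleftrightarrow> x \<in> SL2" by (rule SL2_mult_iff) simp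
  then show "act (nabla r) (row_point 0) (monomial_fn r a) x = fscal ((- 1) ^ a) (monomial_fn r (r - a)) x"
    using a by (simp add: act_nabla monomial_fn_def on_SL2_def matrix_mult_entry power_minus[of "x $ 1 $ 2"])
qed

lemma act_basis_tensor:
  assumes g: "g \<in> SL2"
    and A: "act (nabla r) g (monomial_fn r a) = (\<Sum>i\<le>r. fscal (A i) (monomial_fn r i))"
    and B: "act (nabla s) g (monomial_fn s b) = (\<Sum>j\<le>s. fscal (B j) (monomial_fn s j))"
  shows "act (nabla_tensor r s) g (basis_tensor r s a b)
     = (\<Sum>i\<le>r. \<Sum>j\<le>s. fscal (A i * B j) (basis_tensor r s i j :: 'k::alg_closed_field tfun))"
proof -
  have "act (nabla_tensor r s) g (basis_tensor r s a b)
      = pure_tensor (nabla r) (nabla s) (act (nabla r) g (monomial_fn r a)) (act (nabla s) g (monomial_fn s b))"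
    unfolding basis_tensor_def by (rule act_tensor_pure_tensor[OF rational_nabla rational_nabla g])
  then show ?thesis unfolding A B pure_tensor_nabla_sum .
qed

lemma act_basis_tensor_monomial:
  assumes g: "g \<in> SL2" and A: "act (nabla r) g (monomial_fn r a) = fscal x (monomial_fn r a')"
    and B: "act (nabla s) g (monomial_fn s b) = fscal y (monomial_fn s b')" and ab: "a' \<le> r" "b' \<le> s"
  shows "act (nabla_tensor r s) g (basis_tensor r s a b)
     = fscal (x * y) (basis_tensor r s a' b' :: 'k::alg_closed_field tfun)"
proof -
  have "act (nabla_tensor r s) g (basis_tensor r s a b)
      = pure_tensor (nabla r) (nabla s) (act (nabla r) g (monomial_fn r a)) (act (nabla s) g (monomial_fn s b))"
    unfolding basis_tensor_def by (rule act_tensor_pure_tensor[OF rational_nabla rational_nabla g])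
  also have "\<dots> = pure_tensor (nabla r) (nabla s) (\<Sum>i\<in>{a'}. fscal x (monomial_fn r i)) (\<Sum>j\<in>{b'}. fscal y (monomial_fn s j))"
    unfolding A B by simp
  also have "\<dots> = (\<Sum>i\<in>{a'}. \<Sum>j\<in>{b'}. fscal (x * y) (basis_tensor r s i j))"
    using pure_tensor_sum[where M = "nabla r :: ('k, _) gmodule" and N = "nabla s :: ('k, _) gmodule"
      and I = "{a'}" and J = "{b'}" and f = "monomial_fn r" and h = "monomial_fn s" and c = "\<lambda>_. x" and d = "\<lambda>_. y"] ab
    by (simp add: module_fscal nabla_subspace monomial_fn_nabla basis_tensor_def)
  finally show ?thesis by simp
qed

lemma act_basis_tensor_weyl_element:
  assumes "a \<le> r" "b \<le> s"
  shows "act (nabla_tensor r s) (row_point 0) (basis_tensor r s a b)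
     = fscal ((- 1) ^ (a + b)) (basis_tensor r s (r - a) (s - b) :: 'k::alg_closed_field tfun)"
  unfolding power_add
  by (rule act_basis_tensor_monomial[OF _ act_monomial_weyl_element act_monomial_weyl_element]) (use assms in auto)

abbreviation torus_elt :: "'k \<Rightarrow> 'k::field ^ 2 ^ 2" where
  "torus_elt z \<equiv> mat2 z 0 0 (1 / z)"

lemma act_monomial_torus:
  assumes z: "z \<noteq> 0" and a: "a \<le> r"
  shows "act (nabla r) (torus_elt z) (monomial_fn r a) = fscal (z ^ a * (1 / z) ^ (r - a)) (monomial_fn r a :: 'k::field gfun)"
proof
  fix x :: "'k ^ 2 ^ 2"
  have "x ** torus_elt z \<in> SL2 \<longleftrightarrow> x \<in> SL2" by (rule SL2_mult_iff) (use z in simp)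
  then show "act (nabla r) (torus_elt z) (monomial_fn r a) x = fscal (z ^ a * (1 / z) ^ (r - a)) (monomial_fn r a) x"
    using a by (simp add: act_nabla monomial_fn_def on_SL2_def matrix_mult_entry power_mult_distrib power_divide)
qed

lemma nabla_tensor_eqI:
  fixes t t' :: "'k::alg_closed_field tfun"
  assumes t: "t \<in> vecs (nabla_tensor r s)" "t' \<in> vecs (nabla_tensor r s)"
    and eq: "\<And>a b. a \<le> r \<Longrightarrow> b \<le> s \<Longrightarrow> t (coord_form r s a b) = t' (coord_form r s a b)"
  shows "t = t'"
  using nabla_tensor_expansion[OF t(1)] nabla_tensor_expansion[OF t(2)] eq by simp

lemma act_torus_coord:
  fixes t :: "'k::alg_closed_field tfun"
  assumes t: "t \<in> vecs (nabla_tensor r s)" and z: "z \<noteq> 0" and ab: "a \<le> r" "b \<le> s"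
  shows "z ^ (r + s) * act (nabla_tensor r s) (torus_elt z) t (coord_form r s a b) = z ^ (2 * (a + b)) * t (coord_form r s a b)"
proof -
  let ?X = "nabla_tensor r s :: ('k, _) gmodule"
  let ?cf = "coord_form r s a b :: 'k gfun \<Rightarrow> _"
  let ?y = "\<lambda>i j. z ^ i * (1 / z) ^ (r - i) * (z ^ j * (1 / z) ^ (s - j))"
  have g: "torus_elt z \<in> SL2" using z by simp
  have lin: "linear_within (vecs ?X) fscal (*) (\<lambda>t. act ?X (torus_elt z) t ?cf)"
    by (simp add: linear_within_def act_tensor)
  have ba: "act ?X (torus_elt z) (basis_tensor r s i j) ?cf = (if i = a \<and> j = b then ?y i j else 0)" if "i \<le> r" "j \<le> s" for i j
    by (subst act_basis_tensor_monomial[OF g act_monomial_torus[OF z] act_monomial_torus[OF z]])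
      (use that in \<open>auto simp: basis_tensor_coord_form\<close>)
  have "act ?X (torus_elt z) t ?cf = (\<Sum>i\<le>r. \<Sum>j\<le>s. t (coord_form r s i j) * act ?X (torus_elt z) (basis_tensor r s i j) ?cf)"
    by (rule nabla_tensor_linear_expansion[OF lin t])
  also have "\<dots> = (\<Sum>i\<le>r. \<Sum>j\<le>s. if j = b then (if i = a then ?y a b * t ?cf else 0) else 0)"
    by (intro sum.cong refl) (simp add: ba)
  also have "\<dots> = ?y a b * t ?cf" using ab by simp
  finally have 1: "act ?X (torus_elt z) t ?cf = ?y a b * t ?cf" .
  have "z ^ (r + s) = z ^ a * z ^ (r - a) * (z ^ b * z ^ (s - b))" using ab by (simp flip: power_add)
  then have "z ^ (r + s) * ?y a b = z ^ (2 * (a + b))"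
    using z by (simp add: power_divide) (simp add: power_add power_mult power2_eq_square mult_ac)
  then show ?thesis unfolding 1 by (simp add: mult.assoc)
qed

section \<open>Quotients by submodules\<close>

text \<open>
  The data of an isomorphism from \<open>V / U\<close> to \<open>N\<close>, given on representatives instead of cosets.
\<close>

definition quotient_map ::
  "('k::field, 'v::ab_group_add) gmodule \<Rightarrow> 'v set \<Rightarrow> 'v set \<Rightarrow> ('k, 'w::ab_group_add) gmodule \<Rightarrow> ('v \<Rightarrow> 'w) \<Rightarrow> bool" where
  "quotient_map M V U N \<Theta> \<longleftrightarrow> (\<forall>v\<in>V. \<Theta> v \<in> vecs N) \<and> (\<forall>n\<in>vecs N. \<exists>v\<in>V. \<Theta> v = n) \<and>
     (\<forall>v\<in>V. \<forall>w\<in>V. \<Theta> (v + w) = \<Theta> v + \<Theta> w) \<and> (\<forall>c. \<forall>v\<in>V. \<Theta> (scal M c v) = scal N c (\<Theta> v)) \<and>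
     (\<forall>g\<in>SL2. \<forall>v\<in>V. \<Theta> (act M g v) = act N g (\<Theta> v)) \<and> (\<forall>v\<in>V. \<Theta> v = 0 \<longleftrightarrow> v \<in> U)"

lemma coset_eq_iff:
  assumes m: "module s" and U: "module.subspace s U"
  shows "coset U v = coset U w \<longleftrightarrow> v - w \<in> U"
proof
  assume "coset U v = coset U w"
  moreover have "v \<in> coset U v" using module.subspace_0[OF m U] by (force simp: coset_def)
  ultimately show "v - w \<in> U" by (auto simp: coset_def)
next
  have sub: "coset U v \<subseteq> coset U w" if d: "v - w \<in> U" for v w
  proof
    fix x assume "x \<in> coset U v"
    then obtain u where u: "u \<in> U" "x = v + u" by (auto simp: coset_def)
    then have "x = w + ((v - w) + u)" "(v - w) + u \<in> U" using module.subspace_add[OF m U d] by auto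
    then show "x \<in> coset U w" unfolding coset_def by blast
  qed
  assume d: "v - w \<in> U"
  then have "w - v \<in> U" using module.subspace_neg[OF m U d] by simp
  with d sub show "coset U v = coset U w" by blast
qed

lemma quotient_iso_imp_map:
  assumes q: "quotient_iso M V U N" and U: "module.subspace (scal M) U" and UV: "U \<subseteq> V" and m: "module (scal M)"
  shows "\<exists>\<Theta>. quotient_map M V U N \<Theta>"
proof -
  obtain F where bij: "bij_betw F (coset U ` V) (vecs N)"
    and add: "\<And>v w. v \<in> V \<Longrightarrow> w \<in> V \<Longrightarrow> F (coset U (v + w)) = F (coset U v) + F (coset U w)"
    and sc: "\<And>c v. v \<in> V \<Longrightarrow> F (coset U (scal M c v)) = scal N c (F (coset U v))"
    and ac: "\<And>g v. g \<in> SL2 \<Longrightarrow> v \<in> V \<Longrightarrow> F (coset U (act M g v)) = act N g (F (coset U v))"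
    using q unfolding quotient_iso_def by auto
  have zU: "0 \<in> U" using module.subspace_0[OF m U] .
  from zU have zV: "0 \<in> V" using UV by blast
  have F0: "F (coset U 0) = 0" using add[OF zV zV] by simp
  have "F (coset U v) = 0 \<longleftrightarrow> v \<in> U" if v: "v \<in> V" for v
  proof -
    have "F (coset U v) = 0 \<longleftrightarrow> coset U v = coset U 0"
      unfolding F0[symmetric] using bij v zV by (intro inj_on_eq_iff[of F "coset U ` V"]) (auto simp: bij_betw_def)
    then show ?thesis by (simp add: coset_eq_iff[OF m U])
  qed
  moreover have img: "F ` coset U ` V = vecs N" using bij by (simp add: bij_betw_def)
  moreover have "\<exists>v\<in>V. F (coset U v) = n" if "n \<in> vecs N" for n
    using that unfolding img[symmetric] by blast
  ultimately have "quotient_map M V U N (\<lambda>v. F (coset U v))"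
    unfolding quotient_map_def using add sc ac by (auto simp: image_iff)
  then show ?thesis by blast
qed

lemma quotient_map_imp_iso:
  assumes q: "quotient_map M V U N \<Theta>" and m: "module (scal M)"
    and U: "module.subspace (scal M) U" and V: "module.subspace (scal M) V" and UV: "U \<subseteq> V"
    and act: "\<And>g v. g \<in> SL2 \<Longrightarrow> v \<in> V \<Longrightarrow> act M g v \<in> V"
  shows "quotient_iso M V U N"
proof -
  have q: "\<And>v. v \<in> V \<Longrightarrow> \<Theta> v \<in> vecs N" "\<And>n. n \<in> vecs N \<Longrightarrow> \<exists>v\<in>V. \<Theta> v = n"
    "\<And>v w. v \<in> V \<Longrightarrow> w \<in> V \<Longrightarrow> \<Theta> (v + w) = \<Theta> v + \<Theta> w" "\<And>c v. v \<in> V \<Longrightarrow> \<Theta> (scal M c v) = scal N c (\<Theta> v)"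
    "\<And>g v. g \<in> SL2 \<Longrightarrow> v \<in> V \<Longrightarrow> \<Theta> (act M g v) = act N g (\<Theta> v)" "\<And>v. v \<in> V \<Longrightarrow> \<Theta> v = 0 \<longleftrightarrow> v \<in> U"
    using q unfolding quotient_map_def by blast+
  have eq: "coset U v = coset U w \<longleftrightarrow> \<Theta> v = \<Theta> w" if vw: "v \<in> V" "w \<in> V" for v w
  proof -
    have d: "v - w \<in> V" using module.subspace_diff[OF m V] vw by blast
    have "\<Theta> v = \<Theta> (v - w) + \<Theta> w" using q(3)[OF d vw(2)] by simp
    then show ?thesis using q(6)[OF d] by (auto simp: coset_eq_iff[OF m U])
  qed
  define F where "F C = \<Theta> (SOME v. v \<in> V \<and> coset U v = C)" for C
  have F: "F (coset U v) = \<Theta> v" if v: "v \<in> V" for v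
  proof -
    have "(SOME w. w \<in> V \<and> coset U w = coset U v) \<in> V \<and> coset U (SOME w. w \<in> V \<and> coset U w = coset U v) = coset U v"
      by (rule someI[of _ v]) (use v in simp)
    then show ?thesis unfolding F_def using eq v by blast
  qed
  have "bij_betw F (coset U ` V) (vecs N)"
    unfolding bij_betw_def
  proof
    show "inj_on F (coset U ` V)" using F eq by (auto simp: inj_on_def)
    show "F ` coset U ` V = vecs N"
    proof
      show "F ` coset U ` V \<subseteq> vecs N" using F q(1) by auto
      show "vecs N \<subseteq> F ` coset U ` V"
      proof
        fix n assume "n \<in> vecs N"
        then obtain v where "v \<in> V" "\<Theta> v = n" using q(2) by blast
        then show "n \<in> F ` coset U ` V" using F[of v] by force
      qed
    qed
  qed
  moreover have "v + w \<in> V" "scal M c v \<in> V" if "v \<in> V" "w \<in> V" for v w c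
    using module.subspace_add[OF m V] module.subspace_scale[OF m V] that by auto
  ultimately show ?thesis
    unfolding quotient_iso_def using F q act by (intro exI[of _ F]) auto
qed

section \<open>Invariant functionals and weights\<close>

text \<open>
  The weight space of \<open>nabla_tensor r s\<close> for the weight \<open>2 D - r - s\<close>.
\<close>

definition degree_space :: "nat \<Rightarrow> nat \<Rightarrow> nat \<Rightarrow> 'k::field tfun set" where
  "degree_space r s D = {t \<in> vecs (nabla_tensor r s). \<forall>a\<le>r. \<forall>b\<le>s. a + b \<noteq> D \<longrightarrow> t (coord_form r s a b) = 0}"

text \<open>
  The linear functional on the tensor product that belongs to the bilinear form described by \<open>c\<close>.
\<close>

definition form_value :: "nat \<Rightarrow> nat \<Rightarrow> nat \<Rightarrow> (nat \<Rightarrow> 'k) \<Rightarrow> 'k::field tfun \<Rightarrow> 'k" where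
  "form_value r s D c t = (\<Sum>i\<in>form_range r s D. c i * t (coord_form r s i (D - i)))"

lemma finite_form_range [simp]: "finite (form_range r s D)"
  by (rule finite_subset[of _ "{..r}"]) (auto simp: form_range_def)

lemma form_value_add: "form_value r s D c (t + t') = form_value r s D c t + form_value r s D c t'"
  by (simp add: form_value_def distrib_left sum.distrib)

lemma form_value_fscal: "form_value r s D c (fscal x t) = x * form_value r s D c t"
  by (simp add: form_value_def sum_distrib_left mult_ac)

lemma form_value_linear: "linear_within V fscal (*) (form_value r s D c)"
  by (simp add: linear_within_def form_value_add form_value_fscal)

lemma form_value_basis:
  assumes "a \<le> r" "b \<le> s"
  shows "form_value r s D c (basis_tensor r s a b :: 'k::alg_closed_field tfun) = (if a + b = D then c a else 0)"
proof -
  have "form_value r s D c (basis_tensor r s a b :: 'k tfun)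
      = (\<Sum>i\<in>form_range r s D. if i = a then (if a + b = D then c a else 0) else 0)"
    unfolding form_value_def
    by (intro sum.cong refl) (use assms in \<open>auto simp: basis_tensor_coord_form form_range_def\<close>)
  also have "\<dots> = (if a + b = D then c a else 0)"
    using assms by (auto simp: form_range_def)
  finally show ?thesis .
qed

abbreviation lower_elt :: "'k \<Rightarrow> 'k::field ^ 2 ^ 2" where
  "lower_elt h \<equiv> mat2 1 0 h 1"

lemma form_value_invariant:
  fixes t :: "'k::alg_closed_field tfun"
  assumes c: "translation_form r s D c" and t: "t \<in> vecs (nabla_tensor r s)"
  shows "form_value r s D c (act (nabla_tensor r s) (lower_elt 1) t) = form_value r s D c t"
proof -
  let ?X = "nabla_tensor r s :: ('k, _) gmodule"
  let ?g = "lower_elt 1 :: 'k ^ 2 ^ 2"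
  let ?B = "\<lambda>a b. basis_tensor r s a b :: 'k tfun"
  have lin: "linear_within (vecs ?X) fscal (*) (\<lambda>t. form_value r s D c (act ?X ?g t))"
  proof -
    have "act ?X ?g (t + t') = act ?X ?g t + act ?X ?g t'" "act ?X ?g (fscal x t) = fscal x (act ?X ?g t)" for x t t'
      by (simp_all add: act_tensor fun_eq_iff)
    then show ?thesis by (simp add: linear_within_def form_value_add form_value_fscal)
  qed
  have basis: "form_value r s D c (act ?X ?g (?B a b)) = form_value r s D c (?B a b)" if ab: "a \<le> r" "b \<le> s" for a b
  proof -
    have low: "act (nabla r) ?g (monomial_fn r a) = (\<Sum>i\<le>r. fscal (of_nat (a choose i)) (monomial_fn r i))" if "a \<le> r" for r a
      using act_monomial_lower[of ?g a r] that by simp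
    have "act ?X ?g (?B a b) = (\<Sum>i\<le>r. \<Sum>j\<le>s. fscal (of_nat (a choose i) * of_nat (b choose j)) (?B i j))"
      by (rule act_basis_tensor[OF _ low[OF ab(1)] low[OF ab(2)]]) simp
    then have "form_value r s D c (act ?X ?g (?B a b))
        = (\<Sum>i\<le>r. \<Sum>j\<le>s. of_nat (a choose i) * of_nat (b choose j) * form_value r s D c (?B i j))"
      using nabla_tensor_linear_value[where m = "\<lambda>i j. of_nat (a choose i) * of_nat (b choose j)" and \<xi> = "form_value r s D c", OF form_value_linear]
      by simp
    also have "\<dots> = (\<Sum>i\<le>r. \<Sum>j\<le>s. if i + j = D then of_nat (a choose i) * of_nat (b choose j) * c i else 0)"
      by (intro sum.cong refl) (simp add: form_value_basis)
    also have "\<dots> = (\<Sum>i\<le>D. of_nat (a choose i) * of_nat (b choose (D - i)) * c i)"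
      by (rule antidiagonal_sum[OF ab])
    also have "\<dots> = form_value r s D c (?B a b)"
    proof -
      consider "D < a + b" | "D = a + b" | "a + b < D" by linarith
      then show ?thesis
      proof cases
        case 1 then show ?thesis using c ab by (auto simp: translation_form_def form_value_basis)
      next
        case 2
        have "(\<Sum>i\<le>D. of_nat (a choose i) * of_nat (b choose (D - i)) * c i) = (\<Sum>i\<le>D. if i = a then c a else 0)"
        proof (intro sum.cong refl)
          fix i assume "i \<in> {..D}"
          show "of_nat (a choose i) * of_nat (b choose (D - i)) * c i = (if i = a then c a else 0)"
            using 2 by (cases "i < a"; cases "i = a") (auto simp: binomial_eq_0)
        qed
        then show ?thesis using 2 ab by (simp add: form_value_basis)
      next
        case 3
        then have "of_nat (a choose i) * of_nat (b choose (D - i)) * c i = 0" for i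
          by (cases "a < i") (auto simp: binomial_eq_0)
        then have "(\<Sum>i\<le>D. of_nat (a choose i) * of_nat (b choose (D - i)) * c i) = 0"
          by (intro sum.neutral) blast
        then show ?thesis using 3 ab by (simp add: form_value_basis)
      qed
    qed
    finally show ?thesis .
  qed
  show ?thesis
    unfolding nabla_tensor_linear_expansion[OF lin t] nabla_tensor_linear_expansion[OF form_value_linear t]
    by (intro sum.cong refl) (simp add: basis)
qed

lemma weyl_simps:
  "scal (weyl u) = fscal"
  "\<theta> \<in> vecs (weyl u) \<longleftrightarrow> linear_within (vecs (nabla u)) fscal (*) \<theta> \<and> (\<forall>f. f \<notin> vecs (nabla u) \<longrightarrow> \<theta> f = 0)"
  "act (weyl u) g \<theta> f = (if f \<in> vecs (nabla u) then \<theta> (act (nabla u) (matrix_inv g) f) else 0)"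
  by (simp_all add: weyl_def dual_def)

text \<open>
  An element of a Weyl module is a linear form on the induced module, so it is determined by its
  values on the basis.
\<close>

lemma weyl_eq_zeroI:
  fixes \<theta> :: "'k::alg_closed_field gfun \<Rightarrow> 'k"
  assumes \<theta>: "\<theta> \<in> vecs (weyl u)" and 0: "\<And>i. i \<le> u \<Longrightarrow> \<theta> (monomial_fn u i) = 0"
  shows "\<theta> = 0"
proof
  fix f show "\<theta> f = 0 f"
  proof (cases "f \<in> vecs (nabla u)")
    case True
    have "\<theta> (\<Sum>i\<le>u. fscal (coord u i f) (monomial_fn u i)) = (\<Sum>i\<le>u. coord u i f * \<theta> (monomial_fn u i))"
      using \<theta> by (intro linear_within_sum[OF module_fscal module_mult nabla_subspace])
        (auto simp: weyl_simps intro: monomial_fn_nabla)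
    then have "\<theta> f = (\<Sum>i\<le>u. coord u i f * \<theta> (monomial_fn u i))"
      by (simp only: nabla_expansion[OF True, symmetric])
    then show ?thesis by (simp add: 0)
  qed (use \<theta> in \<open>simp add: weyl_simps\<close>)
qed

lemma act_weyl_torus:
  assumes \<theta>: "\<theta> \<in> vecs (weyl u :: ('k::alg_closed_field, _) gmodule)" and z: "z \<noteq> 0" and i: "i \<le> u"
  shows "act (weyl u) (torus_elt z) \<theta> (monomial_fn u i) = (1 / z) ^ i * z ^ (u - i) * \<theta> (monomial_fn u i)"
proof -
  have "matrix_inv (torus_elt z) = torus_elt (1 / z)" using z by (subst matrix_inv_SL2_eq) auto
  then have "act (weyl u) (torus_elt z) \<theta> (monomial_fn u i) = \<theta> (act (nabla u) (torus_elt (1 / z)) (monomial_fn u i))"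
    using i by (simp only: weyl_simps monomial_fn_nabla if_True)
  also have "\<dots> = \<theta> (fscal ((1 / z) ^ i * (1 / (1 / z)) ^ (u - i)) (monomial_fn u i))"
    using z i by (subst act_monomial_torus) auto
  also have "\<dots> = (1 / z) ^ i * (1 / (1 / z)) ^ (u - i) * \<theta> (monomial_fn u i)"
    using \<theta> i monomial_fn_nabla unfolding weyl_simps linear_within_def by blast
  finally show ?thesis by simp
qed

text \<open>
  The form \<open>coord u 0\<close> is the highest weight vector of \<open>weyl u\<close>.  Its translate by a lower unipotent
  matrix has a nonzero component in every weight, so the highest weight vector generates.
\<close>

lemma lower_weyl_vector:
  assumes k: "k \<le> u"
  shows "coord u 0 (act (nabla u) (matrix_inv (lower_elt 1)) (monomial_fn u k)) = (- 1 :: 'k::alg_closed_field) ^ k"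
proof -
  have "matrix_inv (lower_elt 1 :: 'k ^ 2 ^ 2) = lower_elt (- 1)" by (subst matrix_inv_SL2_eq) auto
  moreover have "act (nabla u) (lower_elt (- 1)) (monomial_fn u k) = (\<Sum>i\<le>u. fscal (of_nat (k choose i) * (- 1) ^ (k - i)) (monomial_fn u i :: 'k gfun))"
    using act_monomial_lower[of "lower_elt (- 1)" k u] k by simp
  ultimately have "coord u 0 (act (nabla u) (matrix_inv (lower_elt 1 :: 'k ^ 2 ^ 2)) (monomial_fn u k))
      = (\<Sum>i\<le>u. of_nat (k choose i) * (- 1) ^ (k - i) * coord u 0 (monomial_fn u i :: 'k gfun))"
    by (simp add: coord_sum)
  also have "\<dots> = (\<Sum>i\<le>u. if i = 0 then (- 1) ^ k else 0)"
    by (intro sum.cong refl) (auto simp: coord_monomial)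
  finally show ?thesis by simp
qed

section \<open>The obstruction to a Weyl filtration\<close>

definition form_kernel :: "nat \<Rightarrow> nat \<Rightarrow> nat \<Rightarrow> (nat \<Rightarrow> 'k) \<Rightarrow> (nat \<Rightarrow> 'k) \<Rightarrow> 'k::field tfun set" where
  "form_kernel r s D c c' = {t \<in> degree_space r s D. form_value r s D c t = 0 \<and> form_value r s D c' t = 0}"

lemma degree_space_subspace: "fs.subspace (degree_space r s D)"
  using tensor_subspace[of "nabla r" "nabla s"] unfolding degree_space_def fs.subspace_def by auto

lemma form_kernel_subspace: "fs.subspace (form_kernel r s D c c')"
  using degree_space_subspace[of r s D] unfolding form_kernel_def fs.subspace_def
  by (auto simp: form_value_add form_value_fscal) (auto simp: form_value_def)

text \<open>
  One step of a filtration with quotient \<open>weyl u\<close>.  Suppose that the quotient contributes to the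
  weight of degree \<open>D + 1\<close>, which is \<open>t + 2\<close> for \<open>t = 2 D - r - s \<ge> 0\<close>.  It contributes one dimension
  because weight spaces of Weyl modules are lines, and \<open>u > t\<close>.  Lift the highest weight vector to \<open>v\<close>,
  move it by an element \<open>g\<close> of \<open>U\<close> and take the component \<open>y\<close> of \<open>g v - v\<close> of weight \<open>t\<close>.  All invariant
  functionals vanish on \<open>g v - v\<close>, hence those of weight \<open>t\<close> vanish on \<open>y\<close>; but \<open>y\<close> is nonzero in
  the quotient.  So the common kernel grows by at least one dimension, too.
\<close>

lemma weyl_quotient_step:
  fixes Y Y' :: "'k::alg_closed_field tfun set"
  assumes Y: "submodule_of Y (nabla_tensor r s)" and Y': "submodule_of Y' (nabla_tensor r s)" and YY': "Y \<subseteq> Y'"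
    and iso: "quotient_iso (nabla_tensor r s) Y' Y (weyl u)"
    and D: "r + s \<le> 2 * D" "D \<le> r + s"
    and c: "translation_form r s D c" "translation_form r s D c'"
  shows "fs.dim (Y' \<inter> degree_space r s (D + 1)) + fs.dim (Y \<inter> form_kernel r s D c c')
     \<le> fs.dim (Y \<inter> degree_space r s (D + 1)) + fs.dim (Y' \<inter> form_kernel r s D c c')"
proof -
  let ?X = "nabla_tensor r s :: ('k, _) gmodule"
  let ?W = "weyl u :: ('k, _) gmodule"
  let ?E = "degree_space r s (D + 1) :: 'k tfun set"
  let ?Z = "form_kernel r s D c c'"
  let ?B = "(\<lambda>(a, b). basis_tensor r s a b) ` ({..r} \<times> {..s}) :: 'k tfun set"
  have finB: "finite ?B" and X: "vecs ?X = fs.span ?B" using nabla_tensor_finite_span[of r s, where 'k='k] by auto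
  have Ysub: "fs.subspace Y" "fs.subspace Y'" "Y \<subseteq> vecs ?X" "Y' \<subseteq> vecs ?X"
    using Y Y' by (auto simp: submodule_of_def)
  have Yact: "act ?X g v \<in> Y'" if "g \<in> SL2" "v \<in> Y'" for g v
    using Y' that by (auto simp: submodule_of_def)
  have SB: "S \<subseteq> fs.span ?B" if "S \<subseteq> Y'" for S using that Ysub X by blast
  have Zmono: "fs.dim (Y \<inter> ?Z) \<le> fs.dim (Y' \<inter> ?Z)"
    using YY' by (intro fs.dim_mono_finite[OF finB SB]) auto
  obtain \<Theta> where "quotient_map ?X Y' Y ?W \<Theta>"
    using quotient_iso_imp_map[OF iso] Ysub(1) YY' module_fscal by auto
  then have \<Theta>: "\<And>v. v \<in> Y' \<Longrightarrow> \<Theta> v \<in> vecs ?W"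
    "\<And>v w. v \<in> Y' \<Longrightarrow> w \<in> Y' \<Longrightarrow> \<Theta> (v + w) = \<Theta> v + \<Theta> w"
    "\<And>x v. v \<in> Y' \<Longrightarrow> \<Theta> (fscal x v) = fscal x (\<Theta> v)"
    "\<And>g v. g \<in> SL2 \<Longrightarrow> v \<in> Y' \<Longrightarrow> \<Theta> (act ?X g v) = act ?W g (\<Theta> v)"
    "\<And>v. v \<in> Y' \<Longrightarrow> \<Theta> v = 0 \<longleftrightarrow> v \<in> Y"
    "\<And>n. n \<in> vecs ?W \<Longrightarrow> \<exists>v\<in>Y'. \<Theta> v = n"
    unfolding quotient_map_def scal_tensor weyl_simps(1) by blast+
  show ?thesis
  proof (cases "Y' \<inter> ?E \<subseteq> Y")
    case True
    then have "Y' \<inter> ?E = Y \<inter> ?E" using YY' by blast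
    then show ?thesis using Zmono by simp
  next
    case False
    \<comment> \<open>the torus acts on degree D + 1 and on the i-th coordinate of weyl u by powers that must agree\<close>
    have wt: "r + s + u = 2 * D + 2 + 2 * i" if v: "v \<in> Y'" "v \<in> ?E" and i: "i \<le> u" "\<Theta> v (monomial_fn u i) \<noteq> 0" for v i
    proof -
      let ?e = "\<Theta> v (monomial_fn u i)"
      have pw: "z ^ (r + s + (u - i)) = z ^ (2 * (D + 1) + i)" if z: "z \<noteq> 0" for z :: 'k
      proof -
        have g: "torus_elt z \<in> SL2" using z by simp
        have vX: "v \<in> vecs ?X" using v Ysub by blast
        have aX: "act ?X (torus_elt z) v \<in> vecs ?X" using Yact[OF g v(1)] Ysub by blast
        have "fscal (z ^ (r + s)) (act ?X (torus_elt z) v) = fscal (z ^ (2 * (D + 1))) v"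
        proof (rule nabla_tensor_eqI)
          show "fscal (z ^ (r + s)) (act ?X (torus_elt z) v) \<in> vecs ?X" "fscal (z ^ (2 * (D + 1))) v \<in> vecs ?X"
            using aX vX fs.subspace_scale[OF tensor_subspace] by blast+
          fix a b assume ab: "a \<le> r" "b \<le> s"
          show "fscal (z ^ (r + s)) (act ?X (torus_elt z) v) (coord_form r s a b) = fscal (z ^ (2 * (D + 1))) v (coord_form r s a b)"
            using act_torus_coord[OF vX z ab] v(2) ab by (cases "a + b = D + 1") (auto simp: degree_space_def)
        qed
        then have "fscal (z ^ (r + s)) (act ?W (torus_elt z) (\<Theta> v)) = fscal (z ^ (2 * (D + 1))) (\<Theta> v)"
          using \<Theta>(3)[OF Yact[OF g v(1)]] \<Theta>(3)[OF v(1)] \<Theta>(4)[OF g v(1)] by metis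
        then have "z ^ (r + s) * act ?W (torus_elt z) (\<Theta> v) (monomial_fn u i) = z ^ (2 * (D + 1)) * ?e"
          by (metis fscal_apply)
        then have "z ^ (r + s) * ((1 / z) ^ i * z ^ (u - i)) = z ^ (2 * (D + 1))"
          using act_weyl_torus[OF \<Theta>(1)[OF v(1)] z i(1)] i(2) by (simp add: mult.assoc[symmetric])
        then show ?thesis using z by (simp add: power_divide power_add field_simps)
      qed
      have "r + s + (u - i) = 2 * (D + 1) + i" by (rule power_eq_all_imp_eq) (rule pw)
      then show ?thesis using i(1) by arith
    qed
    from False obtain v0 where v0: "v0 \<in> Y'" "v0 \<in> ?E" "v0 \<notin> Y" by blast
    obtain i0 where i0: "i0 \<le> u" "\<Theta> v0 (monomial_fn u i0) \<noteq> 0"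
      using weyl_eq_zeroI[OF \<Theta>(1)[OF v0(1)]] \<Theta>(5)[OF v0(1)] v0(3) by blast
    have u: "r + s + u = 2 * D + 2 + 2 * i0" by (rule wt[OF v0(1,2) i0])
    define e where "e v = \<Theta> v (monomial_fn u i0)" for v
    \<comment> \<open>the weight determines the coordinate i0, so the quotient contributes at most one dimension\<close>
    have one: "Y' \<inter> ?E \<subseteq> fs.span (insert v0 (Y \<inter> ?E))"
    proof
      fix v assume v: "v \<in> Y' \<inter> ?E"
      define w where "w = v + fscal (- (e v / e v0)) v0"
      have sv: "fscal (- (e v / e v0)) v0 \<in> Y'" "fscal (- (e v / e v0)) v0 \<in> ?E"
        using v0 Ysub(2) degree_space_subspace fs.subspace_scale by blast+
      have w: "w \<in> Y'" "w \<in> ?E"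
        unfolding w_def using v sv Ysub(2) degree_space_subspace fs.subspace_add by blast+
      have \<Theta>w: "\<Theta> w = \<Theta> v + fscal (- (e v / e v0)) (\<Theta> v0)"
        unfolding w_def by (simp only: \<Theta>(2)[OF IntD1[OF v] sv(1)] \<Theta>(3)[OF v0(1)])
      have "\<Theta> w = 0"
      proof (rule weyl_eq_zeroI[OF \<Theta>(1)[OF w(1)]])
        fix i assume i: "i \<le> u"
        show "\<Theta> w (monomial_fn u i) = 0"
        proof (cases "i = i0")
          case True
          then show ?thesis using i0 by (simp add: \<Theta>w e_def)
        next
          case False
          then show ?thesis using wt[OF w i] u by auto
        qed
      qed
      then have "w \<in> Y \<inter> ?E" using \<Theta>(5) w by blast
      moreover have "v = w + fscal (e v / e v0) v0" by (simp add: w_def fun_eq_iff)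
      ultimately show "v \<in> fs.span (insert v0 (Y \<inter> ?E))"
        by (metis fs.span_add fs.span_base fs.span_scale insertI1 insertI2)
    qed
    have d1: "fs.dim (Y' \<inter> ?E) \<le> fs.dim (Y \<inter> ?E) + 1"
    proof -
      have YE: "Y \<inter> ?E \<subseteq> fs.span ?B" using YY' by (intro SB) blast
      obtain A where A: "finite A" "A \<subseteq> Y \<inter> ?E" "fs.independent A" "Y \<inter> ?E \<subseteq> fs.span A" "card A = fs.dim (Y \<inter> ?E)"
        by (rule fs.finite_basis_exists[OF finB YE])
      have "insert v0 (Y \<inter> ?E) \<subseteq> fs.span (insert v0 A)"
        using A(4) fs.span_mono[of A "insert v0 A"] fs.span_base[of v0 "insert v0 A"] by blast
      then have "fs.span (insert v0 (Y \<inter> ?E)) \<subseteq> fs.span (insert v0 A)"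
        by (intro fs.span_minimal) auto
      then have "fs.dim (Y' \<inter> ?E) \<le> card (insert v0 A)"
        using one A(1) by (intro fs.dim_le_card) auto
      also have "\<dots> \<le> card A + 1" using card_insert_le_m1 by (simp add: card_insert_if A(1))
      finally show ?thesis using A(5) by simp
    qed
    \<comment> \<open>the coordinate of weyl u that has the weight of degree D\<close>
    define k where "k = i0 + 1"
    have k: "r + s + u = 2 * D + 2 * k" "1 \<le> k" "k \<le> u" using u D by (auto simp: k_def)
    define e0 where "e0 = (\<lambda>f. if f \<in> vecs (nabla u) then coord u 0 f else (0::'k))"
    have "e0 \<in> vecs ?W"
    proof -
      have "linear_within (vecs (nabla u)) fscal (*) e0"
        unfolding linear_within_def e0_def
        using fs.subspace_add[OF nabla_subspace[where 'k='k]] fs.subspace_scale[OF nabla_subspace[where 'k='k]]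
        by (simp add: coord_add coord_fscal)
      then show ?thesis by (simp add: weyl_simps e0_def)
    qed
    then obtain v where v: "v \<in> Y'" "\<Theta> v = e0" using \<Theta>(6) by blast
    have l: "lower_elt 1 \<in> (SL2 :: ('k ^ 2 ^ 2) set)" by simp
    define w where "w = act ?X (lower_elt 1) v + fscal (- 1) v"
    have lv: "act ?X (lower_elt 1) v \<in> Y'" by (rule Yact[OF l v(1)])
    have mv: "fscal (- 1) v \<in> Y'" using fs.subspace_scale[OF Ysub(2) v(1)] .
    have w: "w \<in> Y'" unfolding w_def by (rule fs.subspace_add[OF Ysub(2) lv mv])
    have wX: "w \<in> vecs ?X" using w Ysub by blast
    have form_w: "form_value r s D x w = 0" if "translation_form r s D x" for x
      using form_value_invariant[OF that] v(1) Ysub unfolding w_def form_value_add form_value_fscal by auto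
    have \<Theta>w: "\<Theta> w (monomial_fn u k) = (- 1) ^ k"
    proof -
      have "\<Theta> w = act ?W (lower_elt 1) e0 + fscal (- 1) e0"
        unfolding w_def by (simp only: \<Theta>(2)[OF lv mv] \<Theta>(3)[OF v(1)] \<Theta>(4)[OF l v(1)] v(2))
      then have "\<Theta> w (monomial_fn u k) = act ?W (lower_elt 1) e0 (monomial_fn u k) - e0 (monomial_fn u k)" by simp
      also have "e0 (monomial_fn u k) = 0" using k by (simp add: e0_def monomial_fn_nabla coord_monomial)
      also have "act ?W (lower_elt 1) e0 (monomial_fn u k) = (- 1) ^ k"
        using lower_weyl_vector[OF k(3), where 'k='k] act_nabla_closed[OF monomial_fn_nabla[OF k(3)] matrix_inv_SL2(1)[OF l]]
        by (simp only: weyl_simps monomial_fn_nabla[OF k(3)] if_True e0_def)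
      finally show ?thesis by simp
    qed
    \<comment> \<open>projection to degree D as a combination of torus elements, which keeps it inside submodules; the factor with exponent M turns all weights, those of X and those of weyl u, into nonnegative powers of q\<close>
    define K \<kappa> where "K = fst (interp (u + r + s) (u + D) :: 'k set \<times> ('k \<Rightarrow> 'k))" and "\<kappa> = snd (interp (u + r + s) (u + D) :: 'k set \<times> ('k \<Rightarrow> 'k))"
    have K: "finite K" "0 \<notin> K" and \<kappa>: "\<And>n. n \<le> u + r + s \<Longrightarrow> (\<Sum>q\<in>K. \<kappa> q * q ^ n) = (if n = u + D then 1 else 0)"
      unfolding K_def \<kappa>_def by (rule interp(1), rule interp(2), erule interp(3))
    have "\<exists>z. z ^ 2 = q" for q :: 'k using nth_root_exists[of 2 q] by auto
    then obtain \<zeta> where \<zeta>: "\<And>q :: 'k. \<zeta> q ^ 2 = q" by metis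
    have \<zeta>p: "\<zeta> q ^ (2 * n) = q ^ n" for q n by (simp only: power_mult \<zeta>)
    have \<zeta>0: "\<zeta> q \<noteq> 0" if "q \<in> K" for q using \<zeta>[of q] K that by auto
    have gq: "torus_elt (\<zeta> q) \<in> SL2" if "q \<in> K" for q using \<zeta>0[OF that] by simp
    define M where "M = r + s + 2 * u"
    define y where "y = (\<Sum>q\<in>K. fscal (\<kappa> q * \<zeta> q ^ M) (act ?X (torus_elt (\<zeta> q)) w))"
    have yY: "y \<in> Y'" unfolding y_def
      using Yact gq w by (intro fs.subspace_sum[OF Ysub(2)] fs.subspace_scale[OF Ysub(2)]) auto
    have ycoord: "y (coord_form r s a b) = (if a + b = D then w (coord_form r s a b) else 0)" if ab: "a \<le> r" "b \<le> s" for a b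
    proof -
      have "y (coord_form r s a b) = (\<Sum>q\<in>K. \<kappa> q * (\<zeta> q ^ (2 * u) * (\<zeta> q ^ (r + s) * act ?X (torus_elt (\<zeta> q)) w (coord_form r s a b))))"
        by (simp add: y_def sum_fun_apply M_def power_add mult_ac)
      also have "\<dots> = (\<Sum>q\<in>K. \<kappa> q * (\<zeta> q ^ (2 * u) * (\<zeta> q ^ (2 * (a + b)) * w (coord_form r s a b))))"
        using act_torus_coord[OF wX \<zeta>0 ab] by (intro sum.cong refl) simp
      also have "\<dots> = (\<Sum>q\<in>K. \<kappa> q * q ^ (u + (a + b))) * w (coord_form r s a b)"
        unfolding sum_distrib_right by (intro sum.cong refl) (simp only: \<zeta>p power_add[of _ u] mult.assoc)
      also have "\<dots> = (if a + b = D then w (coord_form r s a b) else 0)"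
        using \<kappa>[of "u + (a + b)"] ab by simp
      finally show ?thesis .
    qed
    have yD: "y \<in> degree_space r s D"
      using yY Ysub ycoord by (auto simp: degree_space_def)
    have "form_value r s D x y = form_value r s D x w" for x
      unfolding form_value_def by (intro sum.cong refl) (auto simp: form_range_def ycoord)
    then have yZ: "y \<in> ?Z" using yD form_w c by (simp add: form_kernel_def)
    have "\<Theta> y (monomial_fn u k) = (- 1) ^ k"
    proof -
      have "linear_within Y' fscal fscal \<Theta>" using \<Theta>(2,3) by (simp add: linear_within_def)
      then have "\<Theta> y = (\<Sum>q\<in>K. fscal (\<kappa> q * \<zeta> q ^ M) (\<Theta> (act ?X (torus_elt (\<zeta> q)) w)))"
        unfolding y_def using Yact gq w by (intro linear_within_sum[OF module_fscal module_fscal Ysub(2) _ K(1)]) auto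
      then have "\<Theta> y (monomial_fn u k) = (\<Sum>q\<in>K. \<kappa> q * \<zeta> q ^ M * \<Theta> (act ?X (torus_elt (\<zeta> q)) w) (monomial_fn u k))"
        by (simp add: sum_fun_apply)
      also have "\<dots> = (\<Sum>q\<in>K. \<kappa> q * q ^ (u + D) * (- 1) ^ k)"
      proof (intro sum.cong refl)
        fix q assume q: "q \<in> K"
        let ?z = "\<zeta> q"
        have "\<Theta> (act ?X (torus_elt ?z) w) (monomial_fn u k) = (1 / ?z) ^ k * ?z ^ (u - k) * (- 1) ^ k"
          using \<Theta>(4)[OF gq[OF q] w] act_weyl_torus[OF \<Theta>(1)[OF w] \<zeta>0[OF q] k(3)] \<Theta>w by simp
        moreover have "?z ^ M * ((1 / ?z) ^ k * ?z ^ (u - k)) = q ^ (u + D)"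
        proof -
          have "M + (u - k) = 2 * (u + D) + k" using k by (simp add: M_def)
          then have "?z ^ M * ?z ^ (u - k) = ?z ^ (2 * (u + D)) * ?z ^ k" by (simp flip: power_add)
          then have "?z ^ M * ?z ^ (u - k) = q ^ (u + D) * ?z ^ k" unfolding \<zeta>p .
          then show ?thesis using \<zeta>0[OF q] by (simp add: power_divide field_simps)
        qed
        ultimately show "\<kappa> q * ?z ^ M * \<Theta> (act ?X (torus_elt ?z) w) (monomial_fn u k) = \<kappa> q * q ^ (u + D) * (- 1) ^ k"
          by (metis mult.assoc)
      qed
      also have "\<dots> = (- 1) ^ k"
        using \<kappa>[of "u + D"] D by (simp flip: sum_distrib_right)
      finally show ?thesis .
    qed
    then have "y \<notin> Y" using \<Theta>(5)[OF yY] by auto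
    then have "Y \<inter> ?Z \<subset> Y' \<inter> ?Z" using yY yZ YY' by blast
    then have "fs.dim (Y \<inter> ?Z) < fs.dim (Y' \<inter> ?Z)"
      using fs.subspace_inter[OF Ysub(1) form_kernel_subspace]
      by (intro fs.dim_strict_mono_finite[OF finB SB]) auto
    with d1 show ?thesis by linarith
  qed
qed

text \<open>
  In terms of forms: the number of independent invariant functionals of weight \<open>t = 2 D - r - s\<close> is
  at most the dimension of the weight space for \<open>t\<close> minus that for \<open>t + 2\<close>.
\<close>

lemma weyl_filtration_form_bound:
  fixes c c' :: "nat \<Rightarrow> 'k::alg_closed_field"
  assumes W: "weyl_filtration (nabla_tensor r s :: ('k, _) gmodule)"
    and D: "r + s \<le> 2 * D" "D \<le> r + s"
    and c: "translation_form r s D c" "translation_form r s D c'"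
  shows "fs.dim (degree_space r s (D + 1) :: 'k tfun set)
    \<le> fs.dim (form_kernel r s D c c')"
proof -
  let ?X = "nabla_tensor r s :: ('k, _) gmodule"
  obtain n F where nF: "F 0 = {0} \<and> F n = vecs ?X \<and> (\<forall>i\<le>n. submodule_of (F i) ?X) \<and>
      (\<forall>i<n. F i \<subseteq> F (Suc i) \<and> (F (Suc i) = F i \<or> (\<exists>u. quotient_iso ?X (F (Suc i)) (F i) (weyl u))))"
    using W unfolding weyl_filtration_def filtration_with_def by (elim exE) (rule that)
  then have F: "F 0 = {0}" "F n = vecs ?X" and sub: "\<And>i. i \<le> n \<Longrightarrow> submodule_of (F i) ?X"
    and step: "\<And>i. i < n \<Longrightarrow> F i \<subseteq> F (Suc i) \<and> (F (Suc i) = F i \<or> (\<exists>u. quotient_iso ?X (F (Suc i)) (F i) (weyl u)))"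
    by simp_all
  define G H where "G i = fs.dim (F i \<inter> degree_space r s (D + 1))"
    and "H i = fs.dim (F i \<inter> form_kernel r s D c c')" for i
  have G0: "G 0 = 0"
  proof -
    have "fs.dim (F 0 \<inter> degree_space r s (D + 1)) \<le> card ({} :: 'k tfun set)"
      by (rule fs.dim_le_card) (auto simp: F(1))
    then show ?thesis by (simp add: G_def)
  qed
  have GH: "G (Suc i) + H i \<le> G i + H (Suc i)" if i: "i < n" for i
  proof -
    from step[OF i] consider "F (Suc i) = F i"
      | u where "F i \<subseteq> F (Suc i)" "quotient_iso ?X (F (Suc i)) (F i) (weyl u)" by blast
    then show ?thesis
    proof cases
      case 2
      then show ?thesis
        using weyl_quotient_step[OF sub sub 2 D c] i by (simp add: G_def H_def)
    qed (simp add: G_def H_def)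
  qed
  have "G i \<le> H i" if "i \<le> n" for i
    using that
  proof (induction i)
    case (Suc i)
    then show ?case using GH[of i] by simp
  qed (simp add: G0)
  from this[of n] show ?thesis
    unfolding G_def H_def F(2)
    by (simp add: degree_space_def form_kernel_def Int_absorb1 Collect_mono_iff Int_def conj_ac)
qed

text \<open>
  The weight multiplicities of the tensor product are constant between the weights \<open>0\<close> and
  \<open>max r s - min r s\<close> and then drop by one at each step.
\<close>

lemma card_form_range:
  assumes "r + s \<le> 2 * D"
  shows "D < max r s \<Longrightarrow> card (form_range r s D) \<le> card (form_range r s (D + 1))"
    "card (form_range r s D) \<le> card (form_range r s (D + 1)) + 1"
proof -
  have *: "form_range r s D = {D - s..min r D}" for D by (auto simp: form_range_def)
  show "D < max r s \<Longrightarrow> card (form_range r s D) \<le> card (form_range r s (D + 1))"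
    "card (form_range r s D) \<le> card (form_range r s (D + 1)) + 1"
    unfolding * card_atLeastAtMost using assms by (auto simp: min_def max_def split: if_splits)
qed

lemma degree_space_span:
  "degree_space r s D \<subseteq> fs.span ((\<lambda>i. basis_tensor r s i (D - i) :: 'k::alg_closed_field tfun) ` form_range r s D)"
proof
  fix t :: "'k tfun"
  assume t: "t \<in> degree_space r s D"
  let ?S = "fs.span ((\<lambda>i. basis_tensor r s i (D - i) :: 'k tfun) ` form_range r s D)"
  have tX: "t \<in> vecs (nabla_tensor r s)" using t by (simp add: degree_space_def)
  have "fscal (t (coord_form r s a b)) (basis_tensor r s a b) \<in> ?S" if ab: "a \<le> r" "b \<le> s" for a b
  proof (cases "a + b = D")
    case True
    then have "a \<in> form_range r s D" "b = D - a" using ab by (auto simp: form_range_def)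
    then show ?thesis
      by (intro fs.span_scale fs.span_base) (rule image_eqI[of _ _ a], simp_all)
  next
    case False
    then have "t (coord_form r s a b) = 0" using t ab by (simp add: degree_space_def)
    then show ?thesis using fs.span_zero by simp
  qed
  then have "(\<Sum>a\<le>r. \<Sum>b\<le>s. fscal (t (coord_form r s a b)) (basis_tensor r s a b)) \<in> ?S"
    by (intro fs.span_sum) auto
  then show "t \<in> ?S" by (simp only: nabla_tensor_expansion[OF tX, symmetric])
qed

lemma basis_tensor_degree_space:
  assumes "i \<in> form_range r s D"
  shows "basis_tensor r s i (D - i) \<in> (degree_space r s D :: 'k::alg_closed_field tfun set)"
  using assms by (auto simp: degree_space_def form_range_def basis_tensor_coord_form intro: basis_tensor_mem)

lemma dim_degree_space:
  "fs.dim (degree_space r s D :: 'k::alg_closed_field tfun set) = card (form_range r s D)"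
proof (rule antisym)
  let ?B = "(\<lambda>i. basis_tensor r s i (D - i) :: 'k tfun) ` form_range r s D"
  have "fs.dim (degree_space r s D :: 'k tfun set) \<le> card ?B"
    by (rule fs.dim_le_card[OF degree_space_span]) simp
  also have "\<dots> \<le> card (form_range r s D)" by (rule card_image_le) simp
  finally show "fs.dim (degree_space r s D :: 'k tfun set) \<le> card (form_range r s D)" .
  show "card (form_range r s D) \<le> fs.dim (degree_space r s D :: 'k tfun set)"
  proof (rule independent_by_coordinates[where e = "\<lambda>i t. t (coord_form r s i (D - i))"])
    show "finite ?B" "degree_space r s D \<subseteq> fs.span ?B" using degree_space_span by auto
    show "basis_tensor r s i (D - i) \<in> (degree_space r s D :: 'k tfun set)"
      if "i \<in> form_range r s D" for i by (rule basis_tensor_degree_space[OF that])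
    fix i j assume "i \<in> form_range r s D" "j \<in> form_range r s D"
    then show "basis_tensor r s j (D - j) (coord_form r s i (D - i) :: 'k gfun \<Rightarrow> _) = (if i = j then 1 else 0)"
      by (auto simp: form_range_def basis_tensor_coord_form)
  qed auto
qed

lemma excess_forms_not_weyl_filtration:
  assumes ex: "excess_forms r s D (c :: nat \<Rightarrow> 'k::alg_closed_field) c'"
  shows "\<not> weyl_filtration (nabla_tensor r s :: ('k, _) gmodule)"
proof
  assume W: "weyl_filtration (nabla_tensor r s :: ('k, _) gmodule)"
  let ?D = "degree_space r s D :: 'k tfun set"
  let ?Z = "form_kernel r s D c c'"
  let ?B = "(\<lambda>i. basis_tensor r s i (D - i)) ` form_range r s D"
  have e: "r + s \<le> 2 * D" "translation_form r s D c" "translation_form r s D c'"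
    using ex by (auto simp: excess_forms_def)
  obtain j where j: "j \<in> form_range r s D" "c' j \<noteq> 0" using ex by (auto simp: excess_forms_def)
  then have Drs: "D \<le> r + s" by (auto simp: form_range_def)
  let ?b = "\<lambda>i. basis_tensor r s i (D - i) :: 'k tfun"
  have val: "form_value r s D x (?b i) = x i" if "i \<in> form_range r s D" for x i
    using that by (auto simp: form_value_basis form_range_def)
  have Z1: "fs.subspace (form_kernel r s D (\<lambda>_. 0) c')" by (rule form_kernel_subspace)
  have v0: "form_value r s D (\<lambda>_. 0) t = 0" for t by (simp add: form_value_def)
  have sub1: "form_kernel r s D (\<lambda>_. 0) c' \<subset> ?D"
  proof
    show "form_kernel r s D (\<lambda>_. 0) c' \<subseteq> ?D" by (auto simp: form_kernel_def)
    have "?b j \<in> ?D" "?b j \<notin> form_kernel r s D (\<lambda>_. 0) c'"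
      using j basis_tensor_degree_space[OF j(1)] val[OF j(1)] by (auto simp: form_kernel_def)
    then show "form_kernel r s D (\<lambda>_. 0) c' \<noteq> ?D" by blast
  qed
  have fin: "finite ?B" "?D \<subseteq> fs.span ?B" using degree_space_span by auto
  have lt1: "fs.dim (form_kernel r s D (\<lambda>_. 0) c') < fs.dim ?D"
    by (rule fs.dim_strict_mono_finite[OF fin Z1 sub1])
  have sub2: "?Z \<subseteq> form_kernel r s D (\<lambda>_. 0) c'" by (auto simp: form_kernel_def v0)
  have fin2: "form_kernel r s D (\<lambda>_. 0) c' \<subseteq> fs.span ?B" using sub1 fin by blast
  have le: "fs.dim (degree_space r s (D + 1) :: 'k tfun set) \<le> fs.dim ?Z"
    by (rule weyl_filtration_form_bound[OF W e(1) Drs e(2,3)])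
  show False
  proof (cases "D < max r s")
    case True
    have "fs.dim ?Z \<le> fs.dim (form_kernel r s D (\<lambda>_. 0) c')"
      by (rule fs.dim_mono_finite[OF fin(1) fin2 sub2])
    then show False using le lt1 card_form_range(1)[OF e(1) True] unfolding dim_degree_space by linarith
  next
    case False
    then have ind: "\<exists>i\<in>form_range r s D. c i \<noteq> x * c' i" for x using ex by (auto simp: excess_forms_def)
    obtain i where i: "i \<in> form_range r s D" "c i \<noteq> (c j / c' j) * c' i" using ind by blast
    define t where "t = fscal (c' j) (?b i) + fscal (- c' i) (?b j)"
    have tD: "t \<in> ?D" unfolding t_def
      by (intro fs.subspace_add fs.subspace_scale degree_space_subspace basis_tensor_degree_space i(1) j(1))
    have ft: "form_value r s D x t = c' j * x i - c' i * x j" for x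
      unfolding t_def form_value_add form_value_fscal val[OF i(1)] val[OF j(1)] by simp
    have "t \<in> form_kernel r s D (\<lambda>_. 0) c'" using tD by (simp add: form_kernel_def v0 ft)
    moreover have "t \<notin> ?Z" using i(2) j(2) by (simp add: form_kernel_def ft field_simps)
    ultimately have "?Z \<subset> form_kernel r s D (\<lambda>_. 0) c'" using sub2 by blast
    then have "fs.dim ?Z < fs.dim (form_kernel r s D (\<lambda>_. 0) c')"
      by (rule fs.dim_strict_mono_finite[OF fin(1) fin2 form_kernel_subspace])
    then show False using le lt1 card_form_range(2)[OF e(1)] unfolding dim_degree_space by linarith
  qed
qed

section \<open>Filtrations cut out by functionals\<close>

lemma nabla_span_card:
  "finite (monomial_fn r ` {..r} :: 'k::alg_closed_field gfun set)" "card (monomial_fn r ` {..r} :: 'k gfun set) \<le> r + 1"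
  using card_image_le[of "{..r}" "monomial_fn r :: _ \<Rightarrow> 'k gfun"] by auto

text \<open>
  A group action \<open>A\<close> on a space \<open>V\<close> of functions together with functionals \<open>\<xi> 0, \<xi> 1, \<dots>\<close> such that
  \<open>\<xi> i\<close> is semi-invariant under the Borel subgroup on the vectors all of whose translates are killed by
  the previous functionals.  Frobenius reciprocity embeds the successive kernels into induced modules,
  and the assumption on dimensions makes the embeddings surjective.  It is stated for an abstract
  action because it is applied to a module and to its dual.
\<close>

locale functional_chain =
  fixes V :: "('x \<Rightarrow> 'k::alg_closed_field) set" and B :: "('x \<Rightarrow> 'k) set"
    and A :: "'k ^ 2 ^ 2 \<Rightarrow> ('x \<Rightarrow> 'k) \<Rightarrow> 'x \<Rightarrow> 'k"
    and \<xi> :: "nat \<Rightarrow> ('x \<Rightarrow> 'k) \<Rightarrow> 'k" and l :: "nat \<Rightarrow> nat" and m :: nat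
  assumes V: "fs.subspace V" "finite B" "V \<subseteq> fs.span B"
    and A_closed: "\<And>g v. g \<in> SL2 \<Longrightarrow> v \<in> V \<Longrightarrow> A g v \<in> V"
    and A_lin: "\<And>g. g \<in> SL2 \<Longrightarrow> linear_within V fscal fscal (A g)"
    and A_mult: "\<And>g h v. g \<in> SL2 \<Longrightarrow> h \<in> SL2 \<Longrightarrow> v \<in> V \<Longrightarrow> A (g ** h) v = A g (A h v)"
    and \<xi>_lin: "\<And>i. i < m \<Longrightarrow> linear_within V fscal (*) (\<xi> i)"
    and reg: "\<And>i v. i < m \<Longrightarrow> v \<in> V \<Longrightarrow> on_SL2 (\<lambda>g. \<xi> i (A g v)) \<in> regular_functions"
    and semi: "\<And>i v b. i < m \<Longrightarrow> v \<in> V \<Longrightarrow> (\<And>j g. j < i \<Longrightarrow> g \<in> SL2 \<Longrightarrow> \<xi> j (A g v) = 0)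
      \<Longrightarrow> b \<in> borel2 \<Longrightarrow> \<xi> i (A b v) = (b $ 1 $ 1) ^ l i * \<xi> i v"
    and final: "\<And>v. v \<in> V \<Longrightarrow> (\<And>j g. j < m \<Longrightarrow> g \<in> SL2 \<Longrightarrow> \<xi> j (A g v) = 0) \<Longrightarrow> v = 0"
    and dims: "(\<Sum>i<m. l i + 1) \<le> fs.dim V"
begin

text \<open>
  The largest invariant subspace on which the first \<open>i\<close> functionals vanish.
\<close>

definition cut :: "nat \<Rightarrow> ('x \<Rightarrow> 'k) set" where
  "cut i = {v \<in> V. \<forall>j<i. \<forall>g\<in>SL2. \<xi> j (A g v) = 0}"

text \<open>
  The map of Frobenius reciprocity for \<open>\<xi> i\<close>.
\<close>

definition orbit_fn :: "nat \<Rightarrow> ('x \<Rightarrow> 'k) \<Rightarrow> 'k gfun" where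
  "orbit_fn i v = on_SL2 (\<lambda>g. \<xi> i (A g v))"

lemma functional_translate_linear:
  assumes "j < m" "g \<in> SL2"
  shows "linear_within V fscal (*) (\<lambda>v. \<xi> j (A g v))"
  using \<xi>_lin[OF assms(1)] A_lin[OF assms(2)] A_closed[OF assms(2)] by (simp add: linear_within_def)

lemma cut_subspace:
  assumes "i \<le> m"
  shows "fs.subspace (cut i)"
proof (rule fs.subspaceI)
  have "\<xi> j (A g 0) = 0" if "j < i" "g \<in> SL2" for j g
    using linear_within_zero[OF module_fscal module_mult V(1) functional_translate_linear] that assms by simp
  then show "0 \<in> cut i" using fs.subspace_0[OF V(1)] by (simp add: cut_def)
  show "x + y \<in> cut i" if xy: "x \<in> cut i" "y \<in> cut i" for x y
  proof -
    have "\<xi> j (A g (x + y)) = 0" if j: "j < i" "g \<in> SL2" for j g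
      using functional_translate_linear[of j g] xy j assms by (simp add: cut_def linear_within_def)
    then show ?thesis using xy fs.subspace_add[OF V(1)] by (simp add: cut_def)
  qed
  show "fscal c x \<in> cut i" if x: "x \<in> cut i" for c x
  proof -
    have "\<xi> j (A g (fscal c x)) = 0" if j: "j < i" "g \<in> SL2" for j g
      using functional_translate_linear[of j g] x j assms by (simp add: cut_def linear_within_def)
    then show ?thesis using x fs.subspace_scale[OF V(1)] by (simp add: cut_def)
  qed
qed

lemma cut_act:
  assumes "i \<le> m" "g \<in> SL2" "v \<in> cut i"
  shows "A g v \<in> cut i"
proof -
  have "\<xi> j (A h (A g v)) = 0" if "j < i" "h \<in> SL2" for j h
  proof -
    have "h ** g \<in> SL2" using that assms by simp
    then have "\<xi> j (A (h ** g) v) = 0" using assms(3) that(1) by (simp add: cut_def)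
    then show ?thesis using A_mult[OF that(2) assms(2)] assms(3) by (simp add: cut_def)
  qed
  then show ?thesis using A_closed assms by (simp add: cut_def)
qed

lemma orbit_fn_linear:
  assumes "i < m"
  shows "linear_within V fscal fscal (orbit_fn i)"
  using functional_translate_linear[OF assms] by (auto simp: linear_within_def orbit_fn_def fun_eq_iff on_SL2_def)

lemma orbit_fn_eq_zero:
  assumes "i < m" "v \<in> cut i"
  shows "orbit_fn i v = 0 \<longleftrightarrow> v \<in> cut (Suc i)"
  using assms by (auto simp: orbit_fn_def cut_def on_SL2_def fun_eq_iff less_Suc_eq)

lemma orbit_fn_mem:
  assumes i: "i < m"
  shows "orbit_fn i ` cut i \<subseteq> vecs (nabla (l i))"
proof
  fix f assume "f \<in> orbit_fn i ` cut i"
  then obtain v where v: "v \<in> cut i" "f = orbit_fn i v" by blast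
  then have v0: "v \<in> V" by (simp add: cut_def)
  show "f \<in> vecs (nabla (l i))"
  proof (rule nabla_memI)
    show "f \<in> regular_functions" using reg[OF i v0] by (simp add: v orbit_fn_def)
    fix b x :: "'k ^ 2 ^ 2" assume b: "b \<in> borel2" and x: "x \<in> SL2"
    then have b': "b \<in> SL2" by (simp add: borel2_def)
    have "\<xi> i (A (b ** x) v) = (b $ 1 $ 1) ^ l i * \<xi> i (A x v)"
      unfolding A_mult[OF b' x v0] using cut_act[OF _ x v(1)] i b by (intro semi) (auto simp: cut_def)
    then show "f (b ** x) = (b $ 1 $ 1) ^ l i * f x" using b' x by (simp add: v orbit_fn_def on_SL2_def)
  qed
qed

lemma orbit_fn_onto:
  assumes i: "i < m"
  shows "orbit_fn i ` cut i = vecs (nabla (l i))"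
proof (rule kernel_chain_surjective[where m = m and B = B and V = cut and f = orbit_fn and W = "\<lambda>i. vecs (nabla (l i))"
      and C = "\<lambda>i. monomial_fn (l i) ` {..l i}" and d = "\<lambda>i. l i + 1"])
  show "finite B" by (rule V)
  show "cut 0 \<subseteq> fs.span B" using V(3) by (auto simp: cut_def)
  show "\<And>i. i \<le> m \<Longrightarrow> fs.subspace (cut i)" by (rule cut_subspace)
  show "linear_within (cut i) fscal fscal (orbit_fn i)" if "i < m" for i
    using orbit_fn_linear[OF that] by (auto simp: linear_within_def cut_def)
  show "cut (Suc i) = {v \<in> cut i. orbit_fn i v = 0}" if "i < m" for i
    using orbit_fn_eq_zero[OF that] by (auto simp: cut_def)
  show "cut m = {0}" using final fs.subspace_0[OF cut_subspace[of m]] by (auto simp: cut_def)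
  show "\<And>i. i < m \<Longrightarrow> orbit_fn i ` cut i \<subseteq> vecs (nabla (l i))" by (rule orbit_fn_mem)
  show "finite (monomial_fn (l i) ` {..l i}) \<and> card (monomial_fn (l i) ` {..l i} :: 'k gfun set) \<le> l i + 1
      \<and> vecs (nabla (l i)) = fs.span (monomial_fn (l i) ` {..l i} :: 'k gfun set)" for i
    using nabla_span_card[where 'k='k] nabla_eq_span[where 'k='k] by blast
  have "cut 0 = V" by (simp add: cut_def)
  then show "(\<Sum>i<m. l i + 1) \<le> fs.dim (cut 0)" using dims by simp
qed (rule i)

lemma orbit_fn_act:
  assumes "g \<in> SL2" "v \<in> V"
  shows "orbit_fn i (A g v) = act (nabla (l i)) g (orbit_fn i v)"
proof
  fix x
  show "orbit_fn i (A g v) x = act (nabla (l i)) g (orbit_fn i v) x"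
    using A_mult[of x g v] assms by (simp add: orbit_fn_def act_nabla on_SL2_def SL2_mult_iff)
qed

lemma cut_antimono: "cut (Suc i) \<subseteq> cut i"
  and cut_0: "cut 0 = V"
  and cut_subset: "cut i \<subseteq> V"
  by (auto simp: cut_def)

lemma cut_m: "cut m = {0}"
  using final fs.subspace_0[OF cut_subspace[of m]] by (auto simp: cut_def)

end

lemma rational_facts:
  assumes "rational_module M" "scal M = fscal"
  shows "fs.subspace (vecs M)" "\<And>g. g \<in> SL2 \<Longrightarrow> linear_within (vecs M) fscal fscal (act M g)"
    "\<And>g h v. g \<in> SL2 \<Longrightarrow> h \<in> SL2 \<Longrightarrow> v \<in> vecs M \<Longrightarrow> act M (g ** h) v = act M g (act M h v)"
    "\<And>v. v \<in> vecs M \<Longrightarrow> act M (mat 1) v = v"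
    "\<And>\<phi> v. linear_within (vecs M) fscal (*) \<phi> \<Longrightarrow> v \<in> vecs M \<Longrightarrow> on_SL2 (\<lambda>g. \<phi> (act M g v)) \<in> regular_functions"
    "\<exists>B. finite B \<and> vecs M \<subseteq> fs.span B"
proof -
  note d = assms(1)[unfolded rational_module_def assms(2)]
  note d2 = d[THEN conjunct2] and d3 = d[THEN conjunct2, THEN conjunct2]
  note d4 = d3[THEN conjunct2] and d5 = d3[THEN conjunct2, THEN conjunct2]
  show "fs.subspace (vecs M)" by (rule d2[THEN conjunct1])
  show "\<exists>B. finite B \<and> vecs M \<subseteq> fs.span B"
    using d3[THEN conjunct1] by (elim exE conjE) (intro exI conjI, assumption, simp)
  show "linear_within (vecs M) fscal fscal (act M g)" if "g \<in> SL2" for g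
    using d4[THEN conjunct1] that by simp
  show "act M (mat 1) v = v" if "v \<in> vecs M" for v
    using d5[THEN conjunct1] that by simp
  show "act M (g ** h) v = act M g (act M h v)" if "g \<in> SL2" "h \<in> SL2" "v \<in> vecs M" for g h v
    using d5[THEN conjunct2, THEN conjunct1] that by simp
  show "on_SL2 (\<lambda>g. \<phi> (act M g v)) \<in> regular_functions" if "linear_within (vecs M) fscal (*) \<phi>" "v \<in> vecs M" for \<phi> v
    using d5[THEN conjunct2, THEN conjunct2] that by simp
qed

lemma good_filtration_from_functionals:
  fixes M :: "('k::alg_closed_field, 'x \<Rightarrow> 'k) gmodule" and \<xi> :: "nat \<Rightarrow> ('x \<Rightarrow> 'k) \<Rightarrow> 'k" and l :: "nat \<Rightarrow> nat"
  assumes M: "rational_module M" "scal M = fscal"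
    and \<xi>_lin: "\<And>i. i < m \<Longrightarrow> linear_within (vecs M) fscal (*) (\<xi> i)"
    and semi: "\<And>i v b. i < m \<Longrightarrow> v \<in> vecs M \<Longrightarrow> (\<And>j g. j < i \<Longrightarrow> g \<in> SL2 \<Longrightarrow> \<xi> j (act M g v) = 0)
      \<Longrightarrow> b \<in> borel2 \<Longrightarrow> \<xi> i (act M b v) = (b $ 1 $ 1) ^ l i * \<xi> i v"
    and final: "\<And>v. v \<in> vecs M \<Longrightarrow> (\<And>j g. j < m \<Longrightarrow> g \<in> SL2 \<Longrightarrow> \<xi> j (act M g v) = 0) \<Longrightarrow> v = 0"
    and dims: "(\<Sum>i<m. l i + 1) \<le> fs.dim (vecs M)"
  shows "good_filtration M"
proof -
  note rf = rational_facts[OF M]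
  obtain B where B: "finite B" "vecs M \<subseteq> fs.span B" using rf(6) by blast
  interpret functional_chain "vecs M" B "act M" \<xi> l m
  proof
    show "on_SL2 (\<lambda>g. \<xi> i (act M g v)) \<in> regular_functions" if "i < m" "v \<in> vecs M" for i v
      by (rule rf(5)[OF \<xi>_lin[OF that(1)] that(2)])
  qed (fact rf(1) B(1) B(2) rational_act_closed[OF M(1)] rf(2) rf(3) \<xi>_lin semi final dims)+
  have quot: "quotient_iso M (cut i) (cut (Suc i)) (nabla (l i))" if i: "i < m" for i
  proof (rule quotient_map_imp_iso[where \<Theta> = "orbit_fn i"])
    show "quotient_map M (cut i) (cut (Suc i)) (nabla (l i)) (orbit_fn i)"
      unfolding quotient_map_def M(2) scal_nabla
    proof (intro conjI ballI allI)
      show "orbit_fn i v \<in> vecs (nabla (l i))" if "v \<in> cut i" for v using orbit_fn_mem[OF i] that by blast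
      show "\<exists>v\<in>cut i. orbit_fn i v = n" if "n \<in> vecs (nabla (l i))" for n
        using that unfolding orbit_fn_onto[OF i, symmetric] by blast
      show "orbit_fn i (v + w) = orbit_fn i v + orbit_fn i w" if "v \<in> cut i" "w \<in> cut i" for v w
        using orbit_fn_linear[OF i] cut_subset that unfolding linear_within_def by blast
      show "orbit_fn i (fscal c v) = fscal c (orbit_fn i v)" if "v \<in> cut i" for c v
        using orbit_fn_linear[OF i] cut_subset that unfolding linear_within_def by blast
      show "orbit_fn i v = 0 \<longleftrightarrow> v \<in> cut (Suc i)" if "v \<in> cut i" for v by (rule orbit_fn_eq_zero[OF i that])
      show "orbit_fn i (act M g v) = act (nabla (l i)) g (orbit_fn i v)" if "g \<in> SL2" "v \<in> cut i" for g v
        using orbit_fn_act that cut_subset by blast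
    qed
  qed (use M(2) module_fscal cut_subspace[of i] cut_subspace[of "Suc i"] cut_act[of i] cut_antimono i in auto)
  show ?thesis
    unfolding good_filtration_def filtration_with_def
  proof (intro exI[of _ m] exI[of _ "\<lambda>i. cut (m - i)"] conjI allI impI)
    show "cut (m - 0) = {0}" "cut (m - m) = vecs M" using cut_0 cut_m by simp_all
    show "submodule_of (cut (m - i)) M" for i
      unfolding submodule_of_def M(2) using cut_subspace[of "m - i"] cut_subset cut_act[of "m - i"] by auto
    fix i assume i: "i < m"
    then have e: "m - i = Suc (m - Suc i)" by simp
    show "cut (m - i) \<subseteq> cut (m - Suc i)" unfolding e by (rule cut_antimono)
    show "cut (m - Suc i) = cut (m - i) \<or> (\<exists>u. quotient_iso M (cut (m - Suc i)) (cut (m - i)) (nabla u))"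
      unfolding e using quot[of "m - Suc i"] i by auto
  qed
qed

lemma dual_simps:
  "scal (dual M) = fscal"
  "\<theta> \<in> vecs (dual M) \<longleftrightarrow> linear_within (vecs M) (scal M) (*) \<theta> \<and> (\<forall>v. v \<notin> vecs M \<longrightarrow> \<theta> v = 0)"
  "act (dual M) g \<theta> v = (if v \<in> vecs M then \<theta> (act M (matrix_inv g) v) else 0)"
  by (simp_all add: dual_def)

text \<open>
  The functionals on the dual module are the evaluations at the vectors \<open>w i\<close>, which are lowest
  weight vectors modulo the submodule generated by their predecessors.  The dual module is filtered by
  \<open>cut i\<close> with induced quotients, and the filtration of \<open>M\<close> consists of the annihilators \<open>F i\<close>.  A vector
  \<open>v\<close> of \<open>F (Suc i)\<close> acts on \<open>cut i\<close> through \<open>orbit_fn i\<close>, so it defines a linear form on the induced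
  module, that is, an element \<open>\<Theta> v\<close> of the Weyl module.
\<close>

lemma weyl_filtration_from_vectors:
  fixes M :: "('k::alg_closed_field, 'x \<Rightarrow> 'k) gmodule" and w :: "nat \<Rightarrow> 'x \<Rightarrow> 'k" and l :: "nat \<Rightarrow> nat"
  assumes M: "rational_module M" "scal M = fscal"
    and w: "\<And>i. i < m \<Longrightarrow> w i \<in> vecs M"
    and semi: "\<And>i \<theta> b. i < m \<Longrightarrow> \<theta> \<in> vecs (dual M) \<Longrightarrow> (\<And>j g. j < i \<Longrightarrow> g \<in> SL2 \<Longrightarrow> \<theta> (act M g (w j)) = 0)
      \<Longrightarrow> b \<in> borel2 \<Longrightarrow> \<theta> (act M (matrix_inv b) (w i)) = (b $ 1 $ 1) ^ l i * \<theta> (w i)"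
    and final: "\<And>\<theta>. \<theta> \<in> vecs (dual M) \<Longrightarrow> (\<And>j g. j < m \<Longrightarrow> g \<in> SL2 \<Longrightarrow> \<theta> (act M g (w j)) = 0) \<Longrightarrow> \<theta> = 0"
    and dims: "(\<Sum>i<m. l i + 1) \<le> fs.dim (vecs (dual M))"
    and B: "finite B" "vecs (dual M) \<subseteq> fs.span B"
    and sep: "\<And>v. v \<in> vecs M \<Longrightarrow> (\<And>\<theta>. \<theta> \<in> vecs (dual M) \<Longrightarrow> \<theta> v = 0) \<Longrightarrow> v = 0"
  shows "weyl_filtration M"
proof -
  note rf = rational_facts[OF M]
  note Mact = rational_act_closed[OF M(1)]
  have D: "\<theta> \<in> vecs (dual M) \<longleftrightarrow> linear_within (vecs M) fscal (*) \<theta> \<and> (\<forall>v. v \<notin> vecs M \<longrightarrow> \<theta> v = 0)" for \<theta>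
    by (simp add: dual_simps M(2))
  have actD: "act (dual M) g \<theta> v = \<theta> (act M (matrix_inv g) v)" if "v \<in> vecs M" for g \<theta> v
    using that by (simp add: dual_simps)
  have inv_iff: "(\<forall>g\<in>SL2. P (matrix_inv g)) \<longleftrightarrow> (\<forall>g\<in>SL2. P g)" for P :: "'k ^ 2 ^ 2 \<Rightarrow> bool"
    using matrix_inv_SL2(1) matrix_inv_SL2_inv by metis
  interpret functional_chain "vecs (dual M)" B "act (dual M)" "\<lambda>i \<theta>. \<theta> (w i)" l m
  proof
    show "fs.subspace (vecs (dual M))"
      unfolding fs.subspace_def by (auto simp: D linear_within_def algebra_simps)
    show "finite B" "vecs (dual M) \<subseteq> fs.span B" by (rule B)+
    show "act (dual M) g \<theta> \<in> vecs (dual M)" if "g \<in> SL2" "\<theta> \<in> vecs (dual M)" for g \<theta>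
    proof -
      have g: "matrix_inv g \<in> SL2" using that(1) by (rule matrix_inv_SL2)
      have 1: "v + v' \<in> vecs M" "fscal c v \<in> vecs M" if "v \<in> vecs M" "v' \<in> vecs M" for v v' c
        using that fs.subspace_add[OF rf(1)] fs.subspace_scale[OF rf(1)] by auto
      show ?thesis
        using that(2) rf(2)[OF g] Mact[OF g] 1
        unfolding D by (auto simp: linear_within_def actD dual_simps(3))
    qed
    show "linear_within (vecs (dual M)) fscal fscal (act (dual M) g)" for g
      by (auto simp: linear_within_def dual_simps fun_eq_iff)
    show "act (dual M) (g ** h) \<theta> = act (dual M) g (act (dual M) h \<theta>)"
      if gh: "g \<in> SL2" "h \<in> SL2" "\<theta> \<in> vecs (dual M)" for g h \<theta>
    proof
      fix v
      show "act (dual M) (g ** h) \<theta> v = act (dual M) g (act (dual M) h \<theta>) v"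
      proof (cases "v \<in> vecs M")
        case True
        note ig = matrix_inv_SL2(1)[OF gh(1)] and ih = matrix_inv_SL2(1)[OF gh(2)]
        show ?thesis
          using actD[OF True] actD[OF Mact[OF ig True]] rf(3)[OF ih ig True]
          by (simp add: matrix_inv_SL2_mult[OF gh(1,2)])
      qed (simp add: dual_simps)
    qed
    show "linear_within (vecs (dual M)) fscal (*) (\<lambda>\<theta>. \<theta> (w i))" for i
      by (simp add: linear_within_def)
    show "on_SL2 (\<lambda>g. act (dual M) g \<theta> (w i)) \<in> regular_functions" if "i < m" "\<theta> \<in> vecs (dual M)" for i \<theta>
    proof -
      have "on_SL2 (\<lambda>g. \<theta> (act M g (w i))) \<in> regular_functions"
        using rf(5) that w unfolding D by blast
      from regular_inverse[OF this]
      have "on_SL2 (\<lambda>x. on_SL2 (\<lambda>g. \<theta> (act M g (w i))) (matrix_inv x)) \<in> regular_functions" .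
      also have "on_SL2 (\<lambda>x. on_SL2 (\<lambda>g. \<theta> (act M g (w i))) (matrix_inv x)) = on_SL2 (\<lambda>g. act (dual M) g \<theta> (w i))"
        by (rule regular_on_SL2_cong) (simp add: on_SL2_def matrix_inv_SL2(1) actD[OF w[OF that(1)]])
      finally show ?thesis .
    qed
    have all: "\<theta> (act M g (w j)) = 0"
      if "j < m" "\<And>g. g \<in> SL2 \<Longrightarrow> act (dual M) g \<theta> (w j) = 0" "g \<in> SL2" for j g \<theta>
      using that(2)[OF matrix_inv_SL2(1)[OF that(3)]] actD[OF w[OF that(1)]] matrix_inv_SL2_inv[OF that(3)] by simp
    show "act (dual M) b \<theta> (w i) = (b $ 1 $ 1) ^ l i * \<theta> (w i)"
      if "i < m" "\<theta> \<in> vecs (dual M)" "\<And>j g. j < i \<Longrightarrow> g \<in> SL2 \<Longrightarrow> act (dual M) g \<theta> (w j) = 0" "b \<in> borel2" for i \<theta> b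
      unfolding actD[OF w[OF that(1)]] using all that by (intro semi) auto
    show "\<theta> = 0" if "\<theta> \<in> vecs (dual M)" "\<And>j g. j < m \<Longrightarrow> g \<in> SL2 \<Longrightarrow> act (dual M) g \<theta> (w j) = 0" for \<theta>
      using all that by (intro final) auto
  qed (rule dims)
  define F where "F i = {v \<in> vecs M. \<forall>\<theta>\<in>cut i. \<theta> v = 0}" for i
  have cutD: "linear_within (vecs M) fscal (*) \<theta>" if "\<theta> \<in> cut i" for \<theta> i
    using that cut_subset D by blast
  have F0: "\<theta> v = 0" if "\<theta> \<in> cut i" "v \<in> F i" for \<theta> v i using that unfolding F_def by blast
  have Fsub: "fs.subspace (F i)" for i
  proof (rule fs.subspaceI)
    have "\<theta> 0 = 0" if "\<theta> \<in> cut i" for \<theta>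
      using linear_within_zero[OF module_fscal module_mult rf(1) cutD[OF that]] .
    then show "0 \<in> F i" using fs.subspace_0[OF rf(1)] by (simp add: F_def)
    show "x + y \<in> F i" if xy: "x \<in> F i" "y \<in> F i" for x y
    proof -
      have "\<theta> (x + y) = 0" if "\<theta> \<in> cut i" for \<theta>
        using cutD[OF that] xy F0[OF that xy(1)] F0[OF that xy(2)] by (simp add: F_def linear_within_def)
      then show ?thesis using xy fs.subspace_add[OF rf(1)] by (simp add: F_def)
    qed
    show "fscal c x \<in> F i" if x: "x \<in> F i" for c x
    proof -
      have "\<theta> (fscal c x) = 0" if "\<theta> \<in> cut i" for \<theta>
        using cutD[OF that] x F0[OF that x] by (simp add: F_def linear_within_def)
      then show ?thesis using x fs.subspace_scale[OF rf(1)] by (simp add: F_def)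
    qed
  qed
  have Fact: "act M g v \<in> F i" if i: "i \<le> m" and g: "g \<in> SL2" and v: "v \<in> F i" for i g v
  proof -
    have vM: "v \<in> vecs M" using v by (simp add: F_def)
    have "\<theta> (act M g v) = 0" if "\<theta> \<in> cut i" for \<theta>
    proof -
      have "act (dual M) (matrix_inv g) \<theta> \<in> cut i" using cut_act[OF i matrix_inv_SL2(1)[OF g] that] .
      then have "act (dual M) (matrix_inv g) \<theta> v = 0" using v by (rule F0)
      then show ?thesis by (simp add: actD[OF vM] matrix_inv_SL2_inv[OF g])
    qed
    then show ?thesis using Mact[OF g vM] by (simp add: F_def)
  qed
  have Fmono: "F i \<subseteq> F (Suc i)" for i using cut_antimono[of i] by (auto simp: F_def)
  have FM: "F i \<subseteq> vecs M" for i by (auto simp: F_def)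
  have quot: "quotient_iso M (F (Suc i)) (F i) (weyl (l i))" if i: "i < m" for i
  proof -
    let ?N = "nabla (l i) :: ('k, 'k gfun) gmodule"
    have orb_add: "orbit_fn i (\<theta> + \<theta>') = orbit_fn i \<theta> + orbit_fn i \<theta>'"
      if "\<theta> \<in> vecs (dual M)" "\<theta>' \<in> vecs (dual M)" for \<theta> \<theta>'
      using orbit_fn_linear[OF i] that unfolding linear_within_def by blast
    have orb_scale: "orbit_fn i (fscal c \<theta>) = fscal c (orbit_fn i \<theta>)" if "\<theta> \<in> vecs (dual M)" for c \<theta>
      using orbit_fn_linear[OF i] that unfolding linear_within_def by blast
    have cD: "\<theta> \<in> vecs (dual M)" if "\<theta> \<in> cut i" for \<theta> using that cut_subset by blast
    define sec where "sec f = (SOME \<theta>. \<theta> \<in> cut i \<and> orbit_fn i \<theta> = f)" for f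
    have sec: "sec f \<in> cut i" "orbit_fn i (sec f) = f" if "f \<in> vecs ?N" for f
    proof -
      have "\<exists>\<theta>. \<theta> \<in> cut i \<and> orbit_fn i \<theta> = f" using that unfolding orbit_fn_onto[OF i, symmetric] by blast
      from someI_ex[OF this] show "sec f \<in> cut i" "orbit_fn i (sec f) = f" by (auto simp: sec_def)
    qed
    have orb_diff: "orbit_fn i (\<theta> - \<theta>') = orbit_fn i \<theta> - orbit_fn i \<theta>'" if "\<theta> \<in> cut i" "\<theta>' \<in> cut i" for \<theta> \<theta>'
    proof -
      have "orbit_fn i (\<theta> + fscal (- 1) \<theta>') = orbit_fn i \<theta> + fscal (- 1) (orbit_fn i \<theta>')"
        unfolding orb_add[OF cD[OF that(1)] fs.subspace_scale[OF V(1) cD[OF that(2)]]] orb_scale[OF cD[OF that(2)]] ..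
      then show ?thesis by simp
    qed
    \<comment> \<open>two functionals with the same image differ by an element of cut (Suc i), which kills F (Suc i)\<close>
    have indep: "\<theta> v = \<theta>' v" if "\<theta> \<in> cut i" "\<theta>' \<in> cut i" "orbit_fn i \<theta> = orbit_fn i \<theta>'" "v \<in> F (Suc i)" for \<theta> \<theta>' v
    proof -
      have c: "\<theta> - \<theta>' \<in> cut i" using fs.subspace_diff[OF cut_subspace that(1,2)] i by simp
      have "orbit_fn i (\<theta> - \<theta>') = 0" using orb_diff[OF that(1,2)] that(3) by simp
      then have "\<theta> - \<theta>' \<in> cut (Suc i)" using orbit_fn_eq_zero[OF i c] by blast
      then have "(\<theta> - \<theta>') v = 0" using that(4) by (rule F0)
      then show ?thesis by simp
    qed
    define \<Theta> where "\<Theta> v = (\<lambda>f. if f \<in> vecs ?N then sec f v else 0)" for v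
    have val: "\<Theta> v (orbit_fn i \<theta>) = \<theta> v" if "\<theta> \<in> cut i" "v \<in> F (Suc i)" for v \<theta>
    proof -
      have f: "orbit_fn i \<theta> \<in> vecs ?N" using orbit_fn_mem[OF i] that(1) by blast
      show ?thesis using indep[OF sec(1)[OF f] that(1) sec(2)[OF f] that(2)] f by (simp add: \<Theta>_def)
    qed
    have quotient: "quotient_map M (F (Suc i)) (F i) (weyl (l i)) \<Theta>"
      unfolding quotient_map_def M(2) weyl_simps(1)
    proof (intro conjI ballI allI)
      fix v assume v: "v \<in> F (Suc i)"
      show "\<Theta> v \<in> vecs (weyl (l i))"
        unfolding weyl_simps
      proof (intro conjI allI impI)
        show "\<Theta> v f = 0" if "f \<notin> vecs ?N" for f using that by (simp add: \<Theta>_def)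
        show "linear_within (vecs ?N) fscal (*) (\<Theta> v)"
          unfolding linear_within_def
        proof (intro conjI ballI allI)
          fix f h assume fh: "f \<in> vecs ?N" "h \<in> vecs ?N"
          note sf = sec[OF fh(1)] and sh = sec[OF fh(2)]
          have c: "sec f + sec h \<in> cut i" using fs.subspace_add[OF cut_subspace sf(1) sh(1)] i by simp
          have "orbit_fn i (sec f + sec h) = f + h"
            by (simp only: orb_add[OF cD[OF sf(1)] cD[OF sh(1)]] sf(2) sh(2))
          then have "\<Theta> v (f + h) = (sec f + sec h) v" using val[OF c v] by simp
          then show "\<Theta> v (f + h) = \<Theta> v f + \<Theta> v h" using fh by (simp add: \<Theta>_def)
        next
          fix x f assume f: "f \<in> vecs ?N"
          note sf = sec[OF f]
          have c: "fscal x (sec f) \<in> cut i" using fs.subspace_scale[OF cut_subspace sf(1)] i by simp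
          have "orbit_fn i (fscal x (sec f)) = fscal x f"
            by (simp only: orb_scale[OF cD[OF sf(1)]] sf(2))
          then have "\<Theta> v (fscal x f) = fscal x (sec f) v" using val[OF c v] by simp
          then show "\<Theta> v (fscal x f) = x * \<Theta> v f" using f by (simp add: \<Theta>_def)
        qed
      qed
    next
      fix v v' assume v: "v \<in> F (Suc i)" "v' \<in> F (Suc i)"
      show "\<Theta> (v + v') = \<Theta> v + \<Theta> v'"
      proof
        fix f
        show "\<Theta> (v + v') f = (\<Theta> v + \<Theta> v') f"
          using cutD[OF sec(1)[of f]] v FM[of "Suc i"] by (auto simp: \<Theta>_def linear_within_def subset_iff)
      qed
    next
      fix x v assume v: "v \<in> F (Suc i)"
      show "\<Theta> (fscal x v) = fscal x (\<Theta> v)"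
      proof
        fix f
        show "\<Theta> (fscal x v) f = fscal x (\<Theta> v) f"
          using cutD[OF sec(1)[of f]] v FM[of "Suc i"] by (auto simp: \<Theta>_def linear_within_def subset_iff)
      qed
    next
      fix g :: "'k ^ 2 ^ 2" and v assume g: "g \<in> SL2" and v: "v \<in> F (Suc i)"
      have ig: "matrix_inv g \<in> SL2" using g by (rule matrix_inv_SL2)
      have vM: "v \<in> vecs M" using FM v by blast
      show "\<Theta> (act M g v) = act (weyl (l i)) g (\<Theta> v)"
      proof
        fix f
        show "\<Theta> (act M g v) f = act (weyl (l i)) g (\<Theta> v) f"
        proof (cases "f \<in> vecs ?N")
          case True
          note sf = sec[OF True]
          have c: "act (dual M) (matrix_inv g) (sec f) \<in> cut i" using cut_act[OF _ ig sf(1)] i by simp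
          have "orbit_fn i (act (dual M) (matrix_inv g) (sec f)) = act ?N (matrix_inv g) f"
            using orbit_fn_act[OF ig, of "sec f" i] sf cut_subset by auto
          then have "\<Theta> v (act ?N (matrix_inv g) f) = act (dual M) (matrix_inv g) (sec f) v" using val[OF c v] by simp
          also have "\<dots> = \<Theta> (act M g v) f" using True by (simp add: actD[OF vM] matrix_inv_SL2_inv[OF g] \<Theta>_def)
          finally show ?thesis using True by (simp add: weyl_simps)
        qed (simp add: \<Theta>_def weyl_simps)
      qed
    next
      fix v assume v: "v \<in> F (Suc i)"
      show "\<Theta> v = 0 \<longleftrightarrow> v \<in> F i"
      proof
        assume z: "\<Theta> v = 0"
        have "\<theta> v = 0" if "\<theta> \<in> cut i" for \<theta> using val[OF that v] z by simp
        then show "v \<in> F i" using v FM by (auto simp: F_def)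
      next
        assume "v \<in> F i"
        then show "\<Theta> v = 0" using F0[OF sec(1)] by (auto simp: \<Theta>_def fun_eq_iff)
      qed
    next
      \<comment> \<open>translates of w i map to evaluations at group elements, and these span the Weyl module\<close>
      fix \<eta> :: "'k gfun \<Rightarrow> 'k" assume \<eta>: "\<eta> \<in> vecs (weyl (l i))"
      let ?e = "\<lambda>q. act M (matrix_inv (row_point q)) (w i)"
      have rp: "row_point q \<in> SL2" for q :: 'k by simp
      have eM: "?e q \<in> vecs M" for q by (rule Mact[OF matrix_inv_SL2(1)[OF rp] w[OF i]])
      have eF: "?e q \<in> F (Suc i)" for q
      proof -
        have "\<theta> (?e q) = 0" if "\<theta> \<in> cut (Suc i)" for \<theta>
        proof -
          have "act (dual M) (row_point q) \<theta> (w i) = 0" using that rp[of q] by (auto simp: cut_def)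
          then show ?thesis by (simp add: actD[OF w[OF i]])
        qed
        then show ?thesis using eM by (simp add: F_def)
      qed
      let ?K = "\<lambda>k. fst (interp (l i) k :: 'k set \<times> ('k \<Rightarrow> 'k))" and ?\<kappa> = "\<lambda>k. snd (interp (l i) k :: 'k set \<times> ('k \<Rightarrow> 'k))"
      define v where "v = (\<Sum>k\<le>l i. \<Sum>q\<in>?K k. fscal (\<eta> (monomial_fn (l i) k) * ?\<kappa> k q) (?e q))"
      have vF: "v \<in> F (Suc i)" unfolding v_def
        by (intro fs.subspace_sum[OF Fsub] fs.subspace_scale[OF Fsub] eF)
      have "\<Theta> v f = \<eta> f" for f
      proof (cases "f \<in> vecs ?N")
        case True
        have ev: "sec f (?e q) = f (row_point q)" for q
        proof -
          have "sec f (?e q) = orbit_fn i (sec f) (row_point q)"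
            using rp[of q] by (simp add: orbit_fn_def on_SL2_def actD[OF w[OF i]])
          then show ?thesis using sec(2)[OF True] by simp
        qed
        have lin: "linear_within (vecs M) fscal (*) (sec f)" by (rule cutD[OF sec(1)[OF True]])
        have "sec f v = (\<Sum>k\<le>l i. \<Sum>q\<in>?K k. \<eta> (monomial_fn (l i) k) * ?\<kappa> k q * sec f (?e q))"
        proof -
          have "v = (\<Sum>k\<le>l i. fscal 1 (\<Sum>q\<in>?K k. fscal (\<eta> (monomial_fn (l i) k) * ?\<kappa> k q) (?e q)))"
            by (simp add: v_def)
          then have "sec f v = (\<Sum>k\<le>l i. 1 * sec f (\<Sum>q\<in>?K k. fscal (\<eta> (monomial_fn (l i) k) * ?\<kappa> k q) (?e q)))"
            by (simp only:) (rule linear_within_sum[OF module_fscal module_mult rf(1) lin],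
              auto intro!: fs.subspace_sum[OF rf(1)] fs.subspace_scale[OF rf(1)] eM)
          also have "\<dots> = (\<Sum>k\<le>l i. \<Sum>q\<in>?K k. \<eta> (monomial_fn (l i) k) * ?\<kappa> k q * sec f (?e q))"
            unfolding mult_1 by (intro sum.cong refl linear_within_sum[OF module_fscal module_mult rf(1) lin] interp(1) eM)
          finally show ?thesis .
        qed
        also have "\<dots> = (\<Sum>k\<le>l i. coord (l i) k f * \<eta> (monomial_fn (l i) k))"
          unfolding ev coord_def sum_distrib_right by (intro sum.cong refl) (simp add: mult_ac)
        also have "\<dots> = \<eta> (\<Sum>k\<le>l i. fscal (coord (l i) k f) (monomial_fn (l i) k))"
          using \<eta> by (intro linear_within_sum[OF module_fscal module_mult nabla_subspace, symmetric])
            (auto simp: weyl_simps intro: monomial_fn_nabla)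
        also have "\<dots> = \<eta> f" by (simp only: nabla_expansion[OF True, symmetric])
        finally show ?thesis using True by (simp add: \<Theta>_def)
      qed (use \<eta> in \<open>simp add: \<Theta>_def weyl_simps\<close>)
      then show "\<exists>v\<in>F (Suc i). \<Theta> v = \<eta>" using vF by blast
    qed
    show ?thesis
    proof (rule quotient_map_imp_iso[OF quotient])
      show "act M g v \<in> F (Suc i)" if "g \<in> SL2" "v \<in> F (Suc i)" for g v using Fact[of "Suc i"] that i by simp
    qed (use Fsub Fmono in \<open>simp_all add: M(2) module_fscal\<close>)
  qed
  show ?thesis
    unfolding weyl_filtration_def filtration_with_def
  proof (intro exI[of _ m] exI[of _ F] conjI allI impI)
    show "F 0 = {0}" using sep fs.subspace_0[OF Fsub[of 0]] unfolding F_def cut_0 by auto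
    have "v \<in> F m" if "v \<in> vecs M" for v using that by (simp add: F_def cut_m)
    then show "F m = vecs M" using FM by blast
    show "submodule_of (F i) M" if "i \<le> m" for i
      unfolding submodule_of_def M(2) using Fsub FM Fact[OF that] by blast
    show "F i \<subseteq> F (Suc i)" for i by (rule Fmono)
    show "F (Suc i) = F i \<or> (\<exists>u. quotient_iso M (F (Suc i)) (F i) (weyl u))" if "i < m" for i
      using quot[OF that] by blast
  qed
qed

text \<open>
  The highest weights \<open>r + s - 2 i\<close> account for the whole dimension of the tensor product.
\<close>

lemma sum_highest_weights:
  fixes r s :: nat
  shows "(\<Sum>i<min r s + 1. r + s - 2 * i + 1) = (r + 1) * (s + 1)"
proof -
  have "(\<Sum>i<n. r + s - 2 * i + 1) = n * (r + s + 2 - n)" if "n \<le> min r s + 1" for n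
    using that
  proof (induction n)
    case (Suc n)
    then have "2 * n \<le> r + s" by simp
    then obtain e where e: "r + s = 2 * n + e" using le_Suc_ex by blast
    from Suc show ?case by (simp add: e algebra_simps)
  qed simp
  from this[of "min r s + 1"] show ?thesis
    by (cases "r \<le> s") (simp_all add: min_def algebra_simps)
qed

lemma dim_nabla_tensor: "(r + 1) * (s + 1) \<le> fs.dim (vecs (nabla_tensor r s :: ('k::alg_closed_field, _) gmodule))"
proof -
  let ?X = "nabla_tensor r s :: ('k, _) gmodule"
  have "card ({..r} \<times> {..s}) \<le> fs.dim (vecs ?X)"
  proof (rule independent_by_coordinates[where e = "\<lambda>(a, b) t. t (coord_form r s a b)" and x = "\<lambda>(a, b). basis_tensor r s a b"])
    show "finite ((\<lambda>(a, b). basis_tensor r s a b) ` ({..r} \<times> {..s}) :: 'k tfun set)"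
      by simp
    show "vecs ?X \<subseteq> fs.span ((\<lambda>(a, b). basis_tensor r s a b) ` ({..r} \<times> {..s}))"
      by (simp add: nabla_tensor_finite_span)
  qed (auto simp: basis_tensor_coord_form intro: basis_tensor_mem split: if_splits)
  then show ?thesis by (simp add: card_cartesian_product)
qed

section \<open>The good filtration\<close>

lemma coord_top:
  fixes f :: "'k::alg_closed_field gfun"
  assumes f: "f \<in> vecs (nabla r)"
  shows "coord r r f = f (mat 1)"
proof -
  have "f (mat 1) = (\<Sum>i\<le>r. coord r i f * monomial_fn r i (mat 1))"
    using arg_cong[OF nabla_expansion[OF f], of "\<lambda>f. f (mat 1)"] by (simp add: sum_fun_apply)
  also have "\<dots> = (\<Sum>i\<le>r. if i = r then coord r r f else 0)"
  proof (intro sum.cong refl)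
    have one: "(mat 1 :: 'k ^ 2 ^ 2) $ 1 $ 1 = 1" "(mat 1 :: 'k ^ 2 ^ 2) $ 1 $ 2 = 0" by (simp_all add: mat_def)
    fix i assume "i \<in> {..r}"
    then show "coord r i f * monomial_fn r i (mat 1) = (if i = r then coord r r f else 0)"
      unfolding monomial_fn_def on_SL2_def one by (simp add: power_0_left)
  qed
  finally show ?thesis by simp
qed

lemma act_lower_coord:
  fixes t :: "'k::alg_closed_field tfun" and g :: "'k ^ 2 ^ 2"
  defines "L \<equiv> \<lambda>r a i. of_nat (a choose i) * (g $ 1 $ 1 ^ i * g $ 2 $ 1 ^ (a - i) * g $ 2 $ 2 ^ (r - a))"
  assumes t: "t \<in> vecs (nabla_tensor r s)" and g: "g \<in> SL2" "g $ 1 $ 2 = 0" and kl: "k \<le> r" "l \<le> s"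
  shows "act (nabla_tensor r s) g t (coord_form r s k l) = (\<Sum>a\<le>r. \<Sum>c\<le>s. t (coord_form r s a c) * (L r a k * L s c l))"
proof -
  let ?X = "nabla_tensor r s :: ('k, _) gmodule"
  let ?cf = "coord_form r s k l :: 'k gfun \<Rightarrow> _"
  have lin: "linear_within (vecs ?X) fscal (*) (\<lambda>t. act ?X g t ?cf)"
    by (simp add: linear_within_def act_tensor)
  have "act ?X g (basis_tensor r s a c) ?cf = L r a k * L s c l" if ac: "a \<le> r" "c \<le> s" for a c
  proof -
    have "act ?X g (basis_tensor r s a c) ?cf = (\<Sum>i\<le>r. \<Sum>j\<le>s. L r a i * L s c j * basis_tensor r s i j ?cf)"
      by (subst act_basis_tensor[OF g(1) act_monomial_lower[OF g ac(1)] act_monomial_lower[OF g ac(2)]])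
        (simp add: sum_fun_apply L_def)
    also have "\<dots> = (\<Sum>i\<le>r. \<Sum>j\<le>s. if j = l then (if i = k then L r a k * L s c l else 0) else 0)"
      by (intro sum.cong refl) (simp add: basis_tensor_coord_form)
    also have "\<dots> = L r a k * L s c l" using kl by simp
    finally show ?thesis .
  qed
  then show ?thesis unfolding nabla_tensor_linear_expansion[OF lin t] by simp
qed

lemma torus_power_cancel:
  assumes "x * y = (1 :: 'k::field)" "i \<le> r" "i \<le> s"
  shows "x ^ r * (x ^ (s - i) * y ^ i) = x ^ (r + s - 2 * i)"
proof -
  have "x ^ r = x ^ (r - i) * x ^ i" using assms by (simp flip: power_add)
  then have "x ^ r * (x ^ (s - i) * y ^ i) = x ^ (r - i) * x ^ (s - i) * (x * y) ^ i"
    by (simp only: power_mult_distrib mult_ac)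
  also have "\<dots> = x ^ (r - i + (s - i))" unfolding assms(1) by (simp only: power_add power_one mult_1_right)
  also have "r - i + (s - i) = r + s - 2 * i" using assms by simp
  finally show ?thesis .
qed

text \<open>
  The functionals take the coefficient of order \<open>j\<close> of the second factor at the point \<open>(1, 0)\<close> of the
  projective line, which is fixed by the Borel subgroup, and the value of the first factor there.  If
  they all vanish on every translate of \<open>t\<close>, then the evaluation of the first factor at any point
  annihilates \<open>t\<close>, so \<open>t = 0\<close>.
\<close>

lemma good_filtration_nabla_tensor_le:
  assumes sr: "s \<le> r"
  shows "good_filtration (nabla_tensor r s :: ('k::alg_closed_field, _) gmodule)"
proof -
  let ?X = "nabla_tensor r s :: ('k, _) gmodule"
  show ?thesis
  proof (rule good_filtration_from_functionals[where \<xi> = "\<lambda>j t. t (coord_form r s r (s - j))" and l = "\<lambda>j. r + s - 2 * j" and m = "s + 1"])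
    show "rational_module ?X" by (rule rational_nabla_tensor)
    show "scal ?X = fscal" by simp
    show "linear_within (vecs ?X) fscal (*) (\<lambda>t. t (coord_form r s r (s - i)))" for i
      by (simp add: linear_within_def)
    have "(\<Sum>i<s + 1. r + s - 2 * i + 1) = (r + 1) * (s + 1)"
      using sum_highest_weights[of r s] unfolding min_absorb2[OF sr] .
    then show "(\<Sum>i<s + 1. r + s - 2 * i + 1) \<le> fs.dim (vecs ?X)" using dim_nabla_tensor[of r s, where 'k='k] by simp
  next
    fix i t and b :: "'k ^ 2 ^ 2"
    assume i: "i < s + 1" and t: "t \<in> vecs ?X" and b: "b \<in> borel2"
      and z: "\<And>j g. j < i \<Longrightarrow> g \<in> SL2 \<Longrightarrow> act ?X g t (coord_form r s r (s - j)) = 0"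
    have bS: "b \<in> SL2" "b $ 1 $ 2 = 0" using b by (auto simp: borel2_def)
    have det: "b $ 1 $ 1 * b $ 2 $ 2 = 1" using SL2_det[OF bS(1)] bS(2) by simp
    have t0: "t (coord_form r s r c) = 0" if "s - i < c" "c \<le> s" for c
      using z[of "s - c" "mat 1"] that by (simp add: act_nabla_tensor_one)
    let ?L = "\<lambda>r a i. of_nat (a choose i) * (b $ 1 $ 1 ^ i * b $ 2 $ 1 ^ (a - i) * b $ 2 $ 2 ^ (r - a)) :: 'k"
    have "act ?X b t (coord_form r s r (s - i)) = (\<Sum>a\<le>r. \<Sum>c\<le>s. t (coord_form r s a c) * (?L r a r * ?L s c (s - i)))"
      by (rule act_lower_coord[OF t bS]) auto
    also have "\<dots> = (\<Sum>a\<le>r. \<Sum>c\<le>s. if c = s - i then (if a = r then t (coord_form r s r (s - i)) * (?L r r r * ?L s (s - i) (s - i)) else 0) else 0)"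
    proof (intro sum.cong refl)
      fix a c assume ac: "a \<in> {..r}" "c \<in> {..s}"
      consider "a \<noteq> r" | "a = r" "c < s - i" | "a = r" "c = s - i" | "a = r" "s - i < c" by linarith
      then show "t (coord_form r s a c) * (?L r a r * ?L s c (s - i))
         = (if c = s - i then (if a = r then t (coord_form r s r (s - i)) * (?L r r r * ?L s (s - i) (s - i)) else 0) else 0)"
        by cases (use ac t0 in \<open>auto simp: binomial_eq_0\<close>)
    qed
    also have "\<dots> = t (coord_form r s r (s - i)) * (?L r r r * ?L s (s - i) (s - i))"
      by simp
    also have "?L r r r * ?L s (s - i) (s - i) = b $ 1 $ 1 ^ r * (b $ 1 $ 1 ^ (s - i) * b $ 2 $ 2 ^ i)"
      using i by simp
    also have "\<dots> = b $ 1 $ 1 ^ (r + s - 2 * i)"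
      using i sr by (intro torus_power_cancel det) auto
    finally show "act ?X b t (coord_form r s r (s - i)) = b $ 1 $ 1 ^ (r + s - 2 * i) * t (coord_form r s r (s - i))"
      by (simp add: mult.commute)
  next
    fix t assume t: "t \<in> vecs ?X"
      and z: "\<And>j g. j < s + 1 \<Longrightarrow> g \<in> SL2 \<Longrightarrow> act ?X g t (coord_form r s r (s - j)) = 0"
    have yz: "(\<Sum>a\<le>r. t (coord_form r s a c) * q ^ a) = 0" if c: "c \<le> s" for c q
    proof -
      let ?g = "row_point q :: 'k ^ 2 ^ 2"
      have g: "?g \<in> SL2" by simp
      \<comment> \<open>y lists the coordinates of t evaluated at q in the first factor\<close>
      define y where "y c = (\<Sum>a\<le>r. t (coord_form r s a c) * q ^ a)" for c
      define h where "h = (\<Sum>c\<le>s. fscal (y c) (monomial_fn s c :: 'k gfun))"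
      have hN: "h \<in> vecs (nabla s)" unfolding h_def
        by (intro fs.subspace_sum[OF nabla_subspace] fs.subspace_scale[OF nabla_subspace] monomial_fn_nabla) simp
      have ghN: "act (nabla s) ?g h \<in> vecs (nabla s)" by (rule act_nabla_closed[OF hN g])
      have gh: "act (nabla s) ?g h = (\<Sum>c\<le>s. fscal (y c) (act (nabla s) ?g (monomial_fn s c)))"
        by (simp add: h_def act_nabla fun_eq_iff sum_fun_apply)
      have "coord s l (act (nabla s) ?g h) = 0" if l: "l \<le> s" for l
      proof -
        have lin: "linear_within (vecs ?X) fscal (*) (\<lambda>t. act ?X ?g t (coord_form r s r l))"
          by (simp add: linear_within_def act_tensor)
        have top: "coord r r (act (nabla r) ?g (monomial_fn r a)) = q ^ a" if "a \<le> r" for a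
          using that by (simp add: coord_top act_nabla_closed monomial_fn_nabla) (simp add: act_nabla monomial_fn_def on_SL2_def)
        have "act ?X ?g (basis_tensor r s a c) (coord_form r s r l) = q ^ a * coord s l (act (nabla s) ?g (monomial_fn s c))"
          if "a \<le> r" for a c
          unfolding basis_tensor_def act_tensor_pure_tensor[OF rational_nabla rational_nabla g] pure_tensor_coord_form
          by (simp add: top that)
        then have "act ?X ?g t (coord_form r s r l)
            = (\<Sum>a\<le>r. \<Sum>c\<le>s. t (coord_form r s a c) * (q ^ a * coord s l (act (nabla s) ?g (monomial_fn s c))))"
          unfolding nabla_tensor_linear_expansion[OF lin t] by simp
        also have "\<dots> = (\<Sum>c\<le>s. \<Sum>a\<le>r. t (coord_form r s a c) * (q ^ a * coord s l (act (nabla s) ?g (monomial_fn s c))))"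
          by (rule sum.swap)
        also have "\<dots> = (\<Sum>c\<le>s. y c * coord s l (act (nabla s) ?g (monomial_fn s c)))"
          by (simp add: y_def sum_distrib_right mult.assoc)
        also have "\<dots> = coord s l (act (nabla s) ?g h)"
          unfolding gh by (rule coord_sum[symmetric]) simp
        finally show ?thesis using z[of "s - l" ?g] g l by simp
      qed
      then have "(\<Sum>l\<le>s. fscal (coord s l (act (nabla s) ?g h)) (monomial_fn s l)) = 0" by simp
      then have "act (nabla s) ?g h = 0" by (simp only: nabla_expansion[OF ghN, symmetric])
      then have "h (x ** matrix_inv ?g ** ?g) = 0" for x by (simp add: act_nabla fun_eq_iff)
      then have "h x = 0" for x using matrix_inv_SL2(3)[OF g] by (simp flip: matrix_mul_assoc)
      then have "coord s c h = 0" by (simp add: coord_def)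
      moreover have "coord s c h = (\<Sum>d\<le>s. y d * coord s c (monomial_fn s d :: 'k gfun))"
        unfolding h_def by (rule coord_sum) simp
      moreover have "\<dots> = (\<Sum>d\<le>s. if d = c then y c else 0)"
        by (intro sum.cong refl) (auto simp: coord_monomial)
      ultimately have "y c = 0" using c by simp
      then show ?thesis by (simp add: y_def)
    qed
    show "t = 0"
    proof (rule nabla_tensor_eqI[OF t fs.subspace_0[OF tensor_subspace]])
      fix a c assume "a \<le> r" "c \<le> s"
      then show "t (coord_form r s a c) = 0 (coord_form r s a c)" using poly_coeffs_zero[OF yz] by simp
    qed
  qed
qed

section \<open>The Weyl filtration\<close>

text \<open>
  The vectors \<open>?B 0 j\<close> with \<open>j \<le> min r s\<close> generate: \<open>P \<theta>\<close> says that \<open>\<theta>\<close> vanishes on all their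
  translates, and it is shown degree by degree that such a \<open>\<theta>\<close> is zero.
\<close>

lemma weyl_filtration_nabla_tensor_steinberg:
  fixes a n r s :: nat
  assumes p: "prime CHAR('k::alg_closed_field)" and a: "1 \<le> a" "a < CHAR('k)"
    and r: "r + 1 = a * CHAR('k) ^ n" and s: "s < CHAR('k) ^ (n + 1)"
  shows "weyl_filtration (nabla_tensor r s :: ('k, _) gmodule)"
proof -
  let ?X = "nabla_tensor r s :: ('k, _) gmodule"
  let ?B = "\<lambda>i j. basis_tensor r s i j :: 'k tfun"
  define m where "m = min r s"
  define P where "P \<theta> \<longleftrightarrow> linear_within (vecs ?X) fscal (*) \<theta> \<and> (\<forall>j\<le>m. \<forall>g\<in>SL2. \<theta> (act ?X g (?B 0 j)) = 0)" for \<theta>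
  have Xact: "act ?X g t \<in> vecs ?X" if "g \<in> SL2" "t \<in> vecs ?X" for g t
    using act_tensor_closed[OF rational_nabla rational_nabla that] .
  have Ptr: "P (\<lambda>t. \<theta> (act ?X h t))" if \<theta>: "P \<theta>" and h: "h \<in> SL2" for \<theta> h
    unfolding P_def
  proof (intro conjI allI impI ballI)
    show "linear_within (vecs ?X) fscal (*) (\<lambda>t. \<theta> (act ?X h t))"
      using \<theta> act_tensor_linear[of "vecs ?X" "nabla r" "nabla s" h] Xact[OF h] by (simp add: P_def linear_within_def)
    show "\<theta> (act ?X h (act ?X g (?B 0 j))) = 0" if "j \<le> m" "g \<in> SL2" for j g
      using \<theta> that h SL2_mult[OF h that(2)] unfolding act_nabla_tensor_mult[symmetric] P_def by blast
  qed
  have val: "\<theta> (act ?X g (?B i j)) = (\<Sum>k\<le>r. \<Sum>l\<le>s. x k * y l * \<theta> (?B k l))"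
    if "P \<theta>" "g \<in> SL2" "act (nabla r) g (monomial_fn r i) = (\<Sum>k\<le>r. fscal (x k) (monomial_fn r k))"
      "act (nabla s) g (monomial_fn s j) = (\<Sum>l\<le>s. fscal (y l) (monomial_fn s l))" for \<theta> g i j x y
    unfolding act_basis_tensor[OF that(2-4)]
    by (rule nabla_tensor_linear_value) (use that(1) in \<open>simp add: P_def\<close>)
  \<comment> \<open>upper unipotent matrices raise the degree; for fixed degree their coefficients form a triangular system whose diagonal entries r choose k are invertible\<close>
  have low: "\<theta> (?B k l) = 0" if \<theta>: "P \<theta>" and "k \<le> r" "l \<le> s" "k + l \<le> m \<or> m = s" for \<theta> k l
    using that(2-4)
  proof (induction k arbitrary: l rule: less_induct)
    case (less k)
    have lm: "l \<le> m" using less.prems by auto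
    let ?M = "\<lambda>k' l'. if l \<le> l' then of_nat (r choose k') * of_nat ((s - l) choose (l' - l)) * \<theta> (?B k' l') else 0"
    have "(\<Sum>k'\<le>r. \<Sum>l'\<le>s. ?M k' l' * h ^ (k' + (l' - l))) = 0" for h
    proof -
      let ?g = "mat2 1 h 0 1 :: 'k ^ 2 ^ 2"
      have g: "?g \<in> SL2" by simp
      have gm: "act (nabla r) ?g (monomial_fn r 0) = (\<Sum>i\<le>r. fscal (of_nat (r choose i) * h ^ i) (monomial_fn r i))"
        "act (nabla s) ?g (monomial_fn s l) = (\<Sum>i\<le>s. fscal (if l \<le> i then of_nat ((s - l) choose (i - l)) * h ^ (i - l) else 0) (monomial_fn s i))"
        using act_monomial_upper[OF g, of 0 r] act_monomial_upper[OF g, of l s] less.prems by (simp_all cong: if_cong)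
      have "0 = \<theta> (act ?X ?g (?B 0 l))" using \<theta> lm g by (simp add: P_def)
      also have "\<dots> = (\<Sum>k'\<le>r. \<Sum>l'\<le>s. ?M k' l' * h ^ (k' + (l' - l)))"
        unfolding val[OF \<theta> g gm] by (intro sum.cong refl) (simp add: power_add mult_ac)
      finally show ?thesis ..
    qed
    from double_poly_zero[OF this, of k]
    have "0 = (\<Sum>k'\<le>r. \<Sum>l'\<le>s. if k' + (l' - l) = k then ?M k' l' else 0)" ..
    also have "\<dots> = (\<Sum>k'\<le>r. \<Sum>l'\<le>s. if l' = l then (if k' = k then of_nat (r choose k) * \<theta> (?B k l) else 0) else 0)"
    proof (intro sum.cong refl)
      fix k' l' assume kl: "k' \<in> {..r}" "l' \<in> {..s}"
      have "\<theta> (?B k' l') = 0" if "l < l'" "k' + (l' - l) = k"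
        using that kl less.prems by (intro less.IH) auto
      then show "(if k' + (l' - l) = k then ?M k' l' else 0) = (if l' = l then (if k' = k then of_nat (r choose k) * \<theta> (?B k l) else 0) else 0)"
        by auto
    qed
    also have "\<dots> = of_nat (r choose k) * \<theta> (?B k l)" using less.prems by simp
    finally have "of_nat (r choose k) * \<theta> (?B k l) = 0" ..
    moreover have "(of_nat (r choose k) :: 'k) \<noteq> 0"
      using choose_steinberg_nonzero[OF p a, of k n] less.prems(1) r
      by (metis Suc_eq_plus1 diff_Suc_1 le_imp_less_Suc)
    ultimately show ?case by simp
  qed
  have zero: "\<theta> (?B k l) = 0" if \<theta>: "P \<theta>" and kl: "k \<le> r" "l \<le> s" for \<theta> k l
  proof (cases "s \<le> r \<or> k + l \<le> r")
    case True
    then show ?thesis using kl by (intro low[OF \<theta>]) (auto simp: m_def)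
  next
    case False
    then have rs: "r < s" and klr: "r < k + l" by auto
    \<comment> \<open>the Weyl element exchanges low and high degrees\<close>
    have high: "\<theta> (?B k l) = 0" if \<theta>: "P \<theta>" and kl: "k \<le> r" "l \<le> s" "s \<le> k + l" for \<theta> k l
    proof -
      have w: "(row_point 0 :: 'k ^ 2 ^ 2) \<in> SL2" by simp
      have "\<theta> (act ?X (row_point 0) (?B (r - k) (s - l))) = 0"
        using kl rs by (intro low[OF Ptr[OF \<theta> w]]) (auto simp: m_def)
      moreover have "act ?X (row_point 0) (?B (r - k) (s - l)) = fscal ((- 1) ^ (r - k + (s - l))) (?B k l)"
        using act_basis_tensor_weyl_element[of "r - k" r "s - l" s, where 'k='k] kl by simp
      moreover have "\<theta> (fscal x (?B k l)) = x * \<theta> (?B k l)" for x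
        using \<theta> basis_tensor_mem[OF kl(1,2)] unfolding P_def linear_within_def by blast
      ultimately show ?thesis by simp
    qed
    \<comment> \<open>descending induction on the degree D between r and s: since all translates of \<theta> vanish in higher degrees, \<theta> restricted to degree D is a translation-invariant form\<close>
    have "\<theta> (?B k l) = 0" if "P \<theta>" "k \<le> r" "l \<le> s" "r < k + l" "s \<le> k + l + d" for \<theta> k l d
      using that
    proof (induction d arbitrary: \<theta> k l)
      case 0 then show ?case by (intro high) auto
    next
      case (Suc d)
      show ?case
      proof (cases "s \<le> k + l + d")
        case True then show ?thesis using Suc by blast
      next
        case False
        define D where "D = k + l"
        have D: "r < D" "D < s" using Suc.prems False by (auto simp: D_def)
        have "translation_form r s D (\<lambda>i. \<theta> (?B i (D - i)))"
          unfolding translation_form_def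
        proof (intro allI impI)
          fix x y assume xy: "x \<le> r" "y \<le> s" "D < x + y"
          let ?M = "\<lambda>i j. of_nat (x choose i) * of_nat (y choose j) * \<theta> (?B i j)"
          have "(\<Sum>i\<le>r. \<Sum>j\<le>s. ?M i j * h ^ (x - i + (y - j))) = 0" for h
          proof -
            have g: "(lower_elt h :: 'k ^ 2 ^ 2) \<in> SL2" by simp
            have gm: "act (nabla r) (lower_elt h) (monomial_fn r x) = (\<Sum>i\<le>r. fscal (of_nat (x choose i) * h ^ (x - i)) (monomial_fn r i))"
              "act (nabla s) (lower_elt h) (monomial_fn s y) = (\<Sum>i\<le>s. fscal (of_nat (y choose i) * h ^ (y - i)) (monomial_fn s i))"
              using act_monomial_lower[OF g _ xy(1)] act_monomial_lower[OF g _ xy(2)] by simp_all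
            have "0 = \<theta> (act ?X (lower_elt h) (?B x y))"
              using xy Suc.prems D_def False by (intro Suc.IH[OF Ptr[OF Suc.prems(1) g], symmetric]) auto
            also have "\<dots> = (\<Sum>i\<le>r. \<Sum>j\<le>s. ?M i j * h ^ (x - i + (y - j)))"
              unfolding val[OF Suc.prems(1) g gm] by (intro sum.cong refl) (simp add: power_add mult_ac)
            finally show ?thesis ..
          qed
          from double_poly_zero[OF this, of "x + y - D"]
          have "0 = (\<Sum>i\<le>r. \<Sum>j\<le>s. if x - i + (y - j) = x + y - D then ?M i j else 0)" ..
          also have "\<dots> = (\<Sum>i\<le>r. \<Sum>j\<le>s. if i + j = D then ?M i j else 0)"
          proof (intro sum.cong refl)
            fix i j
            show "(if x - i + (y - j) = x + y - D then ?M i j else 0) = (if i + j = D then ?M i j else 0)"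
            proof (cases "i \<le> x \<and> j \<le> y")
              case True
              then have "x - i + (y - j) = x + y - D \<longleftrightarrow> i + j = D" using xy by auto
              then show ?thesis by simp
            qed (auto simp: binomial_eq_0)
          qed
          also have "\<dots> = (\<Sum>i\<le>D. of_nat (x choose i) * of_nat (y choose (D - i)) * \<theta> (?B i (D - i)))"
            by (rule antidiagonal_sum[OF xy(1,2)])
          finally show "(\<Sum>i\<le>D. of_nat (x choose i) * of_nat (y choose (D - i)) * \<theta> (?B i (D - i))) = 0" ..
        qed
        from translation_form_steinberg_zero[OF p a r D s this Suc.prems(2)]
        show ?thesis by (simp add: D_def)
      qed
    qed
    from this[OF \<theta> kl klr, of s] show ?thesis by simp
  qed
  have D: "\<theta> \<in> vecs (dual ?X) \<longleftrightarrow> linear_within (vecs ?X) fscal (*) \<theta> \<and> (\<forall>v. v \<notin> vecs ?X \<longrightarrow> \<theta> v = 0)" for \<theta>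
    by (simp add: dual_simps)
  define dc where "dc = (\<lambda>(k, l) v. if v \<in> vecs ?X then v (coord_form r s k l) else 0)"
  have dcD: "dc kl \<in> vecs (dual ?X)" for kl
    using fs.subspace_add[OF tensor_subspace[of "nabla r :: ('k, _) gmodule" "nabla s"]]
      fs.subspace_scale[OF tensor_subspace[of "nabla r :: ('k, _) gmodule" "nabla s"]]
    by (cases kl) (simp add: D dc_def linear_within_def)
  have expand: "\<theta> = (\<Sum>kl\<in>{..r} \<times> {..s}. fscal (\<theta> (?B (fst kl) (snd kl))) (dc kl))" if \<theta>: "\<theta> \<in> vecs (dual ?X)" for \<theta>
  proof
    fix v
    show "\<theta> v = (\<Sum>kl\<in>{..r} \<times> {..s}. fscal (\<theta> (?B (fst kl) (snd kl))) (dc kl)) v"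
    proof (cases "v \<in> vecs ?X")
      case True
      have "\<theta> v = (\<Sum>k\<le>r. \<Sum>l\<le>s. v (coord_form r s k l) * \<theta> (?B k l))"
        using nabla_tensor_linear_expansion[OF _ True] \<theta> unfolding D by blast
      then show ?thesis using True
        by (simp add: sum_fun_apply dc_def sum.cartesian_product case_prod_beta mult.commute)
    next
      case False
      then show ?thesis using \<theta> by (simp add: D sum_fun_apply dc_def case_prod_beta)
    qed
  qed
  have finD: "finite (dc ` ({..r} \<times> {..s}))" by simp
  have spanD: "vecs (dual ?X) \<subseteq> fs.span (dc ` ({..r} \<times> {..s}))"
  proof
    fix \<theta> assume \<theta>: "\<theta> \<in> vecs (dual ?X)"
    have "(\<Sum>kl\<in>{..r} \<times> {..s}. fscal (\<theta> (?B (fst kl) (snd kl))) (dc kl)) \<in> fs.span (dc ` ({..r} \<times> {..s}))"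
      by (rule fs.span_sum, rule fs.span_scale, rule fs.span_base, rule imageI)
    then show "\<theta> \<in> fs.span (dc ` ({..r} \<times> {..s}))" by (simp only: expand[OF \<theta>, symmetric])
  qed
  have dimD: "card ({..r} \<times> {..s}) \<le> fs.dim (vecs (dual ?X))"
  proof (rule independent_by_coordinates[where e = "\<lambda>kl \<theta>. \<theta> (?B (fst kl) (snd kl))" and x = dc])
    show "finite (dc ` ({..r} \<times> {..s}))" "vecs (dual ?X) \<subseteq> fs.span (dc ` ({..r} \<times> {..s}))" by (rule finD, rule spanD)
    show "dc kl \<in> vecs (dual ?X)" for kl by (rule dcD)
    fix i j :: "nat \<times> nat" assume "i \<in> {..r} \<times> {..s}" "j \<in> {..r} \<times> {..s}"
    then show "dc j (?B (fst i) (snd i)) = (if i = j then 1 else 0)"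
      by (cases i; cases j) (simp add: dc_def basis_tensor_mem basis_tensor_coord_form)
  qed auto
  show ?thesis
  proof (rule weyl_filtration_from_vectors[where w = "?B 0" and l = "\<lambda>j. r + s - 2 * j" and m = "m + 1" and B = "dc ` ({..r} \<times> {..s})"])
    show "rational_module ?X" by (rule rational_nabla_tensor)
    show "scal ?X = fscal" by simp
    show "?B 0 i \<in> vecs ?X" if "i < m + 1" for i using that by (intro basis_tensor_mem) (auto simp: m_def)
    show "finite (dc ` ({..r} \<times> {..s}))" "vecs (dual ?X) \<subseteq> fs.span (dc ` ({..r} \<times> {..s}))" by (rule finD, rule spanD)
    show "(\<Sum>i<m + 1. r + s - 2 * i + 1) \<le> fs.dim (vecs (dual ?X))"
      unfolding m_def sum_highest_weights using dimD by (simp add: card_cartesian_product)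
    show "v = 0" if v: "v \<in> vecs ?X" and z: "\<And>\<theta>. \<theta> \<in> vecs (dual ?X) \<Longrightarrow> \<theta> v = 0" for v
    proof (rule nabla_tensor_eqI[OF v fs.subspace_0[OF tensor_subspace]])
      fix k l :: nat
      show "v (coord_form r s k l) = 0 (coord_form r s k l)" using z[OF dcD[of "(k, l)"]] v by (simp add: dc_def)
    qed
    show "\<theta> = 0" if \<theta>: "\<theta> \<in> vecs (dual ?X)" and z: "\<And>j g. j < m + 1 \<Longrightarrow> g \<in> SL2 \<Longrightarrow> \<theta> (act ?X g (?B 0 j)) = 0" for \<theta>
    proof -
      have "P \<theta>" using \<theta> z by (simp add: P_def D)
      then have "(\<Sum>kl\<in>{..r} \<times> {..s}. fscal (\<theta> (?B (fst kl) (snd kl))) (dc kl)) = 0"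
        by (intro sum.neutral) (auto simp: zero)
      then show ?thesis by (simp only: expand[OF \<theta>, symmetric])
    qed
  next
    fix i \<theta> and b :: "'k ^ 2 ^ 2"
    assume i: "i < m + 1" and \<theta>: "\<theta> \<in> vecs (dual ?X)" and b: "b \<in> borel2"
      and z: "\<And>j g. j < i \<Longrightarrow> g \<in> SL2 \<Longrightarrow> \<theta> (act ?X g (?B 0 j)) = 0"
    have irs: "i \<le> r" "i \<le> s" using i by (auto simp: m_def)
    have bS: "b \<in> SL2" "b $ 1 $ 2 = 0" using b by (auto simp: borel2_def)
    have det: "b $ 1 $ 1 * b $ 2 $ 2 = 1" using SL2_det[OF bS(1)] bS(2) by simp
    let ?c = "matrix_inv b"
    have c: "?c \<in> SL2" by (rule matrix_inv_SL2(1)[OF bS(1)])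
    have ce: "?c $ 1 $ 1 = b $ 2 $ 2" "?c $ 1 $ 2 = 0" "?c $ 2 $ 2 = b $ 1 $ 1"
      using matrix_inv_SL2_eq[OF bS(1)] bS(2) by simp_all
    have \<theta>0: "\<theta> (?B 0 j) = 0" if "j < i" for j using z[OF that SL2_one] by (simp add: act_nabla_tensor_one)
    let ?L = "\<lambda>r a i. of_nat (a choose i) * (?c $ 1 $ 1 ^ i * ?c $ 2 $ 1 ^ (a - i) * ?c $ 2 $ 2 ^ (r - a)) :: 'k"
    have "\<theta> (act ?X ?c (?B 0 i)) = (\<Sum>k\<le>r. \<Sum>l\<le>s. ?L r 0 k * ?L s i l * \<theta> (?B k l))"
      unfolding act_basis_tensor[OF c act_monomial_lower[OF c ce(2) le0] act_monomial_lower[OF c ce(2) irs(2)]]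
      using \<theta> unfolding D by (intro nabla_tensor_linear_value) blast
    also have "\<dots> = (\<Sum>k\<le>r. \<Sum>l\<le>s. if l = i then (if k = 0 then ?L r 0 0 * ?L s i i * \<theta> (?B 0 i) else 0) else 0)"
    proof (intro sum.cong refl)
      fix k l :: nat
      consider "k \<noteq> 0" | "k = 0" "l < i" | "k = 0" "l = i" | "k = 0" "i < l" by linarith
      then show "?L r 0 k * ?L s i l * \<theta> (?B k l) = (if l = i then (if k = 0 then ?L r 0 0 * ?L s i i * \<theta> (?B 0 i) else 0) else 0)"
        by cases (auto simp: binomial_eq_0 \<theta>0)
    qed
    also have "\<dots> = ?L r 0 0 * ?L s i i * \<theta> (?B 0 i)" using irs by simp
    also have "?L r 0 0 * ?L s i i = b $ 1 $ 1 ^ r * (b $ 1 $ 1 ^ (s - i) * b $ 2 $ 2 ^ i)" by (simp add: ce)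
    also have "\<dots> = b $ 1 $ 1 ^ (r + s - 2 * i)" by (rule torus_power_cancel[OF det irs])
    finally show "\<theta> (act ?X ?c (?B 0 i)) = b $ 1 $ 1 ^ (r + s - 2 * i) * \<theta> (?B 0 i)" .
  qed
qed

section \<open>Exchanging the factors\<close>

lemma filtration_with_transport:
  fixes \<sigma> :: "'v::ab_group_add \<Rightarrow> 'w::ab_group_add" and \<tau> :: "'w \<Rightarrow> 'v"
    and M :: "('k::field, 'v) gmodule" and M' :: "('k, 'w) gmodule"
    and S :: "nat \<Rightarrow> ('k, 'z::ab_group_add) gmodule"
  assumes inv: "\<And>x. \<tau> (\<sigma> x) = x" "\<And>y. \<sigma> (\<tau> y) = y"
    and add: "\<And>x y. \<sigma> (x + y) = \<sigma> x + \<sigma> y"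
    and sc: "\<And>c x. \<sigma> (scal M c x) = scal M' c (\<sigma> x)"
    and ac: "\<And>g x. \<sigma> (act M g x) = act M' g (\<sigma> x)"
    and vecs: "\<sigma> ` vecs M = vecs M'"
    and m: "module (scal M)" "module (scal M')"
    and filt: "filtration_with S M"
  shows "filtration_with S M'"
proof -
  obtain n F where nF: "F 0 = {0} \<and> F n = vecs M \<and> (\<forall>i\<le>n. submodule_of (F i) M) \<and>
      (\<forall>i<n. F i \<subseteq> F (Suc i) \<and> (F (Suc i) = F i \<or> (\<exists>u. quotient_iso M (F (Suc i)) (F i) (S u))))"
    using filt unfolding filtration_with_def by (elim exE) (rule that)
  then have F: "F 0 = {0}" "F n = vecs M" and Fsub: "\<And>i. i \<le> n \<Longrightarrow> submodule_of (F i) M"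
    and Fmono: "\<And>i. i < n \<Longrightarrow> F i \<subseteq> F (Suc i)"
    and Fquot: "\<And>i. i < n \<Longrightarrow> F (Suc i) = F i \<or> (\<exists>u. quotient_iso M (F (Suc i)) (F i) (S u))"
    by simp_all
  have \<sigma>0: "\<sigma> 0 = 0" using add[of 0 0] by simp
  have img: "\<tau> ` \<sigma> ` C = C" for C using inv(1) by (auto simp: image_image)
  have cos: "coset (\<sigma> ` U) (\<sigma> v) = \<sigma> ` coset U v" for U v by (simp add: coset_def image_image add)
  have sub: "submodule_of (\<sigma> ` U) M'" if U: "submodule_of U M" for U
  proof -
    have s: "module.subspace (scal M) U" "U \<subseteq> vecs M" "\<And>g x. g \<in> SL2 \<Longrightarrow> x \<in> U \<Longrightarrow> act M g x \<in> U"
      using U by (auto simp: submodule_of_def)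
    have "module.subspace (scal M') (\<sigma> ` U)"
      unfolding module.subspace_def[OF m(2)]
    proof (intro conjI ballI allI)
      show "0 \<in> \<sigma> ` U" using module.subspace_0[OF m(1) s(1)] \<sigma>0 by force
      show "x + y \<in> \<sigma> ` U" if "x \<in> \<sigma> ` U" "y \<in> \<sigma> ` U" for x y
        using that module.subspace_add[OF m(1) s(1)] by (auto simp: add[symmetric])
      show "scal M' c x \<in> \<sigma> ` U" if "x \<in> \<sigma> ` U" for c x
        using that module.subspace_scale[OF m(1) s(1)] by (auto simp: sc[symmetric])
    qed
    moreover have "\<sigma> ` U \<subseteq> vecs M'" using s(2) vecs by blast
    moreover have "act M' g ` \<sigma> ` U \<subseteq> \<sigma> ` U" if "g \<in> SL2" for g
      using s(3)[OF that] by (auto simp: ac[symmetric])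
    ultimately show ?thesis by (simp add: submodule_of_def)
  qed
  have iso: "quotient_iso M' (\<sigma> ` V) (\<sigma> ` U) N" if q: "quotient_iso M V U N" for V U and N :: "('k, 'z) gmodule"
  proof -
    obtain G where bij: "bij_betw G (coset U ` V) (vecs N)"
      and G: "\<forall>v\<in>V. \<forall>w\<in>V. G (coset U (v + w)) = G (coset U v) + G (coset U w)"
        "\<forall>c. \<forall>v\<in>V. G (coset U (scal M c v)) = scal N c (G (coset U v))"
        "\<forall>g\<in>SL2. \<forall>v\<in>V. G (coset U (act M g v)) = act N g (G (coset U v))"
      using q unfolding quotient_iso_def by (elim exE conjE) (rule that)
    have "bij_betw ((`) \<tau>) (coset (\<sigma> ` U) ` \<sigma> ` V) (coset U ` V)"
    proof (rule bij_betw_imageI)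
      show "inj_on ((`) \<tau>) (coset (\<sigma> ` U) ` \<sigma> ` V)"
        by (rule inj_on_inverseI[of _ "(`) \<sigma>"]) (use inv(2) in \<open>auto simp: image_image\<close>)
      show "(`) \<tau> ` coset (\<sigma> ` U) ` \<sigma> ` V = coset U ` V"
        by (simp add: image_image cos inv(1))
    qed
    then have b: "bij_betw (\<lambda>C. G (\<tau> ` C)) (coset (\<sigma> ` U) ` \<sigma> ` V) (vecs N)"
      using bij_betw_trans[OF _ bij] by (simp add: comp_def)
    have val: "G (\<tau> ` coset (\<sigma> ` U) (\<sigma> v)) = G (coset U v)" for v by (simp add: cos img)
    show ?thesis
      unfolding quotient_iso_def
    proof (intro exI[of _ "\<lambda>C. G (\<tau> ` C)"] conjI b ballI allI)
      fix v w assume "v \<in> \<sigma> ` V" "w \<in> \<sigma> ` V"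
      then obtain v' w' where "v' \<in> V" "v = \<sigma> v'" "w' \<in> V" "w = \<sigma> w'" by blast
      then show "G (\<tau> ` coset (\<sigma> ` U) (v + w)) = G (\<tau> ` coset (\<sigma> ` U) v) + G (\<tau> ` coset (\<sigma> ` U) w)"
        using G(1) by (simp only: add[symmetric] val)
    next
      fix c v assume "v \<in> \<sigma> ` V"
      then obtain v' where "v' \<in> V" "v = \<sigma> v'" by blast
      then show "G (\<tau> ` coset (\<sigma> ` U) (scal M' c v)) = scal N c (G (\<tau> ` coset (\<sigma> ` U) v))"
        using G(2) by (simp only: sc[symmetric] val)
    next
      fix g :: "'k ^ 2 ^ 2" and v assume "g \<in> SL2" "v \<in> \<sigma> ` V"
      then obtain v' where "v' \<in> V" "v = \<sigma> v'" by blast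
      then show "G (\<tau> ` coset (\<sigma> ` U) (act M' g v)) = act N g (G (\<tau> ` coset (\<sigma> ` U) v))"
        using G(3) \<open>g \<in> SL2\<close> by (simp only: ac[symmetric] val)
    qed
  qed
  show ?thesis
    unfolding filtration_with_def
  proof (intro exI[of _ n] exI[of _ "\<lambda>i. \<sigma> ` F i"] conjI allI impI)
    show "\<sigma> ` F 0 = {0}" "\<sigma> ` F n = vecs M'" using F \<sigma>0 vecs by simp_all
    show "submodule_of (\<sigma> ` F i) M'" if "i \<le> n" for i by (rule sub[OF Fsub[OF that]])
    show "\<sigma> ` F i \<subseteq> \<sigma> ` F (Suc i)" if "i < n" for i by (rule image_mono[OF Fmono[OF that]])
    show "\<sigma> ` F (Suc i) = \<sigma> ` F i \<or> (\<exists>u. quotient_iso M' (\<sigma> ` F (Suc i)) (\<sigma> ` F i) (S u))" if "i < n" for i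
    proof -
      from Fquot[OF that] consider "F (Suc i) = F i" | u where "quotient_iso M (F (Suc i)) (F i) (S u)" by blast
      then show ?thesis
      proof cases
        case 2
        from iso[OF this] show ?thesis by blast
      qed simp
    qed
  qed
qed

text \<open>
  The isomorphism that takes \<open>v \<otimes> w\<close> to \<open>w \<otimes> v\<close>.
\<close>

definition exchange :: "(('v \<Rightarrow> 'w \<Rightarrow> 'k) \<Rightarrow> 'k) \<Rightarrow> ('w \<Rightarrow> 'v \<Rightarrow> 'k) \<Rightarrow> 'k" where
  "exchange t = (\<lambda>b. t (\<lambda>v w. b w v))"

lemma exchange_pure_tensor: "exchange (pure_tensor M N v w) = pure_tensor N M w v"
proof -
  have "bilinear_form M N (\<lambda>v w. b w v) \<longleftrightarrow> bilinear_form N M b" for b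
    by (auto simp: bilinear_form_def)
  then show ?thesis by (simp add: exchange_def pure_tensor_def fun_eq_iff)
qed

lemma exchange_linear: "exchange (x + y) = exchange x + exchange y" "exchange (fscal c x) = fscal c (exchange x)"
  by (simp_all add: exchange_def fun_eq_iff)

lemma exchange_vecs:
  fixes M :: "('k::field, 'v::ab_group_add) gmodule" and N :: "('k, 'w::ab_group_add) gmodule"
  shows "exchange ` vecs (tensor M N) \<subseteq> vecs (tensor N M)"
proof
  fix y assume "y \<in> exchange ` vecs (tensor M N)"
  then obtain t where t: "t \<in> fs.span {pure_tensor M N v w | v w. v \<in> vecs M \<and> w \<in> vecs N}" and y: "y = exchange t"
    unfolding vecs_tensor by blast
  from t have "exchange t \<in> vecs (tensor N M)"
  proof (induction rule: fs.span_induct_alt)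
    case base
    have "exchange (0 :: ('v \<Rightarrow> 'w \<Rightarrow> 'k) \<Rightarrow> 'k) = 0" by (simp add: exchange_def fun_eq_iff)
    then show ?case using fs.subspace_0[OF tensor_subspace, of N M] by (simp only:)
  next
    case (step c x y)
    then obtain v w where x: "x = pure_tensor M N v w" "v \<in> vecs M" "w \<in> vecs N" by blast
    then have "exchange x \<in> vecs (tensor N M)"
      unfolding x(1) exchange_pure_tensor vecs_tensor by (intro fs.span_base) blast
    from fs.subspace_add[OF tensor_subspace fs.subspace_scale[OF tensor_subspace this, of c] step.IH]
    show ?case unfolding exchange_linear .
  qed
  then show "y \<in> vecs (tensor N M)" by (simp add: y)
qed

lemma filtration_with_exchange:
  fixes M :: "('k::field, 'v::ab_group_add) gmodule" and N :: "('k, 'w::ab_group_add) gmodule"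
  assumes "filtration_with S (tensor M N)" shows "filtration_with S (tensor N M)"
proof (rule filtration_with_transport[where \<sigma> = exchange and \<tau> = exchange, OF _ _ _ _ _ _ _ _ assms])
  show "exchange (exchange x) = x" for x :: "('v \<Rightarrow> 'w \<Rightarrow> 'k) \<Rightarrow> 'k" by (simp add: exchange_def)
  show "exchange (x + y) = exchange x + exchange y" for x y :: "('v \<Rightarrow> 'w \<Rightarrow> 'k) \<Rightarrow> 'k" by (rule exchange_linear)
  show "exchange (scal (tensor M N) c x) = scal (tensor N M) c (exchange x)" for c x by (simp add: exchange_linear)
  show "exchange (act (tensor M N) g x) = act (tensor N M) g (exchange x)" for g x
    by (simp add: exchange_def act_tensor)
  show "exchange ` vecs (tensor M N) = vecs (tensor N M)"
  proof
    show "vecs (tensor N M) \<subseteq> exchange ` vecs (tensor M N)"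
    proof
      fix y assume "y \<in> vecs (tensor N M)"
      then have "exchange y \<in> vecs (tensor M N)" using exchange_vecs[of N M] by blast
      moreover have "y = exchange (exchange y)" by (simp add: exchange_def)
      ultimately show "y \<in> exchange ` vecs (tensor M N)" by blast
    qed
  qed (rule exchange_vecs)
qed (simp_all add: module_fscal exchange_def)

lemma good_filtration_nabla_tensor:
  "good_filtration (nabla_tensor r s :: ('k::alg_closed_field, _) gmodule)"
proof (cases "s \<le> r")
  case True
  then show ?thesis by (rule good_filtration_nabla_tensor_le)
next
  case False
  then have "good_filtration (nabla_tensor s r :: ('k, _) gmodule)" by (intro good_filtration_nabla_tensor_le) simp
  then show ?thesis unfolding good_filtration_def by (rule filtration_with_exchange)
qed

section \<open>The tilting criterion\<close>

text \<open>
  Unlike the final statement this criterion includes all pairs of \<open>p\<close>-restricted weights, for which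
  \<open>steinberg_dominates\<close> always holds.
\<close>

theorem tilting_nabla_tensor_iff:
  assumes p: "prime CHAR('k::alg_closed_field)"
  shows "tilting (nabla_tensor r s :: ('k, _) gmodule)
    \<longleftrightarrow> steinberg_dominates CHAR('k) r s \<or> steinberg_dominates CHAR('k) s r"
proof
  assume "tilting (nabla_tensor r s :: ('k, _) gmodule)"
  then have "weyl_filtration (nabla_tensor r s :: ('k, _) gmodule)" by (simp add: tilting_def)
  then show "steinberg_dominates CHAR('k) r s \<or> steinberg_dominates CHAR('k) s r"
    using excess_forms_exist[OF p, of r s] excess_forms_not_weyl_filtration[where 'k='k] by blast
next
  have W: "weyl_filtration (nabla_tensor r s :: ('k, _) gmodule)" if "steinberg_dominates CHAR('k) r s" for r s
    using that weyl_filtration_nabla_tensor_steinberg[OF p] unfolding steinberg_dominates_def by blast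
  assume "steinberg_dominates CHAR('k) r s \<or> steinberg_dominates CHAR('k) s r"
  then have "weyl_filtration (nabla_tensor r s :: ('k, _) gmodule)"
  proof
    assume "steinberg_dominates CHAR('k) s r"
    from W[OF this] show ?thesis unfolding weyl_filtration_def by (rule filtration_with_exchange)
  qed (rule W)
  then show "tilting (nabla_tensor r s :: ('k, _) gmodule)"
    by (simp add: tilting_def rational_nabla_tensor good_filtration_nabla_tensor)
qed

theorem theorem1p3:
  fixes p r s :: nat
  assumes "CHAR('k::alg_closed_field) = p" and "p > 0"
    and "r \<ge> 1" and "s \<ge> 1"
    and "\<not> (r \<in> {0..p - 1} \<and> s \<in> {0..p - 1})"
  shows "tilting (tensor (nabla r :: ('k, 'k ^ 2 ^ 2 \<Rightarrow> 'k) gmodule) (nabla s)) \<longleftrightarrow>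
    (\<exists>a n. a \<in> {1..p - 1} \<and> n \<ge> 1 \<and>
       (r = a * p ^ n - 1 \<and> s < p ^ (n + 1) - 1 \<or>
        s = a * p ^ n - 1 \<and> r < p ^ (n + 1) - 1))"
proof -
  have prime: "prime CHAR('k)" using assms(1,2) by (intro prime_CHAR) simp
  then have p2: "p \<ge> 2" using assms(1) prime_ge_2_nat by blast
  let ?R = "\<lambda>r s a n. a \<in> {1..p - 1} \<and> n \<ge> 1 \<and> (r = a * p ^ n - 1 \<and> s < p ^ (n + 1) - 1 \<or> s = a * p ^ n - 1 \<and> r < p ^ (n + 1) - 1)"
  have forward: "\<exists>a n. ?R r s a n" if d: "steinberg_dominates p r s" and nr: "\<not> (r < p \<and> s < p)" for r s
  proof -
    obtain a n where a: "1 \<le> a" "a < p" "r + 1 = a * p ^ n" "s < p ^ (n + 1)"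
      using d unfolding steinberg_dominates_def by blast
    have n: "n \<ge> 1" using a nr by (cases n) auto
    show ?thesis
    proof (cases "s = p ^ (n + 1) - 1")
      case False
      then have "?R r s a n" using a n by auto
      then show ?thesis by blast
    next
      case True
      have "a * p ^ n < p * p ^ n" using a p2 by simp
      also have "\<dots> = p ^ (n + 1)" by simp
      also have "\<dots> \<le> p ^ (n + 1 + 1)" using p2 by (intro power_increasing) auto
      finally have "r < p ^ (n + 1 + 1) - 1" using a(3) by linarith
      then have "?R r s 1 (n + 1)" using True p2 by auto
      then show ?thesis by blast
    qed
  qed
  have swap: "?R r s a n \<longleftrightarrow> ?R s r a n" for r s a n by blast
  have backward: "steinberg_dominates p r s" if "a \<in> {1..p - 1}" "r = a * p ^ n - 1" "s < p ^ (n + 1) - 1" for r s a n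
  proof -
    have "1 \<le> a * p ^ n" using that p2 by (simp add: Suc_le_eq)
    then show ?thesis unfolding steinberg_dominates_def using that p2 by (intro exI[of _ a] exI[of _ n]) auto
  qed
  have nr: "\<not> (r < p \<and> s < p)" using assms(5) p2 by auto
  have "steinberg_dominates p r s \<or> steinberg_dominates p s r \<longleftrightarrow> (\<exists>a n. ?R r s a n)"
    using forward[of r s] forward[of s r] nr backward swap by meson
  then show ?thesis using tilting_nabla_tensor_iff[OF prime, of r s] assms(1) by simp
qed

end
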